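(* Let $m\ge 2$ and $n\ge 3$ be integers, $\omega=e^{2\pi i/m}$, and $W=G(m,1,n)$. Let $\sigma\in\mathfrak S_n\subset W$ be (the permutation matrix of) an $n$-cycle, let $z=g_1g_2\cdots g_n=\omega I_n$, and let $C=\langle \sigma, z\rangle\subset W$. Let $\chi$ be the one-dimensional character of the abelian group $C$ with $\chi(\sigma)=e^{2\pi i/n}$ and $\chi(z)=\omega^{n-1}$. Then there is an isomorphism of representations of $W$ \[ S_{\mathcal G^\perp,-2}(\mathrm{top})\cong \mathrm{Ind}_C^W(\chi). \]
   Context: $G(m,1,n)$ is the group of $n\times n$ monomial matrices (exactly one nonzero entry in each row and column) whose nonzero entries are $m$-th roots of unity, acting on $\mathbf C^n$ with standard basis $e_1,\dots,e_n$. It contains the permutation matrices, identified with $\mathfrak S_n$ via $\pi e_i=e_{\pi(i)}$, and the diagonal matrices $g_i$ whose $i$-th diagonal entry is $\omega$ and all others $1$. Internal zonotopal algebra: for a finite set $\mathcal A$ of linear hyperplanes in a finite-dimensional complex vector space $U$ and $u\in U$, let $\rho_{\mathcal A}(u)$ be the number of hyperplanes of $\mathcal A$ not containing $u$; let $I_{\mathcal A,-2}\subset \mathrm{Sym}(U)$ be the ideal generated by $u^{\max\{\rho_{\mathcal A}(u)-1,0\}}$ for $u\in U$, and $S_{\mathcal A,-2}=\mathrm{Sym}(U)/I_{\mathcal A,-2}$ (a finite-dimensional graded algebra). $S_{\mathcal A,-2}(\mathrm{top})$ denotes its nonzero graded component of largest degree. The arrangement $\mathcal G^\perp$: let $\mathbf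 C^{\mathcal G}$ have basis $h_i$ ($1\le i\le n$) and $h_{ij}^k$ ($1\le i<j\le n$, $0\le k<m$), and let $\varphi:\mathbf C^{\mathcal G}\to\mathbf C^n$ be the linear map $h_i\mapsto e_i$, $h_{ij}^k\mapsto e_i-\omega^k e_j$ (these vectors correspond to the hyperplanes $x_i=0$, $x_i-\omega^kx_j=0$ of the reflection arrangement $\mathcal G$ of $W$). Let $K=\ker\varphi$ and let $\mathcal G^\perp$ be the arrangement in $K$ consisting of the hyperplanes $\ker(h^*|_K)$, where $h^*$ runs over the coordinate functionals dual to the basis $h_i,h_{ij}^k$. Each $w\in W$ maps each vector $v$ in the set $\{e_i\}\cup\{e_i-\omega^ke_j\}$ to $c\,v'$ for a unique $v'$ in this set and scalar $c$; letting $w$ send the corresponding basis vector $h_v$ to $c\,h_{v'}$ defines a linear $W$-action on $\mathbf C^{\mathcal G}$ for which $\varphi$ is equivariant; hence $K$ and $\mathcal G^\perp$ are $W$-stable, $W$ acts on $\mathrm{Sym}(K)$ preserving $I_{\mathcal G^\perp,-2}$, and $S_{\mathcal G^\perp,-2}$ is a graded representation of $W$.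
   Formalization: The ideal defining the internal zonotopal algebra is generated by the powers of nonzero u only; taking u = 0 literally would give the generator 0^0 = 1, make the algebra zero, and leave its top component undefined. *)

theory Defs
  imports
    "HOL-Library.Poly_Mapping"
    "HOL-Combinatorics.Orbits"
    "HOL-Algebra.QuotRing"
    "HOL-Algebra.Generated_Groups"
    "Jordan_Normal_Form.VS_Connect"
begin

section \<open>Complex representations\<close>

locale group_rep =
  group G + vectorspace "class_ring :: complex ring" V
  for G :: "('g, 'x) monoid_scheme"
    and V :: "(complex, 'v) module"
    and \<rho> :: "'g \<Rightarrow> 'v \<Rightarrow> 'v" +
  assumes rho_linear: "g \<in> carrier G \<Longrightarrow> linear_map class_ring V V (\<rho> g)"
    and rho_one: "v \<in> carrier V \<Longrightarrow> \<rho> \<one>\<^bsub>G\<^esub> v = v"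
    and rho_mult: "\<lbrakk>g \<in> carrier G; h \<in> carrier G; v \<in> carrier V\<rbrakk>
      \<Longrightarrow> \<rho> (g \<otimes>\<^bsub>G\<^esub> h) v = \<rho> g (\<rho> h v)"

definition rep_isomorphic ::
  "('g, 'x) monoid_scheme \<Rightarrow> (complex, 'v) module \<Rightarrow> ('g \<Rightarrow> 'v \<Rightarrow> 'v)
     \<Rightarrow> (complex, 'w) module \<Rightarrow> ('g \<Rightarrow> 'w \<Rightarrow> 'w) \<Rightarrow> bool" where
  "rep_isomorphic G V \<rho> V' \<rho>' \<longleftrightarrow>
     group_rep G V \<rho> \<and> group_rep G V' \<rho>' \<and>
     (\<exists>T. linear_map class_ring V V' T \<and> bij_betw T (carrier V) (carrier V') \<and>
          (\<forall>g\<in>carrier G. \<forall>v\<in>carrier V. T (\<rho> g v) = \<rho>' g (T v)))"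

definition linear_character ::
  "('g, 'x) monoid_scheme \<Rightarrow> 'g set \<Rightarrow> ('g \<Rightarrow> complex) \<Rightarrow> bool" where
  "linear_character G C \<chi> \<longleftrightarrow> \<chi> \<in> hom (G\<lparr>carrier := C\<rparr>) (units_of (class_ring :: complex ring))"

text \<open>
  The representation of a finite group \<open>G\<close> induced from a one-dimensional character \<open>\<chi>\<close> of a
  subgroup \<open>C\<close>, in its usual function model: functions \<open>f\<close> on \<open>G\<close> with \<open>f (g c) = \<chi>(c)\<^sup>-\<^sup>1 f g\<close>,
  on which \<open>G\<close> acts by left translation.  The function supported on \<open>C\<close> with value \<open>\<chi>(c)\<^sup>-\<^sup>1\<close> at
  \<open>c\<close> spans a copy of \<open>\<chi>\<close>, whose translates by coset representatives decompose the space.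
  Functions are normalised to vanish off the carrier; the ring fields \<open>mult\<close> and \<open>one\<close> of a
  module record are irrelevant.
\<close>

definition induced_module ::
  "('g, 'x) monoid_scheme \<Rightarrow> 'g set \<Rightarrow> ('g \<Rightarrow> complex) \<Rightarrow> (complex, 'g \<Rightarrow> complex) module" where
  "induced_module G C \<chi> =
     \<lparr>carrier = {f. (\<forall>g\<in>carrier G. \<forall>c\<in>C. f (g \<otimes>\<^bsub>G\<^esub> c) = inverse (\<chi> c) * f g) \<and>
                    (\<forall>g. g \<notin> carrier G \<longrightarrow> f g = 0)},
      mult = undefined, one = undefined,
      zero = (\<lambda>_. 0), add = (\<lambda>f f' g. f g + f' g), smult = (\<lambda>a f g. a * f g)\<rparr>"

definition induced_action ::
  "('g, 'x) monoid_scheme \<Rightarrow> 'g \<Rightarrow> ('g \<Rightarrow> complex) \<Rightarrow> 'g \<Rightarrow> complex" where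
  "induced_action G h f = (\<lambda>g. if g \<in> carrier G then f (inv\<^bsub>G\<^esub> h \<otimes>\<^bsub>G\<^esub> g) else 0)"


section \<open>Symmetric algebras of subspaces of coordinate spaces\<close>

text \<open>
  A vector of the complex vector space with basis \<open>'i\<close> is a finitely supported function
  \<open>'i \<Rightarrow>\<^sub>0 complex\<close>, and the symmetric algebra of that space is the polynomial ring
  \<open>('i \<Rightarrow>\<^sub>0 nat) \<Rightarrow>\<^sub>0 complex\<close> in variables indexed by \<open>'i\<close>.  For a linear subspace \<open>U\<close> the
  inclusion induces an injective graded homomorphism of symmetric algebras (a basis of \<open>U\<close> extends
  to one of the whole space); \<open>Sym(U)\<close> is taken to be its image, the unital subalgebra generated
  by \<open>U\<close>.
\<close>

type_synonym 'i cpoly = "('i \<Rightarrow>\<^sub>0 nat) \<Rightarrow>\<^sub>0 complex"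

definition poly_const :: "complex \<Rightarrow> 'i cpoly" where
  "poly_const c = Poly_Mapping.single 0 c"

definition lin_form :: "('i \<Rightarrow>\<^sub>0 complex) \<Rightarrow> 'i cpoly" where
  "lin_form u = (\<Sum>i\<in>Poly_Mapping.keys u.
     Poly_Mapping.single (Poly_Mapping.single i 1) (Poly_Mapping.lookup u i))"

inductive_set sym_carrier :: "('i \<Rightarrow>\<^sub>0 complex) set \<Rightarrow> 'i cpoly set"
  for U :: "('i \<Rightarrow>\<^sub>0 complex) set" where
  const: "poly_const c \<in> sym_carrier U"
| lin: "u \<in> U \<Longrightarrow> lin_form u \<in> sym_carrier U"
| add: "p \<in> sym_carrier U \<Longrightarrow> q \<in> sym_carrier U \<Longrightarrow> p + q \<in> sym_carrier U"
| mult: "p \<in> sym_carrier U \<Longrightarrow> q \<in> sym_carrier U \<Longrightarrow> p * q \<in> sym_carrier U"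

definition sym_alg :: "('i \<Rightarrow>\<^sub>0 complex) set \<Rightarrow> 'i cpoly ring" where
  "sym_alg U = \<lparr>carrier = sym_carrier U, mult = (*), one = 1, zero = 0, add = (+)\<rparr>"

definition homogeneous :: "nat \<Rightarrow> 'i cpoly \<Rightarrow> bool" where
  "homogeneous d p \<longleftrightarrow>
     (\<forall>t\<in>Poly_Mapping.keys p. (\<Sum>i\<in>Poly_Mapping.keys t. Poly_Mapping.lookup t i) = d)"

text \<open>
  The algebra endomorphism of the polynomial ring that extends a linear map \<open>L\<close>; if \<open>L\<close> maps
  \<open>U\<close> to itself, its restriction to \<open>Sym(U)\<close> is \<open>Sym(L|\<^sub>U)\<close>.
\<close>

definition sym_map :: "(('i \<Rightarrow>\<^sub>0 complex) \<Rightarrow> ('i \<Rightarrow>\<^sub>0 complex)) \<Rightarrow> 'i cpoly \<Rightarrow> 'i cpoly" where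
  "sym_map L p = (\<Sum>t\<in>Poly_Mapping.keys p. poly_const (Poly_Mapping.lookup p t) *
     (\<Prod>i\<in>Poly_Mapping.keys t. lin_form (L (Poly_Mapping.single i 1)) ^ Poly_Mapping.lookup t i))"


section \<open>Internal zonotopal algebra\<close>

text \<open>An arrangement in \<open>U\<close> is a set of hyperplanes, each given as a subset of \<open>U\<close>.\<close>

definition arr_rho :: "('i \<Rightarrow>\<^sub>0 complex) set set \<Rightarrow> ('i \<Rightarrow>\<^sub>0 complex) \<Rightarrow> nat" where
  "arr_rho A u = card {H \<in> A. u \<notin> H}"

text \<open>
  Only nonzero \<open>u\<close> contribute generators: \<open>u = 0\<close> would contribute \<open>0\<^sup>0 = 1\<close> and make the algebra
  zero.  Subtraction on \<^typ>\<open>nat\<close> truncates, so the exponent is the maximum of \<open>\<rho>(u) - 1\<close> and \<open>0\<close>.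
\<close>

definition internal_ideal ::
  "('i \<Rightarrow>\<^sub>0 complex) set \<Rightarrow> ('i \<Rightarrow>\<^sub>0 complex) set set \<Rightarrow> 'i cpoly set" where
  "internal_ideal U A =
     genideal (sym_alg U) {lin_form u ^ (arr_rho A u - 1) | u. u \<in> U \<and> u \<noteq> 0}"

definition internal_alg ::
  "('i \<Rightarrow>\<^sub>0 complex) set \<Rightarrow> ('i \<Rightarrow>\<^sub>0 complex) set set \<Rightarrow> 'i cpoly set ring" where
  "internal_alg U A = sym_alg U Quot internal_ideal U A"

definition internal_comp ::
  "('i \<Rightarrow>\<^sub>0 complex) set \<Rightarrow> ('i \<Rightarrow>\<^sub>0 complex) set set \<Rightarrow> nat \<Rightarrow> 'i cpoly set set" where
  "internal_comp U A d =
     (\<lambda>p. internal_ideal U A +>\<^bsub>sym_alg U\<^esub> p) ` {p \<in> carrier (sym_alg U). homogeneous d p}"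

definition internal_top_degree ::
  "('i \<Rightarrow>\<^sub>0 complex) set \<Rightarrow> ('i \<Rightarrow>\<^sub>0 complex) set set \<Rightarrow> nat" where
  "internal_top_degree U A = (GREATEST d. internal_comp U A d \<noteq> {\<zero>\<^bsub>internal_alg U A\<^esub>})"

text \<open>
  A scalar acts through its image in the quotient algebra.
\<close>

definition internal_top ::
  "('i \<Rightarrow>\<^sub>0 complex) set \<Rightarrow> ('i \<Rightarrow>\<^sub>0 complex) set set \<Rightarrow> (complex, 'i cpoly set) module" where
  "internal_top U A =
     \<lparr>carrier = internal_comp U A (internal_top_degree U A),
      mult = mult (internal_alg U A), one = one (internal_alg U A),
      zero = zero (internal_alg U A), add = add (internal_alg U A),
      smult = (\<lambda>c X. (internal_ideal U A +>\<^bsub>sym_alg U\<^esub> poly_const c) \<otimes>\<^bsub>internal_alg U A\<^esub> X)\<rparr>"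


section \<open>The group \<open>G(m,1,n)\<close>, its reflection arrangement, and the dual arrangement\<close>

text \<open>Rows, columns and coordinates are numbered from \<open>0\<close> to \<open>n - 1\<close>.\<close>

definition omega :: "nat \<Rightarrow> complex" where
  "omega m = exp (2 * of_real pi * \<i> / of_nat m)"

definition monomial_group :: "nat \<Rightarrow> nat \<Rightarrow> complex mat monoid" where
  "monomial_group m n =
     \<lparr>carrier = {A \<in> carrier_mat n n.
        (\<forall>i<n. \<exists>!j. j < n \<and> A $$ (i, j) \<noteq> 0) \<and>
        (\<forall>j<n. \<exists>!i. i < n \<and> A $$ (i, j) \<noteq> 0) \<and>
        (\<forall>i<n. \<forall>j<n. A $$ (i, j) \<noteq> 0 \<longrightarrow> A $$ (i, j) ^ m = 1)},
      mult = (*), one = 1\<^sub>m n\<rparr>"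

definition perm_mat :: "nat \<Rightarrow> (nat \<Rightarrow> nat) \<Rightarrow> complex mat" where
  "perm_mat n \<pi> = mat n n (\<lambda>(a, b). if a = \<pi> b then 1 else 0)"

definition arr_vecs :: "nat \<Rightarrow> nat \<Rightarrow> complex vec set" where
  "arr_vecs m n =
     {unit_vec n i | i. i < n} \<union>
     {unit_vec n i - omega m ^ k \<cdot>\<^sub>v unit_vec n j | i j k. i < j \<and> j < n \<and> k < m}"

text \<open>
  The vectors listed in \<^const>\<open>arr_vecs\<close> are pairwise distinct, so they serve directly as indices
  of the basis of \<open>\<complex>\<^sup>\<G>\<close>: the basis vector \<open>h\<^sub>v\<close> is \<open>Poly_Mapping.single v 1\<close>, and \<open>\<complex>\<^sup>\<G>\<close>
  consists of the finitely supported functions with support in \<^const>\<open>arr_vecs\<close>.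
\<close>

definition arr_phi :: "nat \<Rightarrow> (complex vec \<Rightarrow>\<^sub>0 complex) \<Rightarrow> complex vec" where
  "arr_phi n f = vec n (\<lambda>a. \<Sum>v\<in>Poly_Mapping.keys f. Poly_Mapping.lookup f v * v $ a)"

definition arr_kernel :: "nat \<Rightarrow> nat \<Rightarrow> (complex vec \<Rightarrow>\<^sub>0 complex) set" where
  "arr_kernel m n = {f. Poly_Mapping.keys f \<subseteq> arr_vecs m n \<and> arr_phi n f = 0\<^sub>v n}"

definition dual_arr :: "nat \<Rightarrow> nat \<Rightarrow> (complex vec \<Rightarrow>\<^sub>0 complex) set set" where
  "dual_arr m n = (\<lambda>v. {f \<in> arr_kernel m n. Poly_Mapping.lookup f v = 0}) ` arr_vecs m n"

text \<open>For \<open>w\<close> in the group and \<open>v\<close> in \<^const>\<open>arr_vecs\<close>, these are the unique \<open>v'\<close> in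
  \<^const>\<open>arr_vecs\<close> and the scalar \<open>c\<close> with \<open>w v = c v'\<close>.\<close>

definition img_vec :: "nat \<Rightarrow> nat \<Rightarrow> complex mat \<Rightarrow> complex vec \<Rightarrow> complex vec" where
  "img_vec m n w v = (THE v'. v' \<in> arr_vecs m n \<and> (\<exists>c. w *\<^sub>v v = c \<cdot>\<^sub>v v'))"

definition img_scalar :: "nat \<Rightarrow> nat \<Rightarrow> complex mat \<Rightarrow> complex vec \<Rightarrow> complex" where
  "img_scalar m n w v = (THE c. w *\<^sub>v v = c \<cdot>\<^sub>v img_vec m n w v)"

definition hyp_action ::
  "nat \<Rightarrow> nat \<Rightarrow> complex mat \<Rightarrow> (complex vec \<Rightarrow>\<^sub>0 complex) \<Rightarrow> (complex vec \<Rightarrow>\<^sub>0 complex)" where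
  "hyp_action m n w f = (\<Sum>v\<in>Poly_Mapping.keys f.
     Poly_Mapping.single (img_vec m n w v) (Poly_Mapping.lookup f v * img_scalar m n w v))"

text \<open>The induced action on the quotient of \<open>Sym(K)\<close>, sending \<open>I + p\<close> to \<open>I + w p\<close> because \<open>w\<close>
  preserves the ideal \<open>I\<close>.\<close>

definition dual_action :: "nat \<Rightarrow> nat \<Rightarrow> complex mat \<Rightarrow> complex vec cpoly set \<Rightarrow> complex vec cpoly set"
  where "dual_action m n w X = sym_map (hyp_action m n w) ` X"

end

(*
  A pair (i, alpha) stands for the vector alpha e_i, and x p q in Sym(K) for the lift of the edge
  vector p - q to the kernel K; these lifts span K.  Kernel elements with at most three nonzero
  coordinates have square zero in S, which gives x p q * x p q' = 0 for q, q' on the same axis and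
  the triangle relation x a b * x b c + x b c * x c a + x c a * x a b = 0.  The relations
  straighten every product of edges into products in which distinct edges have distinct larger
  endpoints, so S vanishes in degrees >= n; the same relations express inserting a vertex into a
  path, so the degree n - 1 part is spanned by the paths P_d, where d runs over the stabiliser D
  of e_0 in W and P_1 is the path through e_0, sigma e_0, sigma^2 e_0, ...

  Conversely, send the edge between e_i and e_j to plus or minus a variable y attached to the
  later endpoint along sigma, and all other basis vectors to zero.  The image of a generator of the
  ideal lies in the ideal of the squares of the variables, so taking the coefficient of the product
  of all variables gives a functional on the top degree that is 1 on P_1 and 0 on the other P_d.
  Hence the P_d form a basis.

  For f in the induced representation put Psi f = sum over g in W of f(g) P_g.  Inserting the
  labels one after the other shows that the sum of q^imaj(l) P_l over all permutations l equals
  (1 - q) ... (1 - q^(n-1)) P_1, where imaj is the major index of the inverse permutation.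
  Rotating a word changes imaj by 1 modulo n, so for q = exp(-2 pi i / n) the left side is Psi F0
  with F0 in the induced representation.  Thus Psi is onto; since W = D C, its source has dimension
  at most |D|, so Psi is an isomorphism.
*)
theory Submission
  imports Defs
begin

text \<open>The value of the character at z reflects the degree: multiplying all vertices of a path
  by a root of unity \<open>\<gamma>\<close> multiplies the product of its n - 1 edges by the
  (n-1)-st power of \<open>\<gamma>\<close>. Its value at sigma reflects cyclic rotation of the
  vertex list. The inverse of exp(2 pi i / n) is taken for q because functions in the induced module
  transform by \<open>inverse (\<chi> c)\<close>; primitivity of q keeps the factors 1 - q^i
  nonzero.

  The functional kills the ideal for a counting reason. The exponent attached to a kernel element u
  is one less than the number r of its nonzero coordinates, while its image is a linear form in at
  most r - 2 variables. Every monomial of the (r-1)-st power of such a form repeats a variable.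

  Dimensions are never computed on either side. In the top degree the translates of the functional
  by D are dual to the paths. In the induced representation a function is determined by its values
  on D, so a square linear system indexed by D turns the independence of the D-translates of one
  function into the fact that they span.\<close>

abbreviation "lkp \<equiv> Poly_Mapping.lookup"
abbreviation "sgl \<equiv> Poly_Mapping.single"
abbreviation "kys \<equiv> Poly_Mapping.keys"

section \<open>Finitely supported functions and linear forms\<close>

lemma poly_mapping_eq_sum_single: "p = (\<Sum>k\<in>kys p. sgl k (lkp p k))"
  by (rule poly_mapping_eqI)
    (auto simp: lookup_sum lookup_single when_def in_keys_iff sum.delta if_distrib cong: if_cong)

text \<open>Linear forms, substitutions, degrees, coordinates and the group action are all sums over
  a support; each gets its additivity from here. Supports may shrink under addition, so all three
  sums are extended to the union of the supports.\<close>

lemma sum_keys_add: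
  fixes h :: "'k \<Rightarrow> 'b::comm_monoid_add \<Rightarrow> 'c::comm_monoid_add"
  assumes "\<And>k. h k 0 = 0" and "\<And>k a b. h k (a + b) = h k a + h k b"
  shows "(\<Sum>k\<in>kys (p + q). h k (lkp (p + q) k)) =
    (\<Sum>k\<in>kys p. h k (lkp p k)) + (\<Sum>k\<in>kys q. h k (lkp q k))"
proof -
  have *: "(\<Sum>k\<in>kys r. h k (lkp r k)) = (\<Sum>k\<in>kys p \<union> kys q. h k (lkp r k))"
    if "kys r \<subseteq> kys p \<union> kys q" for r
    using that assms(1) by (intro sum.mono_neutral_left) (auto simp: in_keys_iff)
  show ?thesis
    unfolding *[OF keys_add] *[OF Un_upper1] *[OF Un_upper2]
    using assms(2) by (simp add: sum.distrib lookup_add)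
qed

lemma poly_mapping_induct_single [case_names zero single_add]:
  assumes "P 0" and "\<And>k c p. P p \<Longrightarrow> P (sgl k c + p)"
  shows "P (p :: 'k \<Rightarrow>\<^sub>0 'b::comm_monoid_add)"
proof -
  have "P (\<Sum>k\<in>K. sgl k (lkp p k))" if "finite K" for K
    using that by induction (auto intro: assms)
  then show ?thesis
    by (metis poly_mapping_eq_sum_single finite_keys)
qed

definition cscale :: "complex \<Rightarrow> ('i \<Rightarrow>\<^sub>0 complex) \<Rightarrow> ('i \<Rightarrow>\<^sub>0 complex)" where
  "cscale c u = Poly_Mapping.map ((*) c) u"

lemma lookup_cscale [simp]: "lkp (cscale c u) i = c * lkp u i"
  by (auto simp: cscale_def map.rep_eq when_def)

lemma cscale_add: "cscale c (u + v) = cscale c u + cscale c v"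
  by (rule poly_mapping_eqI) (simp add: lookup_add algebra_simps)

lemma cscale_single [simp]: "cscale c (sgl i a) = sgl i (c * a)"
  by (rule poly_mapping_eqI) (simp add: lookup_single when_def)

lemma cscale_zero [simp]: "cscale c 0 = 0"
  by (rule poly_mapping_eqI) simp

lemma cscale_minus: "cscale c (u - v) = cscale c u - cscale c v"
  by (rule poly_mapping_eqI) (simp add: lookup_minus algebra_simps)

lemma poly_const_add: "poly_const (a + b) = poly_const a + poly_const b"
  by (simp add: poly_const_def single_add)

lemma poly_const_mult: "poly_const (a * b) = poly_const a * poly_const b"
  by (simp add: poly_const_def mult_single)

lemma poly_const_0 [simp]: "poly_const 0 = 0"
  by (simp add: poly_const_def)

lemma poly_const_1 [simp]: "poly_const 1 = 1"
  by (simp add: poly_const_def)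

lemma poly_const_uminus: "poly_const (- a) = - poly_const a"
  by (simp add: poly_const_def single_uminus)

lemma poly_const_mult_single: "poly_const a * sgl t b = sgl t (a * b)"
  by (simp add: poly_const_def mult_single)

lemma lookup_poly_const_mult: "lkp (poly_const a * p) t = a * lkp p t"
  by (induction p rule: poly_mapping_induct_single)
    (auto simp: ring_distribs poly_const_mult_single lookup_add lookup_single when_def)

lemma lin_form_0 [simp]: "lin_form 0 = 0"
  by (simp add: lin_form_def)

lemma lin_form_single: "lin_form (sgl i c) = sgl (sgl i 1) c"
  by (cases "c = 0") (auto simp: lin_form_def)

lemma lin_form_add: "lin_form (u + v) = lin_form u + lin_form v"
  unfolding lin_form_def by (rule sum_keys_add) (auto simp: single_add)

lemma lin_form_cscale: "lin_form (cscale c u) = poly_const c * lin_form u"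
  by (induction u rule: poly_mapping_induct_single)
    (simp_all add: cscale_add lin_form_add lin_form_single ring_distribs poly_const_mult_single)

lemma lin_form_uminus: "lin_form (- u) = - lin_form u"
  using lin_form_add[of u "-u"] by (simp add: eq_neg_iff_add_eq_0 add.commute)

lemma lin_form_diff: "lin_form (u - v) = lin_form u - lin_form v"
  using lin_form_add[of u "-v"] by (simp add: lin_form_uminus)

lemma lin_form_sum: "lin_form (\<Sum>a\<in>A. f a) = (\<Sum>a\<in>A. lin_form (f a))"
  by (induction A rule: infinite_finite_induct) (auto simp: lin_form_add)

section \<open>Substitution homomorphisms\<close>

text \<open>Common generalisation of \<open>sym_map\<close>, which substitutes linear forms in the
  same variables, and of the map \<open>\<theta>\<close> below, which also changes the set of
  variables.\<close>

definition poly_subst :: "('i \<Rightarrow> 'j cpoly) \<Rightarrow> 'i cpoly \<Rightarrow> 'j cpoly" where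
  "poly_subst \<phi> p =
    (\<Sum>t\<in>kys p. poly_const (lkp p t) * (\<Prod>i\<in>kys t. \<phi> i ^ lkp t i))"

lemma sym_map_eq_poly_subst: "sym_map L = poly_subst (\<lambda>i. lin_form (L (sgl i 1)))"
  by (rule ext) (simp add: sym_map_def poly_subst_def)

lemma poly_subst_add: "poly_subst \<phi> (p + q) = poly_subst \<phi> p + poly_subst \<phi> q"
  unfolding poly_subst_def by (rule sum_keys_add) (auto simp: poly_const_add ring_distribs)

lemma poly_subst_0 [simp]: "poly_subst \<phi> 0 = 0"
  by (simp add: poly_subst_def)

lemma poly_subst_single: "poly_subst \<phi> (sgl t c) = poly_const c * (\<Prod>i\<in>kys t. \<phi> i ^ lkp t i)"
  by (cases "c = 0") (auto simp: poly_subst_def)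

lemma poly_subst_const: "poly_subst \<phi> (poly_const c) = poly_const c"
  using poly_subst_single[of \<phi> 0 c] by (simp add: poly_const_def)

lemma poly_subst_1 [simp]: "poly_subst \<phi> 1 = 1"
  using poly_subst_const[of \<phi> 1] by simp

lemma prod_keys_power_add:
  fixes \<phi> :: "'i \<Rightarrow> 'a::comm_semiring_1"
  shows "(\<Prod>i\<in>kys (s + t). \<phi> i ^ lkp (s + t) i) =
    (\<Prod>i\<in>kys s. \<phi> i ^ lkp s i) * (\<Prod>i\<in>kys t. \<phi> i ^ lkp t i)"
proof -
  have *: "(\<Prod>i\<in>kys r. \<phi> i ^ lkp r i) = (\<Prod>i\<in>kys s \<union> kys t. \<phi> i ^ lkp r i)"
    if "kys r \<subseteq> kys s \<union> kys t" for r
    using that by (intro prod.mono_neutral_left) (auto simp: in_keys_iff)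
  show ?thesis
    unfolding *[OF keys_add] *[OF Un_upper1] *[OF Un_upper2]
    by (simp add: prod.distrib lookup_add power_add)
qed

lemma poly_subst_mult: "poly_subst \<phi> (p * q) = poly_subst \<phi> p * poly_subst \<phi> q"
proof -
  have single: "poly_subst \<phi> (sgl s a * q) = poly_subst \<phi> (sgl s a) * poly_subst \<phi> q" for s a
    by (induction q rule: poly_mapping_induct_single)
      (simp_all add: ring_distribs poly_subst_add mult_single poly_subst_single
        prod_keys_power_add poly_const_mult mult_ac)
  show ?thesis
    by (induction p rule: poly_mapping_induct_single)
      (simp_all add: ring_distribs poly_subst_add single)
qed

lemma poly_subst_uminus: "poly_subst \<phi> (- p) = - poly_subst \<phi> p"
  using poly_subst_add[of \<phi> p "-p"] by (simp add: eq_neg_iff_add_eq_0 add.commute)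

lemma poly_subst_diff: "poly_subst \<phi> (p - q) = poly_subst \<phi> p - poly_subst \<phi> q"
  using poly_subst_add[of \<phi> p "-q"] by (simp add: poly_subst_uminus)

lemma poly_subst_sum: "poly_subst \<phi> (\<Sum>a\<in>A. f a) = (\<Sum>a\<in>A. poly_subst \<phi> (f a))"
  by (induction A rule: infinite_finite_induct) (auto simp: poly_subst_add)

lemma poly_subst_power: "poly_subst \<phi> (p ^ k) = poly_subst \<phi> p ^ k"
  by (induction k) (auto simp: poly_subst_mult)

lemma poly_subst_lin_form:
  "poly_subst \<phi> (lin_form u) = (\<Sum>i\<in>kys u. poly_const (lkp u i) * \<phi> i)"
  by (simp add: lin_form_def poly_subst_sum poly_subst_single)

section \<open>Linear spans\<close>

text \<open>Adding one scaled generator at a time gives an induction with a single step case and no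
  index sets.\<close>

inductive_set cspan :: "'i cpoly set \<Rightarrow> 'i cpoly set" for G where
  zero: "0 \<in> cspan G"
| step: "g \<in> G \<Longrightarrow> s \<in> cspan G \<Longrightarrow> poly_const c * g + s \<in> cspan G"

lemma cspan_add: "p \<in> cspan G \<Longrightarrow> q \<in> cspan G \<Longrightarrow> p + q \<in> cspan G"
  by (induction rule: cspan.induct) (auto simp: add.assoc intro: cspan.intros)

lemma cspan_scale: "p \<in> cspan G \<Longrightarrow> poly_const c * p \<in> cspan G"
proof (induction rule: cspan.induct)
  case (step g s d)
  then show ?case
    using cspan.step[of g G "poly_const c * s" "c * d"]
    by (simp add: ring_distribs poly_const_mult mult.assoc)
qed (auto intro: cspan.zero)

lemma cspan_base: "g \<in> G \<Longrightarrow> g \<in> cspan G"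
  using cspan.step[OF _ cspan.zero, of g G 1] by simp

lemma cspan_sum: "(\<And>a. a \<in> A \<Longrightarrow> f a \<in> cspan G) \<Longrightarrow> (\<Sum>a\<in>A. f a) \<in> cspan G"
  by (induction A rule: infinite_finite_induct) (auto intro: cspan_add cspan.zero)

lemma cspan_mult:
  assumes "p \<in> cspan G" "q \<in> cspan H" "\<And>g h. g \<in> G \<Longrightarrow> h \<in> H \<Longrightarrow> g * h \<in> cspan E"
  shows "p * q \<in> cspan E"
proof -
  have *: "g * q \<in> cspan E" if "g \<in> G" for g
    using assms(2)
  proof (induction rule: cspan.induct)
    case (step h s c)
    then show ?case
      using cspan_add[OF cspan_scale[OF assms(3)[OF that step.hyps(1)]] step.IH, of c]
      by (simp add: ring_distribs mult_ac)
  qed (auto intro: cspan.zero)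
  from assms(1) show ?thesis
  proof (induction rule: cspan.induct)
    case (step g s c)
    then show ?case
      using cspan_add[OF cspan_scale[OF *[OF step.hyps(1)]] step.IH, of c]
      by (simp add: ring_distribs mult_ac)
  qed (auto intro: cspan.zero)
qed

section \<open>Homogeneous polynomials\<close>

definition mdeg :: "('i \<Rightarrow>\<^sub>0 nat) \<Rightarrow> nat" where
  "mdeg t = (\<Sum>i\<in>kys t. lkp t i)"

lemma mdeg_add: "mdeg (s + t) = mdeg s + mdeg t"
  unfolding mdeg_def by (rule sum_keys_add) auto

lemma homogeneous_iff_mdeg: "homogeneous d p \<longleftrightarrow> (\<forall>t\<in>kys p. mdeg t = d)"
  by (simp add: homogeneous_def mdeg_def)

lemma homogeneous_0 [simp]: "homogeneous d 0"
  by (simp add: homogeneous_def)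

lemma homogeneous_add: "homogeneous d p \<Longrightarrow> homogeneous d q \<Longrightarrow> homogeneous d (p + q)"
  using keys_add[of p q] by (auto simp: homogeneous_iff_mdeg)

lemma homogeneous_mult: "homogeneous d p \<Longrightarrow> homogeneous e q \<Longrightarrow> homogeneous (d + e) (p * q)"
  using keys_mult[of p q] by (fastforce simp: homogeneous_iff_mdeg mdeg_add)

lemma homogeneous_const: "homogeneous 0 (poly_const c)"
  by (auto simp: homogeneous_iff_mdeg poly_const_def mdeg_def)

lemma homogeneous_lin_form: "homogeneous 1 (lin_form u)"
proof (induction u rule: poly_mapping_induct_single)
  case (single_add k c p)
  have "homogeneous 1 (lin_form (sgl k c))"
    by (auto simp: homogeneous_iff_mdeg mdeg_def lin_form_single)
  with single_add show ?case
    by (simp add: lin_form_add homogeneous_add)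
qed auto

lemma homogeneous_scale: "homogeneous d p \<Longrightarrow> homogeneous d (poly_const c * p)"
  using homogeneous_mult[OF homogeneous_const] by fastforce

lemma homogeneous_cspan: "p \<in> cspan G \<Longrightarrow> (\<And>g. g \<in> G \<Longrightarrow> homogeneous d g) \<Longrightarrow> homogeneous d p"
  by (induction rule: cspan.induct) (auto intro: homogeneous_add homogeneous_scale)

lemma homogeneous_prod_list:
  "(\<And>p. p \<in> set ps \<Longrightarrow> homogeneous 1 p) \<Longrightarrow> homogeneous (length ps) (prod_list ps)"
proof (induction ps)
  case Nil
  then show ?case using homogeneous_const[of 1] by simp
next
  case (Cons p ps)
  then show ?case using homogeneous_mult[of 1 p "length ps" "prod_list ps"] by simp
qed

text \<open>Monomials of different degrees cannot cancel, so only the summand of the right degree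
  survives; it is missing when \<open>d\<close> is outside the range of summation.\<close>

lemma homogeneous_eq_component:
  assumes "homogeneous d (\<Sum>k<N. g k)" and "\<And>k. homogeneous k (g k)"
  shows "(\<Sum>k<N. g k) = (if d < N then g d else 0)"
proof (rule poly_mapping_eqI)
  fix t
  have *: "lkp (g k) t = (if k = mdeg t then lkp (g (mdeg t)) t else 0)" for k
    using assms(2)[of k] by (auto simp: homogeneous_iff_mdeg in_keys_iff)
  have **: "lkp (\<Sum>k<N. g k) t = (if mdeg t < N then lkp (g (mdeg t)) t else 0)"
    by (simp add: lookup_sum *[of _] sum.delta)
  show "lkp (\<Sum>k<N. g k) t = lkp (if d < N then g d else 0) t"
  proof (cases "mdeg t = d")
    case False
    with assms(1) have "lkp (\<Sum>k<N. g k) t = 0"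
      by (auto simp: homogeneous_iff_mdeg in_keys_iff)
    with False * [of d] show ?thesis by auto
  qed (use ** in auto)
qed

section \<open>Powers of linear forms modulo squares of variables\<close>

text \<open>The ideal generated by the squares of the variables, described through its
  monomials.\<close>

definition nonsqfree :: "'i cpoly set" where
  "nonsqfree = {p. \<forall>t\<in>kys p. \<exists>i. lkp t i \<ge> 2}"

lemma nonsqfree_add: "p \<in> nonsqfree \<Longrightarrow> q \<in> nonsqfree \<Longrightarrow> p + q \<in> nonsqfree"
  using keys_add[of p q] by (auto simp: nonsqfree_def)

lemma nonsqfree_mult: "p \<in> nonsqfree \<Longrightarrow> q * p \<in> nonsqfree"
proof -
  assume p: "p \<in> nonsqfree"
  have "\<exists>i. lkp t i \<ge> 2" if t: "t \<in> kys (q * p)" for t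
  proof -
    obtain a b where "t = a + b" "b \<in> kys p" using t keys_mult[of q p] by auto
    with p obtain i where "lkp b i \<ge> 2" by (auto simp: nonsqfree_def)
    then show ?thesis using \<open>t = a + b\<close> by (auto simp: lookup_add intro!: exI[of _ i])
  qed
  then show ?thesis by (simp add: nonsqfree_def)
qed

lemma nonsqfree_0 [simp]: "0 \<in> nonsqfree"
  by (simp add: nonsqfree_def)

lemma nonsqfree_sum: "(\<And>a. a \<in> A \<Longrightarrow> f a \<in> nonsqfree) \<Longrightarrow> (\<Sum>a\<in>A. f a) \<in> nonsqfree"
  by (induction A rule: infinite_finite_induct) (auto intro: nonsqfree_add)

lemma nonsqfree_var_square: "sgl (sgl i 1) c * sgl (sgl i 1) d \<in> nonsqfree"
  by (auto simp: nonsqfree_def mult_single lookup_add intro!: exI[of _ i])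

text \<open>Pigeonhole: a monomial of degree \<open>d\<close> in fewer than \<open>d\<close>
  variables repeats one of them. Splitting off one variable, the binomial terms containing it at
  most once fall under the induction hypothesis, and the others contain its square.\<close>

lemma sum_var_power_nonsqfree:
  assumes "finite A" "card A < d"
  shows "(\<Sum>i\<in>A. sgl (sgl i 1) (a i)) ^ d \<in> (nonsqfree :: 'i cpoly set)"
  using assms
proof (induction A arbitrary: d rule: finite_induct)
  case (insert j A)
  define y :: "'i cpoly" where "y = sgl (sgl j 1) (a j)"
  define b :: "'i cpoly" where "b = (\<Sum>i\<in>A. sgl (sgl i 1) (a i))"
  have "of_nat (d choose k) * y ^ k * b ^ (d - k) \<in> nonsqfree" if "k \<le> d" for k
  proof (cases "k \<le> 1")
    case True
    then have "b ^ (d - k) \<in> nonsqfree"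
      unfolding b_def using insert by (intro insert.IH) auto
    then show ?thesis by (rule nonsqfree_mult)
  next
    case False
    then have "y ^ k = y ^ (k - 2) * (y * y)"
      by (metis le_add_diff_inverse2 not_less_eq_eq numeral_2_eq_2 power2_eq_square power_add One_nat_def)
    moreover have "y * y \<in> nonsqfree"
      unfolding y_def by (rule nonsqfree_var_square)
    ultimately show ?thesis
      by (metis nonsqfree_mult mult.assoc mult.commute)
  qed
  then have "(y + b) ^ d \<in> nonsqfree"
    unfolding binomial_ring by (intro nonsqfree_sum) auto
  with insert show ?case by (simp add: y_def b_def)
qed (auto simp: zero_power)

lemma lookup_nonsqfree: "p \<in> nonsqfree \<Longrightarrow> (\<And>i. lkp t i \<le> 1) \<Longrightarrow> lkp p t = 0"
  by (fastforce simp: nonsqfree_def in_keys_iff numeral_2_eq_2 not_less_eq_eq[symmetric])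

section \<open>The symmetric algebra of a subspace and its grading\<close>

lemma sym_carrier_0: "0 \<in> sym_carrier U"
  using sym_carrier.const[of 0 U] by simp

lemma sym_carrier_1: "1 \<in> sym_carrier U"
  using sym_carrier.const[of 1 U] by simp

lemma sym_carrier_scale: "p \<in> sym_carrier U \<Longrightarrow> poly_const c * p \<in> sym_carrier U"
  by (intro sym_carrier.mult sym_carrier.const)

lemma sym_carrier_uminus: "p \<in> sym_carrier U \<Longrightarrow> - p \<in> sym_carrier U"
  using sym_carrier_scale[of p U "-1"] by (simp add: poly_const_uminus)

lemma sym_carrier_sum: "(\<And>a. a \<in> S \<Longrightarrow> f a \<in> sym_carrier U) \<Longrightarrow> (\<Sum>a\<in>S. f a) \<in> sym_carrier U"
  by (induction S rule: infinite_finite_induct) (auto intro: sym_carrier.add sym_carrier_0)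

lemma sym_carrier_prod: "(\<And>a. a \<in> S \<Longrightarrow> f a \<in> sym_carrier U) \<Longrightarrow> (\<Prod>a\<in>S. f a) \<in> sym_carrier U"
  by (induction S rule: infinite_finite_induct) (auto intro: sym_carrier.mult sym_carrier_1)

lemma sym_carrier_power: "p \<in> sym_carrier U \<Longrightarrow> p ^ k \<in> sym_carrier U"
  by (induction k) (auto intro: sym_carrier.mult sym_carrier_1)

lemma sym_alg_simps [simp]:
  "carrier (sym_alg U) = sym_carrier U" "mult (sym_alg U) = (*)" "one (sym_alg U) = 1"
  "zero (sym_alg U) = 0" "add (sym_alg U) = (+)"
  by (simp_all add: sym_alg_def)

lemma cring_sym_alg: "cring (sym_alg U)"
proof (rule cringI)
  show "abelian_group (sym_alg U)"
    by (rule abelian_groupI)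
      (auto simp: add_ac intro: sym_carrier.add sym_carrier_0
        intro!: bexI[OF _ sym_carrier_uminus])
  show "comm_monoid (sym_alg U)"
    by (rule comm_monoidI) (auto simp: mult_ac intro: sym_carrier.mult sym_carrier_1)
qed (auto simp: ring_distribs)

definition prods_of :: "nat \<Rightarrow> 'i cpoly set \<Rightarrow> 'i cpoly set" where
  "prods_of k G = {prod_list ps | ps. set ps \<subseteq> G \<and> length ps = k}"

lemma prods_of_0 [simp]: "prods_of 0 G = {1}"
  by (auto simp: prods_of_def)

lemma prods_of_mult: "p \<in> prods_of k G \<Longrightarrow> q \<in> prods_of l G \<Longrightarrow> p * q \<in> prods_of (k + l) G"
  unfolding prods_of_def by clarify (rule exI[of _ "_ @ _"], auto)

text \<open>\<open>sym_carrier\<close> is generated inductively and shows no grading; this recovers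
  the decomposition into degrees. For a product, degree \<open>k\<close> collects the pairs of
  components whose degrees add up to \<open>k\<close>.\<close>

lemma sym_carrier_components:
  assumes "p \<in> sym_carrier U" and G: "\<And>u. u \<in> U \<Longrightarrow> lin_form u \<in> cspan G"
  shows "\<exists>N g. (\<forall>k. g k \<in> cspan (prods_of k G)) \<and> p = (\<Sum>k<N. g k)"
  using assms(1)
proof (induction rule: sym_carrier.induct)
  case (const c)
  have "poly_const c \<in> cspan (prods_of 0 G)"
    using cspan_scale[OF cspan_base[of 1 "{1}"], of c] by simp
  then show ?case
    by (intro exI[of _ 1] exI[of _ "\<lambda>k. if k = 0 then poly_const c else 0"])
      (auto intro: cspan.zero)
next
  case (lin u)
  have "prods_of 1 G = G"
    by (auto simp: prods_of_def length_Suc_conv intro!: exI[of _ "[_]"])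
  with G[OF lin] show ?case
    by (intro exI[of _ 2] exI[of _ "\<lambda>k. if k = 1 then lin_form u else 0"])
      (auto simp: numeral_2_eq_2 intro: cspan.zero)
next
  case (add p q)
  then obtain N g M h where p: "\<And>k. g k \<in> cspan (prods_of k G)" "p = (\<Sum>k<N. g k)"
    and q: "\<And>k. h k \<in> cspan (prods_of k G)" "q = (\<Sum>k<M. h k)"
    by metis
  define f where "f k = (if k < N then g k else 0) + (if k < M then h k else 0)" for k
  have "p = (\<Sum>k<N+M. if k < N then g k else 0)"
    unfolding p(2) by (rule sum.mono_neutral_cong_left) auto
  moreover have "q = (\<Sum>k<N+M. if k < M then h k else 0)"
    unfolding q(2) by (rule sum.mono_neutral_cong_left) auto
  ultimately have "p + q = (\<Sum>k<N+M. f k)"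
    by (simp add: f_def sum.distrib)
  moreover have "f k \<in> cspan (prods_of k G)" for k
    using p(1) q(1) by (auto simp: f_def intro: cspan_add cspan.zero)
  ultimately show ?case by blast
next
  case (mult p q)
  then obtain N g M h where p: "\<And>k. g k \<in> cspan (prods_of k G)" "p = (\<Sum>k<N. g k)"
    and q: "\<And>k. h k \<in> cspan (prods_of k G)" "q = (\<Sum>k<M. h k)"
    by metis
  define f where "f k = (\<Sum>(i, j) \<in> {x \<in> {..<N} \<times> {..<M}. fst x + snd x = k}. g i * h j)" for k
  have "p * q = (\<Sum>(i, j) \<in> {..<N} \<times> {..<M}. g i * h j)"
    by (simp add: p(2) q(2) sum_product sum.cartesian_product)
  also have "\<dots> = (\<Sum>k<N+M. f k)"
    unfolding f_def by (rule sum.group[symmetric]) auto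
  finally have "p * q = (\<Sum>k<N+M. f k)" .
  moreover have "f k \<in> cspan (prods_of k G)" for k
    unfolding f_def
  proof (rule cspan_sum, clarsimp)
    fix i j
    show "g i * h j \<in> cspan (prods_of (i + j) G)"
      by (rule cspan_mult[OF p(1) q(1)]) (auto intro: cspan_base prods_of_mult)
  qed
  ultimately show ?case by blast
qed

lemma homogeneous_sym_carrier_span:
  assumes "p \<in> sym_carrier U" and "homogeneous d p"
    and "\<And>u. u \<in> U \<Longrightarrow> lin_form u \<in> cspan (lin_form ` S)"
  shows "p \<in> cspan (prods_of d (lin_form ` S))"
proof -
  obtain N g where g: "\<And>k. g k \<in> cspan (prods_of k (lin_form ` S))" "p = (\<Sum>k<N. g k)"
    using sym_carrier_components[OF assms(1,3)] by metis
  have "homogeneous k (g k)" for k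
    using g(1)[of k]
    by (rule homogeneous_cspan)
      (auto simp: prods_of_def intro!: homogeneous_prod_list homogeneous_lin_form[simplified])
  from homogeneous_eq_component[of d g N, OF _ this] assms(2) g show ?thesis
    by (auto intro: cspan.zero)
qed

section \<open>The internal ideal\<close>

lemma iideal_gens_subset:
  "{lin_form u ^ (arr_rho A u - 1) | u. u \<in> U \<and> u \<noteq> 0} \<subseteq> sym_carrier U"
  by (auto intro: sym_carrier_power sym_carrier.lin)

lemma ideal_internal_ideal: "ideal (internal_ideal U A) (sym_alg U)"
  unfolding internal_ideal_def
  by (rule ring.genideal_ideal[OF cring.axioms(1)[OF cring_sym_alg]])
    (use iideal_gens_subset in simp)

context
  fixes U :: "('i \<Rightarrow>\<^sub>0 complex) set" and A :: "('i \<Rightarrow>\<^sub>0 complex) set set"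
begin

interpretation I: ideal "internal_ideal U A" "sym_alg U"
  by (rule ideal_internal_ideal)

lemma iideal_subset: "p \<in> internal_ideal U A \<Longrightarrow> p \<in> sym_carrier U"
  using I.a_subset by auto

lemma iideal_0: "0 \<in> internal_ideal U A"
  using additive_subgroup.zero_closed[OF I.additive_subgroup_axioms] by simp

lemma iideal_add:
  "p \<in> internal_ideal U A \<Longrightarrow> q \<in> internal_ideal U A \<Longrightarrow> p + q \<in> internal_ideal U A"
  using additive_subgroup.a_closed[OF I.additive_subgroup_axioms] by simp

lemma iideal_mult:
  "p \<in> internal_ideal U A \<Longrightarrow> q \<in> sym_carrier U \<Longrightarrow> q * p \<in> internal_ideal U A"
  using I.I_l_closed by simp

lemma iideal_scale: "p \<in> internal_ideal U A \<Longrightarrow> poly_const c * p \<in> internal_ideal U A"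
  by (simp add: iideal_mult sym_carrier.const)

lemma iideal_scale_iff:
  "c \<noteq> 0 \<Longrightarrow> poly_const c * p \<in> internal_ideal U A \<longleftrightarrow> p \<in> internal_ideal U A"
  using iideal_scale[of "poly_const c * p" "inverse c"] iideal_scale[of p c]
  by (auto simp: mult.assoc[symmetric] poly_const_mult[symmetric])

lemma iideal_uminus: "p \<in> internal_ideal U A \<Longrightarrow> - p \<in> internal_ideal U A"
  using iideal_scale[of p "-1"] by (simp add: poly_const_uminus)

lemma iideal_diff:
  "p \<in> internal_ideal U A \<Longrightarrow> q \<in> internal_ideal U A \<Longrightarrow> p - q \<in> internal_ideal U A"
  using iideal_add[of p "-q"] iideal_uminus by force

lemma iideal_sum:
  "(\<And>a. a \<in> S \<Longrightarrow> f a \<in> internal_ideal U A) \<Longrightarrow> (\<Sum>a\<in>S. f a) \<in> internal_ideal U A"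
  by (induction S rule: infinite_finite_induct) (auto intro: iideal_add iideal_0)

lemma iideal_gen:
  "u \<in> U \<Longrightarrow> u \<noteq> 0 \<Longrightarrow> lin_form u ^ (arr_rho A u - 1) \<in> internal_ideal U A"
  unfolding internal_ideal_def
  using ring.genideal_self[OF I.ring_axioms, of "{lin_form u ^ (arr_rho A u - 1) | u. u \<in> U \<and> u \<noteq> 0}"]
    iideal_gens_subset[of A U] by auto

lemma iideal_gen_le:
  assumes "u \<in> U" "arr_rho A u - 1 \<le> k" "k > 0"
  shows "lin_form u ^ k \<in> internal_ideal U A"
proof (cases "u = 0")
  case True
  then show ?thesis using assms by (simp add: iideal_0 zero_power)
next
  case False
  have "lin_form u ^ k = lin_form u ^ (k - (arr_rho A u - 1)) * lin_form u ^ (arr_rho A u - 1)"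
    using assms(2) by (simp flip: power_add)
  then show ?thesis
    using iideal_mult[OF iideal_gen[OF assms(1) False]]
      sym_carrier_power[OF sym_carrier.lin[OF assms(1)]] by metis
qed

text \<open>Minimality of the generated ideal, phrased as an induction principle: \<open>J\<close>
  is typically the set of elements with a property to be proved. Closure under negatives comes from
  multiplication by the constant -1.\<close>

lemma iideal_least:
  assumes "p \<in> internal_ideal U A"
    and J: "J \<subseteq> sym_carrier U" "0 \<in> J" "\<And>p q. p \<in> J \<Longrightarrow> q \<in> J \<Longrightarrow> p + q \<in> J"
      "\<And>p q. p \<in> J \<Longrightarrow> q \<in> sym_carrier U \<Longrightarrow> q * p \<in> J"
    and gen: "\<And>u. u \<in> U \<Longrightarrow> u \<noteq> 0 \<Longrightarrow> lin_form u ^ (arr_rho A u - 1) \<in> J"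
  shows "p \<in> J"
proof -
  have J4': "p * q \<in> J" if "p \<in> J" "q \<in> sym_carrier U" for p q
    using J(4)[OF that] by (simp add: mult.commute)
  have J_uminus: "- a \<in> J" if "a \<in> J" for a
    using J(4)[OF that sym_carrier.const[of "-1"]] by (simp add: poly_const_uminus)
  have "subgroup J (add_monoid (sym_alg U))"
  proof (rule group.subgroupI[OF I.add.is_group])
    show "inv\<^bsub>add_monoid (sym_alg U)\<^esub> a \<in> J" if "a \<in> J" for a
    proof -
      have "inv\<^bsub>add_monoid (sym_alg U)\<^esub> a = - a"
        using subsetD[OF J(1) that] subsetD[OF J(1) J_uminus[OF that]]
        by (intro group.inv_equality[OF I.add.is_group]) simp_all
      with J_uminus[OF that] show ?thesis by simp
    qed
    show "J \<noteq> {}" using J(2) by blast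
  qed (simp_all add: J(1,3))
  then have "ideal J (sym_alg U)"
    by (rule idealI[OF I.ring_axioms]) (simp_all add: J(4) J4')
  moreover have "{lin_form u ^ (arr_rho A u - 1) | u. u \<in> U \<and> u \<noteq> 0} \<subseteq> J"
    using gen by auto
  ultimately have "internal_ideal U A \<subseteq> J"
    unfolding internal_ideal_def by (rule ring.genideal_minimal[OF I.ring_axioms])
  then show ?thesis using assms(1) by (rule subsetD)
qed

definition icoset :: "'i cpoly \<Rightarrow> 'i cpoly set" where
  "icoset p = internal_ideal U A +>\<^bsub>sym_alg U\<^esub> p"

lemma icoset_eq: "icoset p = (\<lambda>i. i + p) ` internal_ideal U A"
  by (auto simp: icoset_def a_r_coset_def')

lemma icoset_eq_iff: "icoset p = icoset q \<longleftrightarrow> p - q \<in> internal_ideal U A"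
proof
  assume "icoset p = icoset q"
  moreover have "p \<in> icoset p"
    using iideal_0 by (force simp: icoset_eq)
  ultimately show "p - q \<in> internal_ideal U A"
    by (auto simp: icoset_eq)
next
  assume *: "p - q \<in> internal_ideal U A"
  show "icoset p = icoset q"
  proof (intro subset_antisym subsetI)
    fix x assume "x \<in> icoset p"
    then show "x \<in> icoset q"
      using iideal_add[OF _ *] by (auto simp: icoset_eq image_iff) (metis diff_add_cancel add.assoc)
  next
    fix x assume "x \<in> icoset q"
    then show "x \<in> icoset p"
      using iideal_diff[OF _ *] by (auto simp: icoset_eq image_iff algebra_simps)
        (metis add_diff_cancel_right' diff_add_cancel add_diff_eq add.commute)
  qed
qed

lemma icoset_0: "icoset 0 = internal_ideal U A"
  by (simp add: icoset_eq)

lemma icoset_eq_ideal_iff: "icoset p = internal_ideal U A \<longleftrightarrow> p \<in> internal_ideal U A"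
  using icoset_eq_iff[of p 0] by (simp add: icoset_0)

lemma zero_internal_alg: "\<zero>\<^bsub>internal_alg U A\<^esub> = icoset 0"
  by (simp add: internal_alg_def FactRing_def icoset_0)

lemma add_internal_alg:
  "p \<in> sym_carrier U \<Longrightarrow> q \<in> sym_carrier U \<Longrightarrow> icoset p \<oplus>\<^bsub>internal_alg U A\<^esub> icoset q = icoset (p + q)"
  using I.a_rcos_sum by (simp add: internal_alg_def FactRing_def icoset_def)

lemma mult_internal_alg:
  "p \<in> sym_carrier U \<Longrightarrow> q \<in> sym_carrier U \<Longrightarrow> icoset p \<otimes>\<^bsub>internal_alg U A\<^esub> icoset q = icoset (p * q)"
  using I.rcoset_mult_add by (simp add: internal_alg_def FactRing_def icoset_def)

lemma internal_comp_eq: "internal_comp U A d = icoset ` {p \<in> sym_carrier U. homogeneous d p}"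
  by (auto simp: internal_comp_def icoset_def)

abbreviation "itop_polys \<equiv> {p \<in> sym_carrier U. homogeneous (internal_top_degree U A) p}"

lemma carrier_internal_top: "carrier (internal_top U A) = icoset ` itop_polys"
  by (simp add: internal_top_def internal_comp_eq)

lemma zero_internal_top: "\<zero>\<^bsub>internal_top U A\<^esub> = icoset 0"
  by (simp add: internal_top_def zero_internal_alg)

lemma add_internal_top:
  "p \<in> sym_carrier U \<Longrightarrow> q \<in> sym_carrier U \<Longrightarrow> icoset p \<oplus>\<^bsub>internal_top U A\<^esub> icoset q = icoset (p + q)"
  by (simp add: internal_top_def add_internal_alg)

lemma smult_internal_top:
  "p \<in> sym_carrier U \<Longrightarrow> c \<odot>\<^bsub>internal_top U A\<^esub> icoset p = icoset (poly_const c * p)"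
  by (simp add: internal_top_def mult_internal_alg sym_carrier.const flip: icoset_def)

lemma vectorspace_internal_top: "vectorspace class_ring (internal_top U A)"
proof -
  have neg: "\<exists>y\<in>carrier (internal_top U A). x \<oplus>\<^bsub>internal_top U A\<^esub> y = \<zero>\<^bsub>internal_top U A\<^esub>"
    if x: "x \<in> carrier (internal_top U A)" for x
  proof -
    obtain p where p: "p \<in> itop_polys" "x = icoset p"
      using x by (auto simp: carrier_internal_top)
    then have "- p \<in> itop_polys"
      using homogeneous_scale[of _ p "-1"] by (auto simp: poly_const_uminus sym_carrier_uminus)
    with p show ?thesis
      by (intro bexI[of _ "icoset (- p)"])
        (auto simp: carrier_internal_top zero_internal_top add_internal_top)
  qed
  show ?thesis
  proof (rule vs_criteria)
    show "\<forall>v\<in>carrier (internal_top U A). \<exists>y\<in>carrier (internal_top U A).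
        v \<oplus>\<^bsub>internal_top U A\<^esub> y = \<zero>\<^bsub>internal_top U A\<^esub>"
      using neg by blast
  qed (simp_all add: carrier_internal_top ball_conj_distrib class_field,
      (force simp: zero_internal_top add_internal_top smult_internal_top
      sym_carrier_0 sym_carrier.add sym_carrier_scale
      homogeneous_add homogeneous_scale poly_const_mult poly_const_add
      distrib_left distrib_right mult.assoc add_ac)+)
qed

end

section \<open>Linear maps and their extensions to the symmetric algebra\<close>

definition clinear_op :: "(('i \<Rightarrow>\<^sub>0 complex) \<Rightarrow> ('i \<Rightarrow>\<^sub>0 complex)) \<Rightarrow> bool" where
  "clinear_op L \<longleftrightarrow> (\<forall>u v. L (u + v) = L u + L v) \<and> (\<forall>c u. L (cscale c u) = cscale c (L u))"

lemma sym_map_lin_form: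
  assumes "clinear_op L"
  shows "sym_map L (lin_form u) = lin_form (L u)"
proof (induction u rule: poly_mapping_induct_single)
  case zero
  have "L 0 = 0" using assms unfolding clinear_op_def by (metis add_cancel_right_left)
  then show ?case by (simp add: sym_map_eq_poly_subst)
next
  case (single_add k c p)
  have "lin_form (L (sgl k c)) = poly_const c * lin_form (L (sgl k 1))"
    using assms cscale_single[of c k 1] by (metis clinear_op_def lin_form_cscale mult.right_neutral)
  with single_add assms show ?case
    by (simp add: sym_map_eq_poly_subst lin_form_add poly_subst_add clinear_op_def
        lin_form_single poly_subst_single)
qed

lemma sym_map_ring_hom:
  "sym_map L (p + q) = sym_map L p + sym_map L q" "sym_map L (p * q) = sym_map L p * sym_map L q"
  "sym_map L (poly_const c) = poly_const c" "sym_map L 0 = 0" "sym_map L (p ^ k) = sym_map L p ^ k"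
  "sym_map L (p - q) = sym_map L p - sym_map L q"
  by (simp_all add: sym_map_eq_poly_subst poly_subst_add poly_subst_mult poly_subst_const
      poly_subst_power poly_subst_diff)

lemma sym_map_sum: "sym_map L (\<Sum>a\<in>S. f a) = (\<Sum>a\<in>S. sym_map L (f a))"
  by (simp add: sym_map_eq_poly_subst poly_subst_sum)

lemma sym_map_closed:
  assumes "clinear_op L" "\<And>u. u \<in> U \<Longrightarrow> L u \<in> U" "p \<in> sym_carrier U"
  shows "sym_map L p \<in> sym_carrier U"
  using assms(3)
  by induction (auto simp: sym_map_ring_hom sym_map_lin_form[OF assms(1)] assms(2)
      intro: sym_carrier.intros)

lemma sym_map_compose:
  assumes "clinear_op L" "clinear_op L'" "clinear_op L''" "\<And>u. u \<in> U \<Longrightarrow> L (L' u) = L'' u"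
    and "p \<in> sym_carrier U"
  shows "sym_map L (sym_map L' p) = sym_map L'' p"
  using assms(5) by induction (auto simp: sym_map_ring_hom sym_map_lin_form assms(1-4))

lemma sym_map_identity:
  assumes "clinear_op L" "\<And>u. u \<in> U \<Longrightarrow> L u = u" "p \<in> sym_carrier U"
  shows "sym_map L p = p"
  using assms(3) by induction (auto simp: sym_map_ring_hom sym_map_lin_form assms(1,2))

lemma homogeneous_sym_map:
  assumes "clinear_op L" "p \<in> sym_carrier U" "homogeneous d p"
  shows "homogeneous d (sym_map L p)"
proof -
  have "p \<in> cspan (prods_of d (lin_form ` U))"
    using assms(2,3) by (rule homogeneous_sym_carrier_span) (auto intro: cspan_base)
  then show ?thesis
  proof (induction rule: cspan.induct)
    case (step g s c)
    have "homogeneous (length ps) (sym_map L (prod_list ps))" if "set ps \<subseteq> lin_form ` U" for ps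
      using that
    proof (induction ps)
      case Nil
      then show ?case using homogeneous_const[of 1] sym_map_ring_hom(3)[of L 1] by simp
    next
      case (Cons q ps)
      then show ?case
        using homogeneous_mult[OF homogeneous_lin_form, of "length ps" "sym_map L (prod_list ps)"]
        by (auto simp: sym_map_ring_hom sym_map_lin_form[OF assms(1)])
    qed
    with step show ?case
      by (auto simp: sym_map_ring_hom prods_of_def intro!: homogeneous_add homogeneous_scale)
  qed (simp add: sym_map_ring_hom)
qed

text \<open>Generators go to generators: the power of \<open>u\<close> becomes the power of
  \<open>L u\<close> with the same exponent.\<close>

lemma sym_map_internal_ideal:
  assumes "clinear_op L" and U: "\<And>u. u \<in> U \<Longrightarrow> L u \<in> U"
    and rho: "\<And>u. u \<in> U \<Longrightarrow> u \<noteq> 0 \<Longrightarrow> L u \<noteq> 0 \<and> arr_rho A (L u) = arr_rho A u"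
    and "p \<in> internal_ideal U A"
  shows "sym_map L p \<in> internal_ideal U A"
proof -
  let ?J = "{p \<in> sym_carrier U. sym_map L p \<in> internal_ideal U A}"
  have "p \<in> ?J"
    using assms(4)
  proof (rule iideal_least)
    fix u assume u: "u \<in> U" "u \<noteq> 0"
    then show "lin_form u ^ (arr_rho A u - 1) \<in> ?J"
      using iideal_gen[of "L u" U A] rho[OF u] U
      by (auto simp: sym_map_ring_hom sym_map_lin_form[OF assms(1)]
          intro: sym_carrier_power sym_carrier.lin)
  qed (auto simp: sym_map_ring_hom sym_carrier_0 iideal_0
      intro: sym_carrier.intros iideal_add iideal_mult sym_map_closed[OF assms(1) U])
  then show ?thesis by simp
qed

lemma poly_const_2: "poly_const 2 = 2"
  using poly_const_add[of 1 1] by simp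

section \<open>Roots of unity and the vectors of the arrangement\<close>

lemma omega_power: "omega m ^ k = cis (2 * pi * real k / real m)"
  by (simp add: omega_def exp_of_nat_mult[symmetric] cis_conv_exp mult_ac)

text \<open>Allows the scalars \<open>omega m ^ k\<close> in \<open>arr_vecs\<close> to be treated
  as arbitrary m-th roots of unity, without reference to exponents.\<close>

lemma roots_unity_eq_omega:
  assumes "m > 0"
  shows "{\<gamma>. \<gamma> ^ m = 1} = (\<lambda>k. omega m ^ k) ` {..<m}"
  using bij_betw_roots_unity[OF assms] by (auto simp: bij_betw_def omega_power)

lemma omega_root: "m > 0 \<Longrightarrow> omega m ^ m = 1"
  using omega_power[of m m] by simp

definition edge_vec :: "nat \<Rightarrow> nat \<Rightarrow> nat \<Rightarrow> complex \<Rightarrow> complex vec" where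
  "edge_vec n i j \<gamma> = unit_vec n i - \<gamma> \<cdot>\<^sub>v unit_vec n j"

lemma edge_vec_dim [simp]: "dim_vec (edge_vec n i j \<gamma>) = n" "edge_vec n i j \<gamma> \<in> carrier_vec n"
  by (auto simp: edge_vec_def)

lemma edge_vec_index:
  "i < n \<Longrightarrow> j < n \<Longrightarrow> a < n \<Longrightarrow>
    edge_vec n i j \<gamma> $ a = (if a = i then 1 else 0) - (if a = j then \<gamma> else 0)"
  by (auto simp: edge_vec_def)

lemma edge_vec_neq_unit_vec:
  assumes "i \<noteq> j" "i < n" "j < n" "\<gamma> \<noteq> 0" "k < n"
  shows "edge_vec n i j \<gamma> \<noteq> unit_vec n k"
proof
  assume *: "edge_vec n i j \<gamma> = unit_vec n k"
  have "edge_vec n i j \<gamma> $ i = 1" "edge_vec n i j \<gamma> $ j = - \<gamma>"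
    using assms by (auto simp: edge_vec_index)
  then show False using assms unfolding * by (auto split: if_splits)
qed

lemma unit_vec_inject: "i < n \<Longrightarrow> j < n \<Longrightarrow> unit_vec n i = (unit_vec n j :: complex vec) \<longleftrightarrow> i = j"
  by (metis index_unit_vec(1) zero_neq_one)

lemma edge_vec_inject:
  assumes "i < j" "j < n" "i' < j'" "j' < n" "\<gamma> \<noteq> 0" "\<gamma>' \<noteq> 0"
  shows "edge_vec n i j \<gamma> = edge_vec n i' j' \<gamma>' \<longleftrightarrow> i = i' \<and> j = j' \<and> \<gamma> = \<gamma>'"
proof (intro iffI)
  assume *: "edge_vec n i j \<gamma> = edge_vec n i' j' \<gamma>'"
  have eq: "(if a = i then 1 else 0) - (if a = j then \<gamma> else 0) =
      (if a = i' then 1 else 0) - (if a = j' then \<gamma>' else 0)" if "a < n" for a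
    using arg_cong[OF *, of "\<lambda>v. v $ a"] assms that by (simp add: edge_vec_index)
  have "i' = i \<or> i' = j" "j' = i \<or> j' = j" "i = i' \<or> i = j'"
    using eq[of i'] eq[of j'] eq[of i] assms by (auto split: if_splits)
  then have "i = i' \<and> j = j'" using assms by auto
  then show "i = i' \<and> j = j' \<and> \<gamma> = \<gamma>'" using eq[of j] assms by auto
qed auto

text \<open>Coordinate \<open>a\<close> of \<open>arr_phi\<close>, as a linear functional.\<close>

definition vcoord :: "nat \<Rightarrow> (complex vec \<Rightarrow>\<^sub>0 complex) \<Rightarrow> complex" where
  "vcoord a f = (\<Sum>v\<in>kys f. lkp f v * v $ a)"

lemma vcoord_add: "vcoord a (f + g) = vcoord a f + vcoord a g"
  unfolding vcoord_def by (rule sum_keys_add) (auto simp: ring_distribs)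

lemma vcoord_0 [simp]: "vcoord a 0 = 0"
  by (simp add: vcoord_def)

lemma vcoord_single: "vcoord a (sgl v c) = c * v $ a"
  by (cases "c = 0") (auto simp: vcoord_def)

lemma vcoord_cscale: "vcoord a (cscale c f) = c * vcoord a f"
  by (induction f rule: poly_mapping_induct_single)
    (auto simp: cscale_add vcoord_add vcoord_single ring_distribs)

lemma vcoord_diff: "vcoord a (f - g) = vcoord a f - vcoord a g"
  using vcoord_add[of a "f - g" g] by simp

lemma mem_arr_kernel:
  "f \<in> arr_kernel m n \<longleftrightarrow> kys f \<subseteq> arr_vecs m n \<and> (\<forall>a<n. vcoord a f = 0)"
  by (auto simp: arr_kernel_def arr_phi_def vcoord_def vec_eq_iff)

lemma arr_kernel_add: "f \<in> arr_kernel m n \<Longrightarrow> g \<in> arr_kernel m n \<Longrightarrow> f + g \<in> arr_kernel m n"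
  using keys_add[of f g] by (auto simp: mem_arr_kernel vcoord_add)

lemma arr_kernel_0: "0 \<in> arr_kernel m n"
  by (auto simp: mem_arr_kernel)

lemma arr_kernel_cscale: "f \<in> arr_kernel m n \<Longrightarrow> cscale c f \<in> arr_kernel m n"
  by (auto simp: mem_arr_kernel vcoord_cscale in_keys_iff)

lemma arr_kernel_diff: "f \<in> arr_kernel m n \<Longrightarrow> g \<in> arr_kernel m n \<Longrightarrow> f - g \<in> arr_kernel m n"
  using keys_diff[of f g] by (auto simp: mem_arr_kernel vcoord_diff in_keys_iff lookup_minus)

lemma arr_kernel_sum: "(\<And>a. a \<in> S \<Longrightarrow> f a \<in> arr_kernel m n) \<Longrightarrow> (\<Sum>a\<in>S. f a) \<in> arr_kernel m n"
  by (induction S rule: infinite_finite_induct) (auto intro: arr_kernel_add arr_kernel_0)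

locale monomial_arrangement =
  fixes m n :: nat
  assumes m_ge_2: "m \<ge> 2" and n_ge_3: "n \<ge> 3"
begin

abbreviation "K \<equiv> arr_kernel m n"
abbreviation "\<A> \<equiv> dual_arr m n"
abbreviation "I \<equiv> internal_ideal K \<A>"
abbreviation "SK \<equiv> sym_carrier K"

lemma m_pos: "m > 0" using m_ge_2 by simp

lemma root_nonzero: "\<gamma> ^ m = 1 \<Longrightarrow> \<gamma> \<noteq> (0::complex)"
  using m_pos by (auto simp: zero_power)

lemma finite_roots: "finite {\<gamma>::complex. \<gamma> ^ m = 1}"
  using finite_roots_unity[of m] m_ge_2 by simp

lemma ex_root_neq_1: "\<exists>\<gamma>::complex. \<gamma> ^ m = 1 \<and> \<gamma> \<noteq> 1"
proof -
  have "card {\<gamma>::complex. \<gamma> ^ m = 1} = m" by (rule card_roots_unity_eq[OF m_pos])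
  then have "{\<gamma>::complex. \<gamma> ^ m = 1} \<noteq> {1}" using m_ge_2 by auto
  then show ?thesis by (auto simp: set_eq_iff)
qed

lemma arr_vecs_eq:
  "arr_vecs m n = unit_vec n ` {..<n} \<union> {edge_vec n i j \<gamma> | i j \<gamma>. i < j \<and> j < n \<and> \<gamma> ^ m = 1}"
proof -
  have "{unit_vec n i - omega m ^ k \<cdot>\<^sub>v unit_vec n j | i j k. i < j \<and> j < n \<and> k < m}
      = {edge_vec n i j \<gamma> | i j \<gamma>. i < j \<and> j < n \<and> \<gamma> \<in> (\<lambda>k. omega m ^ k) ` {..<m}}"
    by (auto simp: edge_vec_def)
  then show ?thesis
    by (auto simp: arr_vecs_def simp flip: roots_unity_eq_omega[OF m_pos])
qed

lemma arr_vecs_normalised: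
  assumes "v \<in> arr_vecs m n"
  shows "dim_vec v = n \<and> (\<exists>i<n. v $ i = 1 \<and> (\<forall>a<i. v $ a = 0))"
proof -
  consider i where "i < n" "v = unit_vec n i"
    | i j \<gamma> where "i < j" "j < n" "v = edge_vec n i j \<gamma>"
    using assms by (auto simp: arr_vecs_eq)
  then show ?thesis
  proof cases
    case 1
    then show ?thesis by (intro conjI exI[of _ i]) auto
  next
    case 2
    then show ?thesis by (intro conjI exI[of _ i]) (auto simp: edge_vec_index)
  qed
qed

text \<open>The first nonzero entry of every vector in the arrangement is 1, so proportional vectors
  coincide. This makes \<open>img_vec\<close> and \<open>img_scalar\<close> well defined.\<close>

lemma arr_vecs_unique:
  assumes v: "v \<in> arr_vecs m n" and v': "v' \<in> arr_vecs m n" and "c \<noteq> 0" and eq: "c \<cdot>\<^sub>v v = d \<cdot>\<^sub>v v'"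
  shows "v = v' \<and> c = d"
proof -
  from arr_vecs_normalised[OF v] obtain i where i: "dim_vec v = n" "i < n" "v $ i = 1" "\<And>a. a < i \<Longrightarrow> v $ a = 0"
    by blast
  from arr_vecs_normalised[OF v'] obtain j where j: "dim_vec v' = n" "j < n" "v' $ j = 1" "\<And>a. a < j \<Longrightarrow> v' $ a = 0"
    by blast
  have at: "c * v $ a = d * v' $ a" if "a < n" for a
    using arg_cong[OF eq, of "\<lambda>v. v $ a"] that i(1) j(1) by simp
  have "\<not> i < j" using at[of i] i j \<open>c \<noteq> 0\<close> by auto
  moreover have "d \<noteq> 0" using at[of i] i j \<open>c \<noteq> 0\<close> by auto
  then have "\<not> j < i" using at[of j] i j by auto
  ultimately have "i = j" by simp
  then have "c = d" using at[of i] i j by simp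
  then have "v = v'" using at i(1) j(1) \<open>c \<noteq> 0\<close> by (intro eq_vecI) auto
  with \<open>c = d\<close> show ?thesis by simp
qed

section \<open>Generators of the kernel\<close>

text \<open>The pair \<open>(i, \<alpha>)\<close> stands for the vector \<open>\<alpha> e\<^sub>i\<close>.\<close>

definition pts :: "(nat \<times> complex) set" where
  "pts = {(i, \<alpha>). i < n \<and> \<alpha> ^ m = 1}"

definition pscale :: "complex \<Rightarrow> nat \<times> complex \<Rightarrow> nat \<times> complex" where
  "pscale \<gamma> p = (fst p, \<gamma> * snd p)"

lemma pscale_simps [simp]: "fst (pscale \<gamma> p) = fst p" "snd (pscale \<gamma> p) = \<gamma> * snd p"
  by (auto simp: pscale_def)

text \<open>The normalised vector proportional to p - q; the smaller axis comes first, as in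
  \<open>arr_vecs\<close>. The factor of proportionality is \<open>ecoef\<close>.\<close>

definition evec :: "nat \<times> complex \<Rightarrow> nat \<times> complex \<Rightarrow> complex vec" where
  "evec p q = (if fst p < fst q then edge_vec n (fst p) (fst q) (snd q / snd p)
     else edge_vec n (fst q) (fst p) (snd p / snd q))"

definition ecoef :: "nat \<times> complex \<Rightarrow> nat \<times> complex \<Rightarrow> complex" where
  "ecoef p q = (if fst p < fst q then snd p else - snd q)"

text \<open>The lift to the kernel of the edge vector \<open>p - q\<close>.\<close>

definition X :: "nat \<times> complex \<Rightarrow> nat \<times> complex \<Rightarrow> (complex vec \<Rightarrow>\<^sub>0 complex)" where
  "X p q = sgl (evec p q) (ecoef p q) - sgl (unit_vec n (fst p)) (snd p)
     + sgl (unit_vec n (fst q)) (snd q)"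

definition x :: "nat \<times> complex \<Rightarrow> nat \<times> complex \<Rightarrow> complex vec cpoly" where
  "x p q = lin_form (X p q)"

lemma pts_iff: "p \<in> pts \<longleftrightarrow> fst p < n \<and> snd p ^ m = 1"
  by (cases p) (auto simp: pts_def)

lemma pts_nonzero: "p \<in> pts \<Longrightarrow> snd p \<noteq> 0"
  by (auto simp: pts_iff root_nonzero)

lemma pscale_pts: "p \<in> pts \<Longrightarrow> \<gamma> ^ m = 1 \<Longrightarrow> pscale \<gamma> p \<in> pts"
  by (auto simp: pts_iff power_mult_distrib)

context
  fixes p q assumes p: "p \<in> pts" and q: "q \<in> pts" and pq: "fst p \<noteq> fst q"
begin

lemma evec_arr_vecs: "evec p q \<in> arr_vecs m n"
proof -
  have *: "edge_vec n i j \<gamma> \<in> arr_vecs m n" if "i < j" "j < n" "\<gamma> ^ m = 1" for i j \<gamma>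
    using that by (auto simp: arr_vecs_eq)
  show ?thesis
    using p q pq by (auto simp: evec_def pts_iff power_divide intro!: *)
qed

lemma evec_neq_unit: "k < n \<Longrightarrow> evec p q \<noteq> unit_vec n k" "k < n \<Longrightarrow> unit_vec n k \<noteq> evec p q"
  using p q pq pts_nonzero[OF p] pts_nonzero[OF q]
  by (auto simp: evec_def pts_iff edge_vec_neq_unit_vec edge_vec_neq_unit_vec[symmetric])

lemma ecoef_evec:
  "ecoef p q \<cdot>\<^sub>v evec p q = snd p \<cdot>\<^sub>v unit_vec n (fst p) - snd q \<cdot>\<^sub>v unit_vec n (fst q)"
  using p q pq pts_nonzero[OF p] pts_nonzero[OF q]
  by (intro eq_vecI) (auto simp: evec_def ecoef_def edge_vec_index edge_vec_def pts_iff)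

lemma ecoef_nonzero: "ecoef p q \<noteq> 0"
  using pts_nonzero[OF p] pts_nonzero[OF q] by (auto simp: ecoef_def)

lemma lookup_X:
  "lkp (X p q) v = (if v = evec p q then ecoef p q else 0) - (if v = unit_vec n (fst p) then snd p else 0)
     + (if v = unit_vec n (fst q) then snd q else 0)"
  by (auto simp: X_def lookup_add lookup_minus lookup_single when_def)

lemma keys_X: "kys (X p q) \<subseteq> {evec p q, unit_vec n (fst p), unit_vec n (fst q)}"
  by (auto simp: in_keys_iff lookup_X split: if_splits)

lemma X_kernel: "X p q \<in> K"
proof -
  have "vcoord a (X p q) = 0" if "a < n" for a
  proof -
    have "ecoef p q * evec p q $ a = snd p * unit_vec n (fst p) $ a - snd q * unit_vec n (fst q) $ a"
      using arg_cong[OF ecoef_evec, of "\<lambda>v. v $ a"] that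
      by (auto simp: evec_def)
    then show ?thesis by (simp add: X_def vcoord_add vcoord_diff vcoord_single)
  qed
  moreover have "kys (X p q) \<subseteq> arr_vecs m n"
    using p q by (intro order.trans[OF keys_X]) (auto simp: evec_arr_vecs, auto simp: arr_vecs_eq pts_iff)
  ultimately show ?thesis by (simp add: mem_arr_kernel)
qed

lemma X_swap: "X q p = - X p q"
  using pq by (auto simp: X_def evec_def ecoef_def single_uminus)

lemma X_scale: "\<gamma> \<noteq> 0 \<Longrightarrow> X (pscale \<gamma> p) (pscale \<gamma> q) = cscale \<gamma> (X p q)"
  by (auto simp: X_def evec_def ecoef_def cscale_add cscale_minus)

lemma x_sym: "x p q \<in> SK"
  using X_kernel by (simp add: x_def sym_carrier.lin)

lemma x_swap: "x q p = - x p q"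
  by (simp add: x_def X_swap lin_form_uminus)

lemma x_scale: "\<gamma> \<noteq> 0 \<Longrightarrow> x (pscale \<gamma> p) (pscale \<gamma> q) = poly_const \<gamma> * x p q"
  by (simp add: x_def X_scale lin_form_cscale)

end

definition xgens :: "(complex vec \<Rightarrow>\<^sub>0 complex) set" where
  "xgens = {X p q | p q. p \<in> pts \<and> q \<in> pts \<and> fst p \<noteq> fst q}"

text \<open>Among the lifts \<open>X (i, 1) (j, \<gamma>)\<close> with i < j, exactly one has a
  nonzero coordinate at a given edge vector, and that coordinate is 1. Subtracting suitable
  multiples therefore clears all edge coordinates of \<open>u\<close>. The remainder lies in the
  kernel and is supported on the unit vectors, which are linearly independent, so it is
  zero.\<close>

lemma kernel_decomposition:
  assumes "u \<in> K"
  shows "\<exists>(S :: (nat \<times> nat \<times> complex) set) c g. finite S \<and> (\<forall>e\<in>S. g e \<in> xgens) \<and>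
    u = (\<Sum>e\<in>S. cscale (c e) (g e))"
proof -
  define E where "E = {(i, j, \<gamma>). i < j \<and> j < n \<and> (\<gamma>::complex) ^ m = 1}"
  define ev where "ev = (\<lambda>(i, j, \<gamma>). edge_vec n i j \<gamma>)"
  define g where "g = (\<lambda>(i, j, \<gamma>). X (i, 1) (j, \<gamma>))"
  have "E \<subseteq> {..<n} \<times> {..<n} \<times> {\<gamma>. \<gamma> ^ m = 1}" by (auto simp: E_def)
  then have finE: "finite E"
    by (rule finite_subset) (intro finite_cartesian_product finite_lessThan finite_roots)
  have g: "g e \<in> K" "g e \<in> xgens" if "e \<in> E" for e
    using that X_kernel by (fastforce simp: E_def g_def pts_iff xgens_def)+
  have lk: "lkp (g e) (ev e') = (if e = e' then 1 else 0)" if "e \<in> E" "e' \<in> E" for e e'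
    using that by (auto simp: E_def g_def ev_def lookup_X pts_iff evec_def ecoef_def edge_vec_inject
        edge_vec_neq_unit_vec root_nonzero split: if_splits)
  define u' where "u' = (\<Sum>e\<in>E. cscale (lkp u (ev e)) (g e))"
  define d where "d = u - u'"
  have "d \<in> K"
    unfolding d_def u'_def by (intro arr_kernel_diff assms arr_kernel_sum arr_kernel_cscale g)
  have "lkp d (ev e) = 0" if "e \<in> E" for e
    using that finE by (simp add: d_def u'_def lookup_minus lookup_sum lk sum.delta if_distrib cong: if_cong)
  then have keys_d: "kys d \<subseteq> unit_vec n ` {..<n}"
  proof -
    have "v \<in> unit_vec n ` {..<n}" if v: "v \<in> kys d" for v
    proof (rule ccontr)
      assume "v \<notin> unit_vec n ` {..<n}"
      moreover have "v \<in> arr_vecs m n" using v \<open>d \<in> K\<close> by (auto simp: mem_arr_kernel)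
      ultimately obtain i j \<gamma> where *: "i < j" "j < n" "\<gamma> ^ m = 1" "v = edge_vec n i j \<gamma>"
        by (auto simp: arr_vecs_eq)
      then have "lkp d (ev (i, j, \<gamma>)) = 0" using \<open>\<And>e. e \<in> E \<Longrightarrow> lkp d (ev e) = 0\<close> by (simp add: E_def)
      with v * show False by (simp add: ev_def in_keys_iff)
    qed
    then show ?thesis by blast
  qed
  have "lkp d (unit_vec n a) = 0" if "a < n" for a
  proof -
    have "vcoord a d = (\<Sum>v\<in>unit_vec n ` {..<n}. lkp d v * v $ a)"
      unfolding vcoord_def using keys_d by (intro sum.mono_neutral_left) (auto simp: in_keys_iff)
    also have "\<dots> = (\<Sum>k<n. lkp d (unit_vec n k) * unit_vec n k $ a)"
      by (subst sum.reindex) (auto simp: inj_on_def unit_vec_inject)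
    also have "\<dots> = lkp d (unit_vec n a)"
      using that by (simp add: sum.delta if_distrib cong: if_cong)
    finally show ?thesis using \<open>d \<in> K\<close> that by (simp add: mem_arr_kernel)
  qed
  with keys_d have "d = 0" by (intro poly_mapping_eqI) (auto simp: in_keys_iff subset_iff image_iff)
  then have "u = u'" by (simp add: d_def)
  then show ?thesis
    using finE g(2) unfolding u'_def by (intro exI[of _ E] exI[of _ "\<lambda>e. lkp u (ev e)"] exI[of _ g]) simp
qed

lemma kernel_span:
  assumes "u \<in> K"
  shows "lin_form u \<in> cspan (lin_form ` xgens)"
proof -
  obtain S :: "(nat \<times> nat \<times> complex) set" and c g
    where g: "\<And>e. e \<in> S \<Longrightarrow> g e \<in> xgens" and u: "u = (\<Sum>e\<in>S. cscale (c e) (g e))"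
    using kernel_decomposition[OF assms] by blast
  have "lin_form u = (\<Sum>e\<in>S. poly_const (c e) * lin_form (g e))"
    by (simp add: u lin_form_sum lin_form_cscale)
  then show ?thesis
    by (simp only:) (intro cspan_sum cspan_scale cspan_base imageI g)
qed

lemma kernel_induct [consumes 1, case_names zero step]:
  assumes "u \<in> K" and "P 0"
    and step: "\<And>c p q u. p \<in> pts \<Longrightarrow> q \<in> pts \<Longrightarrow> fst p \<noteq> fst q \<Longrightarrow> u \<in> K \<Longrightarrow> P u \<Longrightarrow> P (cscale c (X p q) + u)"
  shows "P u"
proof -
  obtain S :: "(nat \<times> nat \<times> complex) set" and c g
    where S: "finite S" and g: "\<And>e. e \<in> S \<Longrightarrow> g e \<in> xgens" and u: "u = (\<Sum>e\<in>S. cscale (c e) (g e))"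
    using kernel_decomposition[OF assms(1)] by blast
  have "P (\<Sum>e\<in>T. cscale (c e) (g e)) \<and> (\<Sum>e\<in>T. cscale (c e) (g e)) \<in> K" if "finite T" "T \<subseteq> S" for T
    using that
  proof (induction T rule: finite_induct)
    case (insert e T)
    then obtain p q where "g e = X p q" "p \<in> pts" "q \<in> pts" "fst p \<noteq> fst q"
      using g[of e] by (auto simp: xgens_def)
    with insert step show ?case by (simp add: arr_kernel_add arr_kernel_cscale X_kernel)
  qed (simp add: assms(2) arr_kernel_0)
  then show ?thesis using S u by blast
qed

section \<open>Generators of the internal ideal\<close>

text \<open>Shows that different coordinates cut out different hyperplanes of the kernel. For a unit
  vector \<open>v'\<close> on axis i, since n >= 3 some other axis has a unit vector different from
  \<open>v\<close>, and two roots of unity offer two edges to it, one of which avoids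
  \<open>v\<close>. For an edge \<open>v'\<close>, its lift works unless \<open>v\<close> is the
  unit vector of an end axis; then a second lift with the same coordinate at \<open>v\<close> is
  subtracted.\<close>

lemma separating_kernel_element:
  assumes v: "v \<in> arr_vecs m n" and v': "v' \<in> arr_vecs m n" and "v \<noteq> v'"
  shows "\<exists>f\<in>K. lkp f v = 0 \<and> lkp f v' \<noteq> 0"
proof -
  obtain \<delta> :: complex where \<delta>: "\<delta> ^ m = 1" "\<delta> \<noteq> 1" using ex_root_neq_1 by blast
  have "\<delta> \<noteq> 0" using \<delta> root_nonzero by blast
  consider (unit) i where "i < n" "v' = unit_vec n i"
    | (edge) i j \<gamma> where "i < j" "j < n" "\<gamma> ^ m = 1" "v' = edge_vec n i j \<gamma>"
    using v' by (auto simp: arr_vecs_eq)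
  then show ?thesis
  proof cases
    case unit
    have "\<exists>j<n. j \<noteq> i \<and> v \<noteq> unit_vec n j"
    proof (rule ccontr)
      assume *: "\<not> ?thesis"
      obtain j k where jk: "j < n" "k < n" "j \<noteq> i" "k \<noteq> i" "j \<noteq> k"
        using that[of 0 1] that[of 0 2] that[of 1 2] n_ge_3 by (cases "i = 0"; cases "i = 1") auto
      then have "v = unit_vec n j" "v = unit_vec n k" using * by auto
      then show False using jk unit_vec_inject[of j n k] by simp
    qed
    then obtain j where j: "j < n" "j \<noteq> i" "v \<noteq> unit_vec n j" by blast
    have "evec (i, 1) (j, 1) \<noteq> evec (i, 1) (j, \<delta>)"
      using \<delta> j unit \<open>\<delta> \<noteq> 0\<close> by (auto simp: evec_def edge_vec_inject)
    then obtain \<gamma> where \<gamma>: "\<gamma> \<in> {1, \<delta>}" "v \<noteq> evec (i, 1) (j, \<gamma>)" by blast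
    have P: "(i, 1) \<in> pts" "(j, \<gamma>) \<in> pts" using unit j \<gamma>(1) \<delta> by (auto simp: pts_iff)
    then show ?thesis
      using unit j \<gamma>(2) \<open>v \<noteq> v'\<close> evec_neq_unit[OF P]
      by (intro bexI[of _ "X (i, 1) (j, \<gamma>)"]) (auto simp: lookup_X unit_vec_inject X_kernel)
  next
    case edge
    have "\<gamma> \<noteq> 0" using edge root_nonzero by blast
    have P: "(i, 1) \<in> pts" "(j, \<gamma>) \<in> pts" "(j, \<delta> * \<gamma>) \<in> pts" "(i, \<delta>) \<in> pts"
      using edge \<delta> by (auto simp: pts_iff power_mult_distrib)
    have ev: "evec (i, 1) (j, \<gamma>) = v'" "evec (i, 1) (j, \<delta> * \<gamma>) \<noteq> v'" "evec (i, \<delta>) (j, \<gamma>) \<noteq> v'"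
        "ecoef (i, 1) (j, \<gamma>) = 1"
      using edge \<delta> \<open>\<gamma> \<noteq> 0\<close> \<open>\<delta> \<noteq> 0\<close> by (auto simp: evec_def ecoef_def edge_vec_inject field_simps)
    have nu: "v' \<noteq> unit_vec n k" "unit_vec n k \<noteq> v'" if "k < n" for k
      using edge \<open>\<gamma> \<noteq> 0\<close> that by (simp_all add: edge_vec_neq_unit_vec edge_vec_neq_unit_vec[symmetric])
    consider "v = unit_vec n i" | "v = unit_vec n j" | "v \<noteq> unit_vec n i" "v \<noteq> unit_vec n j" by blast
    then show ?thesis
    proof cases
      case 1
      show ?thesis
        by (rule bexI[of _ "X (i, 1) (j, \<gamma>) - X (i, 1) (j, \<delta> * \<gamma>)"])
          (use edge P ev nu 1 in \<open>auto simp: lookup_minus lookup_X arr_kernel_diff X_kernel evec_neq_unit unit_vec_inject\<close>)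
    next
      case 2
      show ?thesis
        by (rule bexI[of _ "X (i, 1) (j, \<gamma>) - X (i, \<delta>) (j, \<gamma>)"])
          (use edge P ev nu 2 in \<open>auto simp: lookup_minus lookup_X arr_kernel_diff X_kernel evec_neq_unit unit_vec_inject\<close>)
    next
      case 3
      show ?thesis
        by (rule bexI[of _ "X (i, 1) (j, \<gamma>)"])
          (use edge P ev nu 3 \<open>v \<noteq> v'\<close> in \<open>auto simp: lookup_X X_kernel\<close>)
    qed
  qed
qed

text \<open>\<open>dual_arr\<close> is a set of hyperplanes, so counting hyperplanes amounts to
  counting coordinates only because \<open>separating_kernel_element\<close> makes them
  distinct.\<close>

lemma arr_rho_eq:
  assumes "u \<in> K"
  shows "arr_rho \<A> u = card (kys u)"
proof -
  let ?G = "\<lambda>v. {f \<in> K. lkp f v = 0}"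
  have keys: "kys u \<subseteq> arr_vecs m n" using assms by (simp add: mem_arr_kernel)
  have "{H \<in> \<A>. u \<notin> H} = ?G ` kys u"
    using assms keys by (auto simp: dual_arr_def in_keys_iff)
  moreover have "inj_on ?G (arr_vecs m n)"
    by (rule inj_onI) (use separating_kernel_element in blast)
  then have "inj_on ?G (kys u)" using keys by (rule inj_on_subset)
  ultimately show ?thesis by (simp add: arr_rho_def card_image)
qed

lemma lin_form_square_ideal:
  assumes "u \<in> K" "card (kys u) \<le> 3"
  shows "lin_form u * lin_form u \<in> I"
  using iideal_gen_le[OF assms(1), of \<A> 2] assms by (simp add: arr_rho_eq power2_eq_square)

lemma card_le_3: "S \<subseteq> {a, b, c} \<Longrightarrow> card S \<le> 3"
  using card_mono[of "{a, b, c}" S] by (auto simp: card_insert_if split: if_splits)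

lemma x_square:
  assumes "p \<in> pts" "q \<in> pts" "fst p \<noteq> fst q"
  shows "x p q * x p q \<in> I"
  unfolding x_def by (intro lin_form_square_ideal X_kernel assms card_le_3[OF keys_X])

text \<open>In \<open>X p q - X p q'\<close> the unit coordinate at \<open>p\<close> cancels, which
  leaves at most two edges and the common axis of \<open>q\<close> and \<open>q'\<close>. Modulo the
  squares of the two edges, the square of this difference is -2 times the product.\<close>

lemma x_parallel:
  assumes "p \<in> pts" "q \<in> pts" "q' \<in> pts" "fst p \<noteq> fst q" "fst q' = fst q"
  shows "x p q * x p q' \<in> I"
proof -
  let ?u = "X p q - X p q'"
  have u: "?u \<in> K" using assms by (intro arr_kernel_diff X_kernel) auto
  have "kys ?u \<subseteq> {evec p q, evec p q', unit_vec n (fst q)}"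
    using assms by (auto simp: in_keys_iff lookup_minus lookup_X split: if_splits)
  then have "lin_form ?u * lin_form ?u \<in> I" by (intro lin_form_square_ideal u card_le_3)
  moreover have "x p q * x p q + x p q' * x p q' \<in> I"
    using assms by (intro iideal_add x_square) auto
  ultimately have "(x p q * x p q + x p q' * x p q') - lin_form ?u * lin_form ?u \<in> I"
    by (intro iideal_diff)
  also have "(x p q * x p q + x p q' * x p q') - lin_form ?u * lin_form ?u = poly_const 2 * (x p q * x p q')"
    by (simp add: poly_const_2 x_def lin_form_diff algebra_simps)
  finally show ?thesis by (subst (asm) iideal_scale_iff) simp_all
qed

text \<open>Around a triangle all unit coordinates cancel and only the three edges remain. The cross
  terms of the square are twice the relation.\<close>

lemma x_triangle:
  assumes "a \<in> pts" "b \<in> pts" "c \<in> pts" "fst a \<noteq> fst b" "fst b \<noteq> fst c" "fst c \<noteq> fst a"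
  shows "x a b * x b c + x b c * x c a + x c a * x a b \<in> I"
proof -
  let ?u = "X a b + X b c + X c a"
  have u: "?u \<in> K" using assms by (intro arr_kernel_add X_kernel) auto
  have "kys ?u \<subseteq> {evec a b, evec b c, evec c a}"
    using assms by (auto simp: in_keys_iff lookup_add lookup_X split: if_splits)
  then have "lin_form ?u * lin_form ?u \<in> I" by (intro lin_form_square_ideal u card_le_3)
  then have "lin_form ?u * lin_form ?u - (x a b * x a b + x b c * x b c + x c a * x c a) \<in> I"
    using assms by (intro iideal_diff iideal_add x_square) auto
  moreover have "lin_form ?u * lin_form ?u - (x a b * x a b + x b c * x b c + x c a * x c a)
      = poly_const 2 * (x a b * x b c + x b c * x c a + x c a * x a b)"
    by (simp add: poly_const_2 x_def lin_form_add algebra_simps)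
  ultimately show ?thesis by (simp add: iideal_scale_iff)
qed

end

context monomial_arrangement
begin

section \<open>Spans modulo the internal ideal\<close>

definition ispan :: "complex vec cpoly set \<Rightarrow> complex vec cpoly set" where
  "ispan G = {s. \<exists>p\<in>cspan G. s - p \<in> I}"

lemma ispan_add: "s \<in> ispan G \<Longrightarrow> t \<in> ispan G \<Longrightarrow> s + t \<in> ispan G"
proof -
  assume "s \<in> ispan G" "t \<in> ispan G"
  then obtain p q where "p \<in> cspan G" "s - p \<in> I" "q \<in> cspan G" "t - q \<in> I" by (auto simp: ispan_def)
  then have "p + q \<in> cspan G" "s + t - (p + q) \<in> I"
    using iideal_add[of "s - p" K \<A> "t - q"] by (auto simp: cspan_add algebra_simps)
  then show ?thesis by (auto simp: ispan_def)
qed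

lemma ispan_scale: "s \<in> ispan G \<Longrightarrow> poly_const c * s \<in> ispan G"
proof -
  assume "s \<in> ispan G"
  then obtain p where "p \<in> cspan G" "s - p \<in> I" by (auto simp: ispan_def)
  then have "poly_const c * p \<in> cspan G" "poly_const c * s - poly_const c * p \<in> I"
    using iideal_scale[of "s - p" K \<A> c] by (auto simp: cspan_scale right_diff_distrib)
  then show ?thesis by (auto simp: ispan_def)
qed

lemma ispan_cspan: "p \<in> cspan G \<Longrightarrow> p \<in> ispan G"
  by (auto simp: ispan_def iideal_0 intro!: bexI[of _ p])

lemma ispan_base: "g \<in> G \<Longrightarrow> g \<in> ispan G"
  by (simp add: ispan_cspan cspan_base)

lemma ispan_ideal: "p \<in> I \<Longrightarrow> p \<in> ispan G"
  by (auto simp: ispan_def intro!: bexI[of _ 0] cspan.zero)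

lemma ispan_uminus: "s \<in> ispan G \<Longrightarrow> - s \<in> ispan G"
  using ispan_scale[of s G "-1"] by (simp add: poly_const_uminus)

lemma ispan_sum: "(\<And>a. a \<in> S \<Longrightarrow> f a \<in> ispan G) \<Longrightarrow> (\<Sum>a\<in>S. f a) \<in> ispan G"
  by (induction S rule: infinite_finite_induct) (auto intro: ispan_add ispan_cspan cspan.zero)

lemma ispan_cong: "s - t \<in> I \<Longrightarrow> t \<in> ispan G \<Longrightarrow> s \<in> ispan G"
  using ispan_add[of t G "s - t"] ispan_ideal by force

lemma ispan_mult:
  assumes "s \<in> ispan G" "y \<in> SK" "\<And>g. g \<in> G \<Longrightarrow> g * y \<in> ispan H"
  shows "s * y \<in> ispan H"
proof -
  obtain p where p: "p \<in> cspan G" "s - p \<in> I" using assms(1) by (auto simp: ispan_def)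
  have "p * y \<in> ispan H"
    using p(1)
  proof induction
    case zero
    then show ?case by (simp add: ispan_cspan cspan.zero)
  next
    case (step g s c)
    have "(poly_const c * g + s) * y = poly_const c * (g * y) + s * y" by (simp add: algebra_simps)
    then show ?case
      using ispan_add[OF ispan_scale[OF assms(3)[OF step.hyps(1)]] step.IH] by (simp only:)
  qed
  moreover have "s * y - p * y \<in> I"
    using iideal_mult[OF p(2) assms(2)] by (simp add: algebra_simps)
  ultimately show ?thesis by (rule ispan_cong[rotated])
qed

lemma ispan_trans:
  assumes "s \<in> ispan G" "G \<subseteq> ispan H"
  shows "s \<in> ispan H"
proof -
  have "s * 1 \<in> ispan H"
    by (rule ispan_mult[OF assms(1) sym_carrier_1]) (use assms(2) in auto)
  then show ?thesis by simp
qed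

lemma ispan_empty: "s \<in> ispan {} \<Longrightarrow> s \<in> I"
proof -
  have "p = 0" if "p \<in> cspan {}" for p :: "complex vec cpoly"
    using that by cases auto
  then show "s \<in> ispan {} \<Longrightarrow> s \<in> I" unfolding ispan_def by force
qed

section \<open>Straightening of edge monomials\<close>

definition nmon :: "(nat \<Rightarrow> nat \<times> complex) \<Rightarrow> nat set \<Rightarrow> complex vec cpoly" where
  "nmon e J = (\<Prod>j\<in>J. x (e j) (j, 1))"

text \<open>Monomials of increasing forests with \<open>k\<close> edges: each j in \<open>J\<close>
  is joined to one parent \<open>e j\<close> on a smaller axis. Scaling an edge changes it only by a
  constant, so j itself may carry the scalar 1.\<close>

definition nmons :: "nat \<Rightarrow> complex vec cpoly set" where
  "nmons k = {nmon e J | e J. J \<subseteq> {..<n} \<and> card J = k \<and> (\<forall>j\<in>J. e j \<in> pts \<and> fst (e j) < j)}"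

lemma pt_one: "j < n \<Longrightarrow> (j, 1) \<in> pts"
  by (simp add: pts_iff)

lemma x_normalise:
  assumes "p \<in> pts" "q \<in> pts" "fst p \<noteq> fst q"
  shows "x p q = poly_const (snd q) * x (pscale (inverse (snd q)) p) (fst q, 1)"
    and "pscale (inverse (snd q)) p \<in> pts"
proof -
  have q: "snd q \<noteq> 0" "snd q ^ m = 1" using assms pts_nonzero by (auto simp: pts_iff)
  show p': "pscale (inverse (snd q)) p \<in> pts"
    using assms(1) q by (intro pscale_pts) (auto simp: power_inverse)
  have "pscale (snd q) (pscale (inverse (snd q)) p) = p" "pscale (snd q) (fst q, 1) = q"
    using q by (auto simp: pscale_def prod_eq_iff)
  then show "x p q = poly_const (snd q) * x (pscale (inverse (snd q)) p) (fst q, 1)"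
    using x_scale[OF p' pt_one, of "fst q" "snd q"] assms q by (auto simp: pts_iff)
qed

text \<open>Induction on the larger axis j of the new edge. If j has no parent yet, the product is
  again an increasing forest. If the old parent a and the new one b lie on the same axis, the two
  edges multiply to zero by \<open>x_parallel\<close>. Otherwise the triangle relation keeps only
  one of the two edges at j and introduces the edge between a and b, whose larger axis is below
  j.\<close>

lemma nmon_mult_edge_less:
  assumes "g \<in> nmons k" "p \<in> pts" "q \<in> pts" "fst p < fst q"
  shows "g * x p q \<in> ispan (nmons (Suc k))"
  using assms
proof (induction "fst q" arbitrary: g p q rule: less_induct)
  case less
  obtain e J where g: "g = nmon e J" and J: "J \<subseteq> {..<n}" "card J = k"
    and e: "\<And>j. j \<in> J \<Longrightarrow> e j \<in> pts \<and> fst (e j) < j"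
    using less.prems(1) by (auto simp: nmons_def)
  have finJ: "finite J" using J(1) by (rule finite_subset) simp
  define j where "j = fst q"
  define b where "b = pscale (inverse (snd q)) p"
  define c where "c = (j, 1 :: complex)"
  have jn: "j < n" using less.prems by (simp add: j_def pts_iff)
  have c: "c \<in> pts" "fst c = j" using jn by (auto simp: c_def pt_one)
  have b: "b \<in> pts" "fst b < j" and xpq: "x p q = poly_const (snd q) * x b c"
    using x_normalise[of p q] less.prems by (auto simp: b_def c_def j_def)
  have "g * x b c \<in> ispan (nmons (Suc k))"
  proof (cases "j \<in> J")
    case False
    have "g * x b c = nmon (e(j := b)) (insert j J)"
      using False finJ unfolding g nmon_def c_def
      by (auto simp: mult.commute intro!: arg_cong2[of _ _ _ _ "(*)"] prod.cong)
    also have "\<dots> \<in> nmons (Suc k)"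
    proof -
      have "\<forall>i\<in>insert j J. (e(j := b)) i \<in> pts \<and> fst ((e(j := b)) i) < i" using b e by simp
      with False finJ J jn show ?thesis
        unfolding nmons_def by (intro CollectI exI[of _ "e(j := b)"] exI[of _ "insert j J"]) auto
    qed
    finally show ?thesis by (rule ispan_base)
  next
    case True
    define a where "a = e j"
    define R where "R = nmon e (J - {j})"
    have a: "a \<in> pts" "fst a < j" using e[OF True] by (auto simp: a_def)
    have ga: "g = R * x a c"
      unfolding g R_def nmon_def a_def c_def using True finJ by (simp add: prod.remove mult.commute)
    have gb: "R * x b c = nmon (e(j := b)) J"
    proof -
      have "nmon (e(j := b)) (J - {j}) = R" unfolding R_def nmon_def by (intro prod.cong) auto
      then show ?thesis
        unfolding nmon_def c_def using True finJ by (simp add: prod.remove mult.commute)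
    qed
    have Rx: "R \<in> SK"
    proof -
      have "e i \<in> pts \<and> (i, 1) \<in> pts \<and> fst (e i) \<noteq> i" if "i \<in> J" for i
        using e[OF that] J that by (auto intro!: pt_one)
      then show ?thesis unfolding R_def nmon_def by (intro sym_carrier_prod x_sym) auto
    qed
    have R_b: "R * x b c \<in> nmons k"
      unfolding gb nmons_def using J b e by (intro CollectI exI[of _ "e(j := b)"] exI[of _ J]) auto
    have R_a: "R * x a c \<in> nmons k" using less.prems(1) ga by simp
    show ?thesis
    proof (cases "fst a = fst b")
      case True
      have "x c a * x c b \<in> I" using a b c True by (intro x_parallel) auto
      then have "x a c * x b c \<in> I" using a b c x_swap[of a c] x_swap[of b c] by auto
      then have "R * (x a c * x b c) \<in> I" by (rule iideal_mult[OF _ Rx])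
      then show ?thesis by (simp add: ga ispan_ideal mult.assoc)
    next
      case False
      have IH: "h * x a b \<in> ispan (nmons (Suc k))" if h: "h \<in> nmons k" for h
      proof (cases "fst a < fst b")
        case True
        then show ?thesis using less.hyps[of b h a] h a b by (auto simp: j_def)
      next
        case False
        then have "fst b < fst a" using \<open>fst a \<noteq> fst b\<close> by simp
        then have "h * x b a \<in> ispan (nmons (Suc k))"
          using less.hyps[of a h b] h a b by (auto simp: j_def)
        moreover have "x a b = - x b a" using a b \<open>fst a \<noteq> fst b\<close> by (intro x_swap) auto
        ultimately show ?thesis using ispan_uminus[of "h * x b a" "nmons (Suc k)"] by simp
      qed
      have xca: "x c a = - x a c" using a c by (intro x_swap) auto
      have "R * (x a b * x b c + x b c * x c a + x c a * x a b) \<in> I"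
        using a b c False by (intro iideal_mult Rx x_triangle) auto
      then have "- (R * (x a b * x b c + x b c * x c a + x c a * x a b)) \<in> I"
        by (rule iideal_uminus)
      moreover have "- (R * (x a b * x b c + x b c * x c a + x c a * x a b)) =
          g * x b c - (R * x b c * x a b + - (R * x a c * x a b))"
        by (simp add: xca ga algebra_simps)
      ultimately have "g * x b c - (R * x b c * x a b + - (R * x a c * x a b)) \<in> I" by simp
      then show ?thesis
        by (rule ispan_cong) (intro ispan_add ispan_uminus IH R_b R_a)
    qed
  qed
  then have "poly_const (snd q) * (g * x b c) \<in> ispan (nmons (Suc k))" by (rule ispan_scale)
  then show ?case by (simp add: xpq mult_ac)
qed

lemma nmon_mult_edge:
  assumes "g \<in> nmons k" "p \<in> pts" "q \<in> pts" "fst p \<noteq> fst q"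
  shows "g * x p q \<in> ispan (nmons (Suc k))"
proof (cases "fst p < fst q")
  case False
  then have "g * x q p \<in> ispan (nmons (Suc k))" using assms by (intro nmon_mult_edge_less) auto
  moreover have "x p q = - x q p" using assms by (intro x_swap) auto
  ultimately show ?thesis using ispan_uminus[of "g * x q p" "nmons (Suc k)"] by simp
qed (rule nmon_mult_edge_less[OF assms(1-3)])

lemma prods_xgens_ispan: "g \<in> prods_of k (lin_form ` xgens) \<Longrightarrow> g \<in> ispan (nmons k)"
proof (induction k arbitrary: g)
  case 0
  then have "g = nmon undefined {}" by (simp add: nmon_def)
  then have "g \<in> nmons 0" unfolding nmons_def by (intro CollectI exI[of _ undefined] exI[of _ "{}"]) simp
  then show ?case by (rule ispan_base)
next
  case (Suc k)
  then obtain ps where "g = prod_list ps" "set ps \<subseteq> lin_form ` xgens" "length ps = Suc k"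
    by (auto simp: prods_of_def)
  then obtain r rs where ps: "g = r * prod_list rs" "r \<in> lin_form ` xgens" "set rs \<subseteq> lin_form ` xgens" "length rs = k"
    by (cases ps) auto
  then obtain p q where r: "r = x p q" "p \<in> pts" "q \<in> pts" "fst p \<noteq> fst q"
    by (auto simp: xgens_def x_def)
  have "prod_list rs \<in> ispan (nmons k)" using ps by (intro Suc.IH) (auto simp: prods_of_def)
  then have "prod_list rs * x p q \<in> ispan (nmons (Suc k))"
    using r by (elim ispan_mult) (auto intro: nmon_mult_edge x_sym)
  then show ?case by (simp add: ps(1) r(1) mult.commute)
qed

lemma homogeneous_ispan_nmons:
  assumes "p \<in> SK" "homogeneous k p"
  shows "p \<in> ispan (nmons k)"
proof (rule ispan_trans)
  show "p \<in> ispan (prods_of k (lin_form ` xgens))"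
    by (intro ispan_cspan homogeneous_sym_carrier_span[OF assms] kernel_span)
qed (use prods_xgens_ispan in blast)

text \<open>Axis 0 has no smaller axis to be attached to. Hence an increasing forest has at most n -
  1 edges, which bounds the degree.\<close>

lemma nmons_index:
  assumes "J \<subseteq> {..<n}" "\<forall>j\<in>J. e j \<in> pts \<and> fst (e j) < j"
  shows "J \<subseteq> {1..<n}"
proof
  fix j assume "j \<in> J"
  with assms have "fst (e j) < j" "j < n" by auto
  then show "j \<in> {1..<n}" by auto
qed

lemma high_degree_ideal:
  assumes "p \<in> SK" "homogeneous k p" "k \<ge> n"
  shows "p \<in> I"
proof -
  have "card J < n" if "J \<subseteq> {..<n}" "\<forall>j\<in>J. e j \<in> pts \<and> fst (e j) < j" for e J
    using card_mono[OF _ nmons_index[OF that]] n_ge_3 by simp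
  then have "nmons k = {}" using assms(3) by (fastforce simp: nmons_def)
  then show ?thesis using homogeneous_ispan_nmons[OF assms(1,2)] ispan_empty by simp
qed

section \<open>Paths\<close>

fun path :: "(nat \<times> complex) list \<Rightarrow> complex vec cpoly" where
  "path (p # q # ps) = x p q * path (q # ps)"
| "path ps = 1"

definition distinct_ax :: "(nat \<times> complex) list \<Rightarrow> bool" where
  "distinct_ax ps \<longleftrightarrow> set ps \<subseteq> pts \<and> distinct (map fst ps)"

lemma path_append: "path (us @ a # vs) = path (us @ [a]) * path (a # vs)"
  by (induction us rule: path.induct) (auto simp: mult.assoc)

lemma path_append2: "path (us @ [a, b]) = path (us @ [a]) * x a b"
  using path_append[of us a "[b]"] by simp

lemma distinct_ax_Cons: "distinct_ax (p # ps) \<longleftrightarrow>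
  p \<in> pts \<and> distinct_ax ps \<and> fst p \<notin> fst ` set ps"
  by (auto simp: distinct_ax_def)

lemma distinct_ax_append: "distinct_ax (ps @ qs) \<longleftrightarrow>
  distinct_ax ps \<and> distinct_ax qs \<and> fst ` set ps \<inter> fst ` set qs = {}"
  by (auto simp: distinct_ax_def)

lemma distinct_ax_Nil [simp]: "distinct_ax []"
  by (simp add: distinct_ax_def)

lemma distinct_ax_mset:
  assumes "mset ps = mset qs"
  shows "distinct_ax ps \<longleftrightarrow> distinct_ax qs"
proof -
  have "mset (map fst ps) = mset (map fst qs)" using assms by simp
  then have "distinct (map fst ps) \<longleftrightarrow> distinct (map fst qs)" by (rule mset_eq_imp_distinct_iff)
  then show ?thesis using mset_eq_setD[OF assms] by (simp add: distinct_ax_def)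
qed

lemma path_sym: "distinct_ax ps \<Longrightarrow> path ps \<in> SK"
  by (induction ps rule: path.induct)
    (auto simp: distinct_ax_Cons intro!: sym_carrier.mult x_sym sym_carrier_1)

lemma homogeneous_path: "ps \<noteq> [] \<Longrightarrow> homogeneous (length ps - 1) (path ps)"
proof (induction ps rule: path.induct)
  case (1 p q ps)
  then show ?case
    using homogeneous_mult[OF homogeneous_lin_form, of "length ps" "path (q # ps)"] by (simp add: x_def)
qed (use homogeneous_const[of 1] in auto)

lemma path_scale:
  assumes "distinct_ax ps" "\<gamma> \<noteq> 0"
  shows "path (map (pscale \<gamma>) ps) = poly_const (\<gamma> ^ (length ps - 1)) * path ps"
  using assms(1)
proof (induction ps rule: path.induct)
  case (1 p q ps)
  then show ?case
    using x_scale[of p q \<gamma>] assms(2) by (auto simp: distinct_ax_Cons poly_const_mult mult_ac)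
qed auto

text \<open>A pendant edge slides along the path. Modulo the ideal the triangle relation reads
  \<open>x a c * x a b = x a b * x b c + x a c * x c b\<close>: the vertex \<open>b\<close> is
  either inserted between \<open>a\<close> and its successor \<open>c\<close>, or hung from
  \<open>c\<close>, where the induction hypothesis applies.\<close>

lemma path_insert_after_hd:
  assumes "distinct_ax (a # vs)" "b \<in> pts" "fst b \<notin> fst ` set (a # vs)"
  shows "path (a # vs) * x a b - (\<Sum>k\<le>length vs. path (a # take k vs @ b # drop k vs)) \<in> I"
  using assms
proof (induction vs arbitrary: a)
  case Nil
  then show ?case by (simp add: iideal_0)
next
  case (Cons c vs)
  let ?P = "path (c # vs)"
  let ?S = "\<Sum>k\<le>length vs. path (c # take k vs @ b # drop k vs)"
  have pts: "a \<in> pts" "b \<in> pts" "c \<in> pts" "fst a \<noteq> fst b" "fst b \<noteq> fst c" "fst c \<noteq> fst a"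
    using Cons.prems by (auto simp: distinct_ax_Cons)
  have IH: "?P * x c b - ?S \<in> I" using Cons.prems by (intro Cons.IH) (auto simp: distinct_ax_Cons)
  have sw: "x c a = - x a c" "x c b = - x b c" using pts by (auto intro: x_swap)
  have P: "?P \<in> SK" using Cons.prems by (intro path_sym) (auto simp: distinct_ax_Cons)
  have "(\<Sum>k\<le>length (c # vs). path (a # take k (c # vs) @ b # drop k (c # vs)))
      = x a b * x b c * ?P + x a c * ?S"
    by (simp add: sum.atMost_Suc_shift sum_distrib_left mult.assoc del: sum.atMost_Suc)
  then have "path (a # c # vs) * x a b - (\<Sum>k\<le>length (c # vs). path (a # take k (c # vs) @ b # drop k (c # vs)))
      = - (?P * (x a b * x b c + x b c * x c a + x c a * x a b)) + x a c * (?P * x c b - ?S)"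
    by (simp only: sw path.simps) (simp add: algebra_simps)
  also have "\<dots> \<in> I"
    using pts by (intro iideal_add iideal_uminus iideal_mult x_triangle P IH x_sym) auto
  finally show ?case .
qed

lemma path_insert_after:
  assumes "distinct_ax (us @ a # vs)" "b \<in> pts" "fst b \<notin> fst ` set (us @ a # vs)"
  shows "path (us @ a # vs) * x a b - (\<Sum>k\<le>length vs. path (us @ a # take k vs @ b # drop k vs)) \<in> I"
proof -
  have "path (us @ [a]) * (path (a # vs) * x a b - (\<Sum>k\<le>length vs. path (a # take k vs @ b # drop k vs))) \<in> I"
    using assms by (intro iideal_mult path_insert_after_hd path_sym)
      (auto simp: distinct_ax_append distinct_ax_Cons)
  then show ?thesis
    by (subst path_append, subst (2) path_append) (simp add: algebra_simps sum_distrib_left)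
qed

lemma path_insert_before_last:
  assumes "distinct_ax (us @ [a])" "b \<in> pts" "fst b \<notin> fst ` set (us @ [a])"
  shows "path (us @ [a]) * x b a - (\<Sum>k\<le>length us. path (take k us @ b # drop k us @ [a])) \<in> I"
  using assms
proof (induction us arbitrary: a rule: rev_induct)
  case Nil
  then show ?case by (simp add: iideal_0)
next
  case (snoc c us)
  let ?P = "path (us @ [c])"
  let ?S = "\<Sum>k\<le>length us. path (take k us @ b # drop k us @ [c])"
  have pts: "a \<in> pts" "b \<in> pts" "c \<in> pts" "fst a \<noteq> fst b" "fst b \<noteq> fst c" "fst c \<noteq> fst a"
    using snoc.prems by (auto simp: distinct_ax_append distinct_ax_Cons)
  have IH: "?P * x b c - ?S \<in> I"
    using snoc.prems by (intro snoc.IH) (auto simp: distinct_ax_append distinct_ax_Cons)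
  have sw: "x b a = - x a b" "x c b = - x b c" using pts by (auto intro: x_swap)
  have P: "?P \<in> SK"
    using snoc.prems by (intro path_sym) (auto simp: distinct_ax_append distinct_ax_Cons)
  have "path (take k us @ b # drop k us @ [c, a]) = path (take k us @ b # drop k us @ [c]) * x c a" for k
    using path_append2[of "take k us @ b # drop k us" c a] by simp
  moreover have "path (us @ [c, b, a]) = ?P * x c b * x b a"
    using path_append2[of "us @ [c]" b a] path_append2[of us c b] by simp
  ultimately have "(\<Sum>k\<le>length (us @ [c]). path (take k (us @ [c]) @ b # drop k (us @ [c]) @ [a]))
      = ?P * x c b * x b a + ?S * x c a"
    by (simp add: sum_distrib_right)
  then have "path ((us @ [c]) @ [a]) * x b a -
      (\<Sum>k\<le>length (us @ [c]). path (take k (us @ [c]) @ b # drop k (us @ [c]) @ [a]))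
      = - (?P * (x a b * x b c + x b c * x c a + x c a * x a b)) + x c a * (?P * x b c - ?S)"
    using path_append2[of us c a] by (simp only: sw append_assoc append_Cons append_Nil) (simp add: algebra_simps)
  also have "\<dots> \<in> I"
    using pts by (intro iideal_add iideal_uminus iideal_mult x_triangle P IH x_sym) auto
  finally show ?case .
qed

text \<open>Mirror image of \<open>path_insert_after\<close>, with \<open>b\<close> sliding towards
  the start. The pendant edge now points towards \<open>a\<close> and so has the opposite sign; this
  sign is the origin of the factor 1 - q^k in \<open>insertion_sum\<close>.\<close>

lemma path_insert_before:
  assumes "distinct_ax (us @ a # vs)" "b \<in> pts" "fst b \<notin> fst ` set (us @ a # vs)"
  shows "path (us @ a # vs) * x b a - (\<Sum>k\<le>length us. path (take k us @ b # drop k us @ a # vs)) \<in> I"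
proof -
  have "path (a # vs) * (path (us @ [a]) * x b a - (\<Sum>k\<le>length us. path (take k us @ b # drop k us @ [a]))) \<in> I"
    using assms by (intro iideal_mult path_insert_before_last path_sym)
      (auto simp: distinct_ax_append distinct_ax_Cons)
  moreover have "path (take k us @ b # drop k us @ a # vs) = path (a # vs) * path (take k us @ b # drop k us @ [a])" for k
    using path_append[of "take k us @ b # drop k us" a vs] by (simp add: mult.commute)
  ultimately show ?thesis
    using path_append[of us a vs] by (simp add: algebra_simps sum_distrib_left)
qed

definition rooted_paths :: "nat \<Rightarrow> complex vec cpoly set" where
  "rooted_paths k = {path ps | ps. distinct_ax ps \<and> fst ` set ps = {..<k} \<and> ps \<noteq> [] \<and> hd ps = (0, 1)}"

text \<open>Increasing trees are turned into paths one vertex at a time. The new vertex hangs from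
  some vertex of each path obtained so far and is distributed by \<open>path_insert_after\<close>;
  as it is always inserted after an existing vertex, the starting point (0, 1) is kept.\<close>

lemma nmon_ispan_rooted_paths:
  assumes "1 \<le> k" "k \<le> n" "\<And>j. 1 \<le> j \<Longrightarrow> j < k \<Longrightarrow> e j \<in> pts \<and> fst (e j) < j"
  shows "nmon e {1..<k} \<in> ispan (rooted_paths k)"
  using assms
proof (induction k rule: dec_induct)
  case base
  have "nmon e {1..<1} = path [(0, 1)]" by (simp add: nmon_def)
  then show ?case
    unfolding rooted_paths_def using n_ge_3
    by (intro ispan_base CollectI exI[of _ "[(0, 1)]"]) (auto simp: distinct_ax_def pts_iff)
next
  case (step k)
  have ek: "e k \<in> pts" "fst (e k) < k" using step by auto
  have k: "(k, 1) \<in> pts" using step by (auto intro: pt_one)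
  have "nmon e {1..<Suc k} = nmon e {1..<k} * x (e k) (k, 1)"
    using step.hyps by (simp add: nmon_def atLeastLessThanSuc mult.commute)
  also have "\<dots> \<in> ispan (rooted_paths (Suc k))"
  proof (rule ispan_mult)
    show "nmon e {1..<k} \<in> ispan (rooted_paths k)" using step by auto
    show "x (e k) (k, 1) \<in> SK" using ek k by (intro x_sym) auto
    fix g assume "g \<in> rooted_paths k"
    then obtain ps where ps: "g = path ps" "distinct_ax ps" "fst ` set ps = {..<k}" "ps \<noteq> []" "hd ps = (0, 1)"
      by (auto simp: rooted_paths_def)
    have "fst (e k) \<in> fst ` set ps" using ps(3) ek by simp
    then obtain a where a: "a \<in> set ps" "fst a = fst (e k)" by force
    then obtain us vs where uv: "ps = us @ a # vs" by (meson split_list)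
    have "a \<in> pts" using a ps(2) by (auto simp: distinct_ax_def)
    \<comment> \<open>The parent \<open>e k\<close> and the path vertex \<open>a\<close> share an
      axis but may carry different scalars. Dividing the new edge by their quotient makes it start
      at \<open>a\<close> itself.\<close>
    define \<gamma> where "\<gamma> = snd (e k) / snd a"
    have nz: "snd (e k) \<noteq> 0" "snd a \<noteq> 0" "\<gamma> \<noteq> 0"
      using ek \<open>a \<in> pts\<close> pts_nonzero by (auto simp: \<gamma>_def)
    have "\<gamma> ^ m = 1" using ek \<open>a \<in> pts\<close> by (simp add: \<gamma>_def power_divide pts_iff)
    define b where "b = (k, inverse \<gamma>)"
    have b: "b \<in> pts" "fst b \<notin> fst ` set ps"
      using k \<open>\<gamma> ^ m = 1\<close> ps(3) by (auto simp: b_def pts_iff power_inverse)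
    have "pscale \<gamma> a = e k" "pscale \<gamma> b = (k, 1)"
      using a nz by (auto simp: pscale_def b_def \<gamma>_def prod_eq_iff)
    then have xe: "x (e k) (k, 1) = poly_const \<gamma> * x a b"
      using x_scale[OF \<open>a \<in> pts\<close> b(1), of \<gamma>] nz a ek by (auto simp: b_def)
    have "g * x a b - (\<Sum>i\<le>length vs. path (us @ a # take i vs @ b # drop i vs)) \<in> I"
      unfolding ps(1) uv using ps(2) b unfolding uv by (rule path_insert_after)
    moreover have "path (us @ a # take i vs @ b # drop i vs) \<in> rooted_paths (Suc k)" for i
    proof -
      have ms: "mset (us @ a # take i vs @ b # drop i vs) = mset (b # ps)"
        by (simp add: uv) (metis append_take_drop_id mset_append)
      have "distinct_ax (b # ps)" using b ps(2) by (simp add: distinct_ax_Cons)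
      then have "distinct_ax (us @ a # take i vs @ b # drop i vs)"
        using distinct_ax_mset[OF ms] by simp
      moreover have "fst ` set (us @ a # take i vs @ b # drop i vs) = {..<Suc k}"
        using mset_eq_setD[OF ms] ps(3) by (simp add: lessThan_Suc b_def)
      moreover have "hd (us @ a # take i vs @ b # drop i vs) = (0, 1)"
        using ps(5) uv by (cases us) auto
      ultimately show ?thesis unfolding rooted_paths_def by blast
    qed
    ultimately have "g * x a b \<in> ispan (rooted_paths (Suc k))"
      using ispan_cong ispan_sum[of "{..length vs}" "\<lambda>i. path (us @ a # take i vs @ b # drop i vs)"] ispan_base
      by blast
    then have "poly_const \<gamma> * (g * x a b) \<in> ispan (rooted_paths (Suc k))" by (rule ispan_scale)
    then show "g * x (e k) (k, 1) \<in> ispan (rooted_paths (Suc k))" by (simp add: xe mult_ac)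
  qed
  finally show ?case .
qed

lemma top_degree_ispan:
  assumes "p \<in> SK" "homogeneous (n - 1) p"
  shows "p \<in> ispan (rooted_paths n)"
proof (rule ispan_trans[OF homogeneous_ispan_nmons[OF assms]], rule subsetI)
  fix g assume "g \<in> nmons (n - 1)"
  then obtain e J where g: "g = nmon e J" and J: "J \<subseteq> {..<n}" "card J = n - 1"
    and e: "\<forall>j\<in>J. e j \<in> pts \<and> fst (e j) < j"
    by (auto simp: nmons_def)
  have "J = {1..<n}" using nmons_index[OF J(1) e] J(2) by (intro card_subset_eq) auto
  then show "g \<in> ispan (rooted_paths n)"
    using e n_ge_3 unfolding g by (simp only:) (intro nmon_ispan_rooted_paths, auto)
qed

end

section \<open>Monomial matrices and their action on the symmetric algebra\<close>

lemma hyp_action_single: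
  "hyp_action m n g (sgl v c) = sgl (img_vec m n g v) (c * img_scalar m n g v)"
  by (cases "c = 0") (auto simp: hyp_action_def)

lemma clinear_hyp_action: "clinear_op (hyp_action m n g)"
proof -
  have add: "hyp_action m n g (u + v) = hyp_action m n g u + hyp_action m n g v" for u v
    unfolding hyp_action_def by (rule sum_keys_add) (auto simp: ring_distribs single_add)
  have "hyp_action m n g (cscale c u) = cscale c (hyp_action m n g u)" for c u
    by (induction u rule: poly_mapping_induct_single)
      (auto simp: add cscale_add hyp_action_single mult.assoc, simp add: hyp_action_def)
  with add show ?thesis by (simp add: clinear_op_def)
qed

lemma card_keys_hyp_action_le: "card (kys (hyp_action m n g u)) \<le> card (kys u)"
proof -
  have "kys (hyp_action m n g u) \<subseteq> img_vec m n g ` kys u"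
    unfolding hyp_action_def by (rule order.trans[OF keys_sum]) auto
  then have "card (kys (hyp_action m n g u)) \<le> card (img_vec m n g ` kys u)"
    by (intro card_mono) auto
  also have "\<dots> \<le> card (kys u)" by (rule card_image_le) simp
  finally show ?thesis .
qed

context monomial_arrangement
begin

abbreviation "W \<equiv> monomial_group m n"

text \<open>The matrix sending e_j to \<open>c j\<close> times the basis vector with index
  \<open>\<pi> j\<close>; \<open>gp\<close> and \<open>gc\<close> below recover the two data from a
  matrix.\<close>

definition mmat :: "(nat \<Rightarrow> nat) \<Rightarrow> (nat \<Rightarrow> complex) \<Rightarrow> complex mat" where
  "mmat \<pi> c = mat n n (\<lambda>(i, j). if i = \<pi> j then c j else 0)"

lemma mmat_carrier:
  assumes \<pi>: "\<pi> permutes {..<n}" and c: "\<And>j. j < n \<Longrightarrow> c j ^ m = 1"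
  shows "mmat \<pi> c \<in> carrier W"
proof -
  have nz: "c j \<noteq> 0" if "j < n" for j using c[OF that] root_nonzero by blast
  have \<pi>n: "\<pi> j < n" if "j < n" for j using permutes_in_image[OF \<pi>, of j] that by simp
  have "\<exists>!j. j < n \<and> mmat \<pi> c $$ (i, j) \<noteq> 0" if "i < n" for i
  proof (rule ex1I)
    have "inv_into UNIV \<pi> i < n" using permutes_in_image[OF permutes_inv[OF \<pi>], of i] that by simp
    then show "inv_into UNIV \<pi> i < n \<and> mmat \<pi> c $$ (i, inv_into UNIV \<pi> i) \<noteq> 0"
      using that nz by (simp add: mmat_def permutes_inverses(1)[OF \<pi>])
    show "j = inv_into UNIV \<pi> i" if "j < n \<and> mmat \<pi> c $$ (i, j) \<noteq> 0" for j
      using that \<open>i < n\<close> by (auto simp: mmat_def permutes_inverses(2)[OF \<pi>] split: if_splits)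
  qed
  moreover have "\<exists>!i. i < n \<and> mmat \<pi> c $$ (i, j) \<noteq> 0" if "j < n" for j
    using that nz \<pi>n by (intro ex1I[of _ "\<pi> j"]) (auto simp: mmat_def split: if_splits)
  ultimately show ?thesis using c by (auto simp: monomial_group_def mmat_def)
qed

text \<open>Fixing all indices from \<open>n\<close> on makes this a permutation in the sense of
  \<open>permutes\<close>.\<close>

definition gp :: "complex mat \<Rightarrow> nat \<Rightarrow> nat" where
  "gp g j = (if j < n then THE i. i < n \<and> g $$ (i, j) \<noteq> 0 else j)"

definition gc :: "complex mat \<Rightarrow> nat \<Rightarrow> complex" where
  "gc g j = g $$ (gp g j, j)"

lemma gp_gc_mmat:
  assumes \<pi>: "\<pi> permutes {..<n}" and c: "\<And>j. j < n \<Longrightarrow> c j ^ m = 1" and "j < n"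
  shows "gp (mmat \<pi> c) j = \<pi> j" "gc (mmat \<pi> c) j = c j"
proof -
  have "c j \<noteq> 0" using c[OF assms(3)] root_nonzero by blast
  moreover have "\<pi> j < n" using permutes_in_image[OF \<pi>, of j] assms(3) by simp
  ultimately show *: "gp (mmat \<pi> c) j = \<pi> j"
    using assms(3) by (auto simp: gp_def mmat_def intro!: the_equality split: if_splits)
  show "gc (mmat \<pi> c) j = c j"
    unfolding gc_def * using assms(3) \<open>\<pi> j < n\<close> by (simp add: mmat_def)
qed

lemma monomial_group_decompose:
  assumes "g \<in> carrier W"
  shows "gp g permutes {..<n}" and "\<And>j. j < n \<Longrightarrow> gc g j ^ m = 1" and "g = mmat (gp g) (gc g)"
proof -
  have g: "g \<in> carrier_mat n n"
    and row: "\<And>i. i < n \<Longrightarrow> \<exists>!j. j < n \<and> g $$ (i, j) \<noteq> 0"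
    and col: "\<And>j. j < n \<Longrightarrow> \<exists>!i. i < n \<and> g $$ (i, j) \<noteq> 0"
    and root: "\<And>i j. i < n \<Longrightarrow> j < n \<Longrightarrow> g $$ (i, j) \<noteq> 0 \<Longrightarrow> g $$ (i, j) ^ m = 1"
    using assms by (auto simp: monomial_group_def)
  have gp: "gp g j < n \<and> g $$ (gp g j, j) \<noteq> 0" if "j < n" for j
    using theI'[OF col[OF that]] that by (simp add: gp_def)
  have gp_eq: "i = gp g j" if "i < n" "j < n" "g $$ (i, j) \<noteq> 0" for i j
    using gp[OF that(2)] col[OF that(2)] that by blast
  have "inj_on (gp g) {..<n}"
  proof (rule inj_onI)
    fix j k assume *: "j \<in> {..<n}" "k \<in> {..<n}" "gp g j = gp g k"
    then show "j = k" using row[of "gp g j"] gp[of j] gp[of k] by auto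
  qed
  moreover have "gp g ` {..<n} \<subseteq> {..<n}" using gp by auto
  ultimately have "bij_betw (gp g) {..<n} {..<n}"
    by (simp add: bij_betw_def endo_inj_surj)
  then show "gp g permutes {..<n}" by (rule bij_imp_permutes) (simp add: gp_def)
  show "gc g j ^ m = 1" if "j < n" for j
    using root gp[OF that] that by (simp add: gc_def)
  show "g = mmat (gp g) (gc g)"
    using g gp_eq by (intro eq_matI) (auto simp: mmat_def gc_def)
qed

lemma gp_less: "g \<in> carrier W \<Longrightarrow> j < n \<Longrightarrow> gp g j < n"
  using permutes_in_image[OF monomial_group_decompose(1), of g j] by simp

lemma mmat_mult:
  assumes "\<tau> permutes {..<n}"
  shows "mmat \<pi> c * mmat \<tau> d = mmat (\<pi> \<circ> \<tau>) (\<lambda>j. c (\<tau> j) * d j)"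
proof (rule eq_matI)
  fix i j assume "i < dim_row (mmat (\<pi> \<circ> \<tau>) (\<lambda>j. c (\<tau> j) * d j))"
    "j < dim_col (mmat (\<pi> \<circ> \<tau>) (\<lambda>j. c (\<tau> j) * d j))"
  then have ij: "i < n" "j < n" by (auto simp: mmat_def)
  have \<tau>j: "\<tau> j < n" using permutes_in_image[OF assms, of j] ij by simp
  have "(mmat \<pi> c * mmat \<tau> d) $$ (i, j) = (\<Sum>k = 0..<n. mmat \<pi> c $$ (i, k) * mmat \<tau> d $$ (k, j))"
    using ij by (simp add: mmat_def scalar_prod_def)
  also have "\<dots> = (\<Sum>k = 0..<n. if k = \<tau> j then mmat \<pi> c $$ (i, k) * d j else 0)"
    using ij by (intro sum.cong) (auto simp: mmat_def)
  also have "\<dots> = mmat \<pi> c $$ (i, \<tau> j) * d j" using \<tau>j by (simp add: sum.delta)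
  finally show "(mmat \<pi> c * mmat \<tau> d) $$ (i, j) = mmat (\<pi> \<circ> \<tau>) (\<lambda>j. c (\<tau> j) * d j) $$ (i, j)"
    using ij \<tau>j by (simp add: mmat_def)
qed (auto simp: mmat_def)

lemma mmat_cong: "(\<And>j. j < n \<Longrightarrow> \<pi> j = \<pi>' j \<and> c j = c' j) \<Longrightarrow> mmat \<pi> c = mmat \<pi>' c'"
  by (auto simp: mmat_def intro!: cong_mat)

lemma one_eq_mmat: "1\<^sub>m n = mmat id (\<lambda>_. 1)"
  by (auto simp: mmat_def one_mat_def)

lemma monomial_group_simps [simp]:
  "mult W = (*)" "one W = 1\<^sub>m n"
  by (simp_all add: monomial_group_def)

lemma monomial_group_mult:
  assumes "g \<in> carrier W" "h \<in> carrier W"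
  shows "g * h \<in> carrier W"
    and "\<And>j. j < n \<Longrightarrow> gp (g * h) j = gp g (gp h j)"
    and "\<And>j. j < n \<Longrightarrow> gc (g * h) j = gc g (gp h j) * gc h j"
proof -
  note dg = monomial_group_decompose[OF assms(1)] and dh = monomial_group_decompose[OF assms(2)]
  have gh: "g * h = mmat (gp g \<circ> gp h) (\<lambda>j. gc g (gp h j) * gc h j)"
    by (subst dg(3), subst dh(3)) (rule mmat_mult[OF dh(1)])
  have perm: "(gp g \<circ> gp h) permutes {..<n}" by (rule permutes_compose[OF dh(1) dg(1)])
  have root: "(gc g (gp h j) * gc h j) ^ m = 1" if "j < n" for j
    using dg(2)[OF gp_less[OF assms(2) that]] dh(2)[OF that] by (simp add: power_mult_distrib)
  show "g * h \<in> carrier W" unfolding gh by (rule mmat_carrier[OF perm root])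
  show "gp (g * h) j = gp g (gp h j)" "gc (g * h) j = gc g (gp h j) * gc h j" if "j < n" for j
    unfolding gh using gp_gc_mmat[OF perm root that, simplified] by (simp_all add: that)
qed

lemma one_monomial_group: "1\<^sub>m n \<in> carrier W" "\<And>j. j < n \<Longrightarrow> gp (1\<^sub>m n) j = j"
    "\<And>j. j < n \<Longrightarrow> gc (1\<^sub>m n) j = 1"
  unfolding one_eq_mmat using gp_gc_mmat[OF permutes_id, of "\<lambda>_. 1"]
  by (auto intro!: mmat_carrier permutes_id)

lemma group_monomial_group: "Group.group W"
proof (rule groupI)
  fix g assume g: "g \<in> carrier W"
  note d = monomial_group_decompose[OF g]
  define h where "h = mmat (inv_into UNIV (gp g)) (\<lambda>j. inverse (gc g (inv_into UNIV (gp g) j)))"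
  have perm: "inv_into UNIV (gp g) permutes {..<n}" by (rule permutes_inv[OF d(1)])
  have lt: "inv_into UNIV (gp g) j < n" if "j < n" for j using permutes_in_image[OF perm, of j] that by simp
  have "h \<in> carrier W"
    unfolding h_def by (rule mmat_carrier[OF perm]) (simp add: power_inverse d(2) lt)
  moreover have "h * g = 1\<^sub>m n"
    unfolding h_def one_eq_mmat by (subst (3) d(3), subst mmat_mult[OF d(1)], rule mmat_cong)
      (use d(2) root_nonzero in \<open>auto simp: permutes_inverses(2)[OF d(1)]\<close>)
  ultimately show "\<exists>h\<in>carrier W. h \<otimes>\<^bsub>W\<^esub> g = \<one>\<^bsub>W\<^esub>" by auto
next
  fix g h k assume "g \<in> carrier W" "h \<in> carrier W" "k \<in> carrier W"
  then have "g \<in> carrier_mat n n" "h \<in> carrier_mat n n" "k \<in> carrier_mat n n"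
    by (auto simp: monomial_group_def)
  then show "g \<otimes>\<^bsub>W\<^esub> h \<otimes>\<^bsub>W\<^esub> k = g \<otimes>\<^bsub>W\<^esub> (h \<otimes>\<^bsub>W\<^esub> k)" by (simp add: assoc_mult_mat[of _ n n _ n _ n])
next
  fix g assume "g \<in> carrier W"
  then show "\<one>\<^bsub>W\<^esub> \<otimes>\<^bsub>W\<^esub> g = g" by (auto simp: monomial_group_def)
qed (auto simp: monomial_group_mult one_monomial_group)

sublocale W: Group.group W by (rule group_monomial_group)

abbreviation "winv g \<equiv> inv\<^bsub>W\<^esub> g"
abbreviation "hact \<equiv> hyp_action m n"

section \<open>Action on the arrangement\<close>

definition gact :: "complex mat \<Rightarrow> nat \<times> complex \<Rightarrow> nat \<times> complex" where
  "gact g p = (gp g (fst p), gc g (fst p) * snd p)"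

lemma gact_pts: "g \<in> carrier W \<Longrightarrow> p \<in> pts \<Longrightarrow> gact g p \<in> pts"
  by (auto simp: gact_def pts_iff gp_less monomial_group_decompose(2) power_mult_distrib)

lemma fst_gact_eq_iff:
  "g \<in> carrier W \<Longrightarrow> fst (gact g p) = fst (gact g q) \<longleftrightarrow> fst p = fst q"
  using permutes_inj[OF monomial_group_decompose(1)] by (auto simp: gact_def inj_eq)

lemma gact_mult:
  "g \<in> carrier W \<Longrightarrow> h \<in> carrier W \<Longrightarrow> p \<in> pts \<Longrightarrow> gact (g * h) p = gact g (gact h p)"
  by (auto simp: gact_def pts_iff monomial_group_mult)

lemma gact_one: "p \<in> pts \<Longrightarrow> gact (1\<^sub>m n) p = p"
  by (auto simp: gact_def pts_iff one_monomial_group prod_eq_iff)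

lemma mult_unit_vec:
  assumes "g \<in> carrier W" "j < n"
  shows "g *\<^sub>v unit_vec n j = gc g j \<cdot>\<^sub>v unit_vec n (gp g j)"
proof (rule eq_vecI)
  have g: "g \<in> carrier_mat n n" using assms by (auto simp: monomial_group_def)
  fix i assume "i < dim_vec (gc g j \<cdot>\<^sub>v unit_vec n (gp g j))"
  then have i: "i < n" by simp
  have "(g *\<^sub>v unit_vec n j) $ i = g $$ (i, j)" using g i assms(2) by simp
  also have "\<dots> = mmat (gp g) (gc g) $$ (i, j)" using monomial_group_decompose(3)[OF assms(1)] by simp
  finally show "(g *\<^sub>v unit_vec n j) $ i = (gc g j \<cdot>\<^sub>v unit_vec n (gp g j)) $ i"
    using i assms(2) gp_less[OF assms] by (simp add: mmat_def)
qed (use assms in \<open>auto simp: monomial_group_def\<close>)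

lemma img_vec_scalar:
  assumes "v' \<in> arr_vecs m n" "c \<noteq> 0" and eq: "g *\<^sub>v v = c \<cdot>\<^sub>v v'"
  shows "img_vec m n g v = v'" "img_scalar m n g v = c"
proof -
  show *: "img_vec m n g v = v'"
    unfolding img_vec_def
    by (rule the_equality) (use assms arr_vecs_unique[OF assms(1) _ assms(2)] in \<open>auto simp: eq\<close>)
  show "img_scalar m n g v = c"
    unfolding img_scalar_def *
    by (rule the_equality) (use assms arr_vecs_unique[OF assms(1) assms(1,2)] in \<open>auto simp: eq\<close>)
qed

context
  fixes g assumes g: "g \<in> carrier W"
begin

lemma hyp_action_unit:
  assumes "p \<in> pts"
  shows "hact g (sgl (unit_vec n (fst p)) (snd p))
    = sgl (unit_vec n (fst (gact g p))) (snd (gact g p))"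
proof -
  have i: "fst p < n" using assms by (simp add: pts_iff)
  have "unit_vec n (gp g (fst p)) \<in> arr_vecs m n" using gp_less[OF g i] by (auto simp: arr_vecs_eq)
  moreover have "gc g (fst p) \<noteq> 0" using monomial_group_decompose(2)[OF g i] root_nonzero by blast
  ultimately show ?thesis
    using img_vec_scalar[OF _ _ mult_unit_vec[OF g i]] by (simp add: hyp_action_single gact_def mult.commute)
qed

text \<open>Computed from g (p - q) = g p - g q in the coordinate space: both differences are
  multiples of normalised vectors, and uniqueness of such multiples determines
  \<open>img_vec\<close> and \<open>img_scalar\<close>.\<close>

lemma hyp_action_edge:
  assumes p: "p \<in> pts" and q: "q \<in> pts" and pq: "fst p \<noteq> fst q"
  shows "hact g (sgl (evec p q) (ecoef p q))
    = sgl (evec (gact g p) (gact g q)) (ecoef (gact g p) (gact g q))"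
proof -
  let ?p = "gact g p" and ?q = "gact g q"
  have gm: "g \<in> carrier_mat n n" using g by (auto simp: monomial_group_def)
  have i: "fst p < n" "fst q < n" using p q by (auto simp: pts_iff)
  have P: "?p \<in> pts" "?q \<in> pts" "fst ?p \<noteq> fst ?q"
    using p q pq by (auto simp: gact_pts[OF g] fst_gact_eq_iff[OF g])
  have dim: "evec p q \<in> carrier_vec n" "evec ?p ?q \<in> carrier_vec n" by (auto simp: evec_def)
  have nz: "ecoef p q \<noteq> 0" "ecoef ?p ?q \<noteq> 0" by (rule ecoef_nonzero[OF p q pq], rule ecoef_nonzero[OF P])
  have "ecoef p q \<cdot>\<^sub>v (g *\<^sub>v evec p q) = g *\<^sub>v (ecoef p q \<cdot>\<^sub>v evec p q)"
    using gm dim by (simp add: mult_mat_vec)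
  also have "\<dots> = g *\<^sub>v (snd p \<cdot>\<^sub>v unit_vec n (fst p)) - g *\<^sub>v (snd q \<cdot>\<^sub>v unit_vec n (fst q))"
    using gm by (simp add: ecoef_evec[OF p q pq] mult_minus_distrib_mat_vec)
  also have "\<dots> = snd ?p \<cdot>\<^sub>v unit_vec n (fst ?p) - snd ?q \<cdot>\<^sub>v unit_vec n (fst ?q)"
    using gm i by (simp add: mult_mat_vec mult_unit_vec[OF g] gact_def smult_smult_assoc mult.commute)
  also have "\<dots> = ecoef ?p ?q \<cdot>\<^sub>v evec ?p ?q" by (rule ecoef_evec[OF P, symmetric])
  finally have eq: "ecoef p q \<cdot>\<^sub>v (g *\<^sub>v evec p q) = ecoef ?p ?q \<cdot>\<^sub>v evec ?p ?q" .
  have "g *\<^sub>v evec p q = inverse (ecoef p q) \<cdot>\<^sub>v (ecoef p q \<cdot>\<^sub>v (g *\<^sub>v evec p q))"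
    using nz by (simp add: smult_smult_assoc)
  then have "g *\<^sub>v evec p q = (inverse (ecoef p q) * ecoef ?p ?q) \<cdot>\<^sub>v evec ?p ?q"
    by (simp add: eq smult_smult_assoc)
  from img_vec_scalar[OF evec_arr_vecs[OF P] _ this] nz show ?thesis
    by (simp add: hyp_action_single mult.assoc[symmetric])
qed

text \<open>On the spanning lifts the action is the action on the endpoints. Stability of the kernel
  and the laws of a group action then follow by \<open>kernel_induct\<close>.\<close>

lemma hyp_action_X:
  assumes p: "p \<in> pts" and q: "q \<in> pts" and pq: "fst p \<noteq> fst q"
  shows "hact g (X p q) = X (gact g p) (gact g q)"
proof -
  let ?L = "hact g"
  have add: "?L (u + v) = ?L u + ?L v" for u v
    using clinear_hyp_action by (simp add: clinear_op_def)
  then have "?L (u - v) = ?L u - ?L v" for u v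
    by (metis add_diff_cancel diff_add_cancel)
  then show ?thesis
    by (simp add: X_def add hyp_action_edge[OF assms] hyp_action_unit p q)
qed

lemma hyp_action_step:
  assumes "p \<in> pts" "q \<in> pts" "fst p \<noteq> fst q"
  shows "hact g (cscale c (X p q) + u) = cscale c (X (gact g p) (gact g q)) + hact g u"
  using clinear_hyp_action[of m n g] by (simp add: clinear_op_def hyp_action_X[OF assms])

lemma hyp_action_kernel: "u \<in> K \<Longrightarrow> hact g u \<in> K"
  by (induction u rule: kernel_induct)
    (auto simp: hyp_action_step hyp_action_def[of m n g 0] gact_pts[OF g] fst_gact_eq_iff[OF g]
      intro!: arr_kernel_0 arr_kernel_add arr_kernel_cscale X_kernel)

end

lemma hyp_action_mult:
  assumes "g \<in> carrier W" "h \<in> carrier W" "u \<in> K"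
  shows "hact g (hact h u) = hact (g * h) u"
  using assms(3) by (induction u rule: kernel_induct)
    (auto simp: hyp_action_step hyp_action_def[of _ _ _ 0] gact_pts fst_gact_eq_iff gact_mult
      monomial_group_mult(1) assms(1,2))

lemma hyp_action_one: "u \<in> K \<Longrightarrow> hact (1\<^sub>m n) u = u"
  by (induction u rule: kernel_induct)
    (auto simp: hyp_action_step hyp_action_def[of _ _ _ 0] gact_one one_monomial_group(1))

lemma hyp_action_inv:
  assumes "g \<in> carrier W" "u \<in> K"
  shows "hact (winv g) (hact g u) = u"
  using hyp_action_mult[OF W.inv_closed[OF assms(1)] assms] W.l_inv[OF assms(1)] hyp_action_one[OF assms(2)]
  by simp

text \<open>Neither \<open>g\<close> nor its inverse can enlarge a support, so the size of the
  support is preserved.\<close>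

lemma arr_rho_hyp_action:
  assumes "g \<in> carrier W" "u \<in> K" "u \<noteq> 0"
  shows "hact g u \<noteq> 0 \<and> arr_rho \<A> (hact g u) = arr_rho \<A> u"
proof -
  have "card (kys u) \<le> card (kys (hact g u))"
    using card_keys_hyp_action_le[of m n "winv g" "hact g u"] hyp_action_inv[OF assms(1,2)] by simp
  then have "card (kys (hact g u)) = card (kys u)"
    using card_keys_hyp_action_le[of m n g u] by simp
  moreover have "card (kys u) \<noteq> 0" using assms(3) by simp
  ultimately show ?thesis
    using assms by (auto simp: arr_rho_eq hyp_action_kernel)
qed

abbreviation act :: "complex mat \<Rightarrow> complex vec cpoly \<Rightarrow> complex vec cpoly" where
  "act g \<equiv> sym_map (hact g)"

context
  fixes g assumes g: "g \<in> carrier W"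
begin

lemma act_sym: "p \<in> SK \<Longrightarrow> act g p \<in> SK"
  by (rule sym_map_closed[OF clinear_hyp_action hyp_action_kernel[OF g]])

lemma act_ideal: "p \<in> I \<Longrightarrow> act g p \<in> I"
  by (rule sym_map_internal_ideal[OF clinear_hyp_action hyp_action_kernel[OF g] arr_rho_hyp_action[OF g]])

lemma homogeneous_act: "p \<in> SK \<Longrightarrow> homogeneous d p \<Longrightarrow> homogeneous d (act g p)"
  by (rule homogeneous_sym_map[OF clinear_hyp_action])

lemma act_x: "p \<in> pts \<Longrightarrow> q \<in> pts \<Longrightarrow> fst p \<noteq> fst q \<Longrightarrow> act g (x p q) = x (gact g p) (gact g q)"
  by (simp add: x_def sym_map_lin_form[OF clinear_hyp_action] hyp_action_X[OF g])

lemma act_path: "distinct_ax ps \<Longrightarrow> act g (path ps) = path (map (gact g) ps)"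
proof (induction ps rule: path.induct)
  case (1 p q ps)
  then show ?case by (auto simp: sym_map_ring_hom act_x distinct_ax_Cons)
qed (use sym_map_ring_hom(3)[of _ 1] in auto)

lemma distinct_ax_gact: "distinct_ax ps \<Longrightarrow> distinct_ax (map (gact g) ps)"
proof (induction ps)
  case (Cons p ps)
  moreover have "fst (gact g p) \<noteq> fst (gact g q)" if "q \<in> set ps" for q
    using Cons.prems that fst_gact_eq_iff[OF g, of p q] by (force simp: distinct_ax_Cons)
  ultimately show ?case by (auto simp: distinct_ax_Cons gact_pts[OF g] simp del: fst_gact_eq_iff) (metis fst_conv)
qed simp

end

lemma act_mult: "g \<in> carrier W \<Longrightarrow> h \<in> carrier W \<Longrightarrow> p \<in> SK \<Longrightarrow> act g (act h p) = act (g * h) p"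
  by (rule sym_map_compose[OF clinear_hyp_action clinear_hyp_action clinear_hyp_action hyp_action_mult])

lemma act_one: "p \<in> SK \<Longrightarrow> act (1\<^sub>m n) p = p"
  by (rule sym_map_identity[OF clinear_hyp_action hyp_action_one])

lemma act_inv:
  assumes "g \<in> carrier W" "p \<in> SK"
  shows "act (winv g) (act g p) = p" "act g (act (winv g) p) = p"
  using assms W.l_inv[OF assms(1)] W.r_inv[OF assms(1)]
  by (simp_all add: act_mult act_one W.inv_closed)

abbreviation "cls \<equiv> icoset K \<A>"

text \<open>\<open>dual_action\<close> is an image of sets; it yields a full coset because
  \<open>g\<close>, having an inverse, maps the ideal onto itself.\<close>

lemma dual_action_icoset:
  assumes g: "g \<in> carrier W"
  shows "dual_action m n g (cls p) = cls (act g p)"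
proof -
  have "act g ` I = I"
  proof (intro subset_antisym subsetI)
    fix i assume "i \<in> I"
    then show "i \<in> act g ` I"
      using act_inv(2)[OF g iideal_subset] act_ideal[OF W.inv_closed[OF g]]
      by (intro image_eqI[of _ _ "act (winv g) i"]) auto
  qed (use act_ideal[OF g] in auto)
  then have "(\<lambda>i. i + act g p) ` (act g ` I) = cls (act g p)" by (simp add: icoset_eq)
  then show ?thesis by (simp add: dual_action_def icoset_eq image_image sym_map_ring_hom)
qed

abbreviation "V \<equiv> internal_top K \<A>"

lemma linear_map_dual_action:
  assumes g: "g \<in> carrier W"
  shows "linear_map class_ring V V (dual_action m n g)"
proof -
  interpret V: vectorspace "class_ring :: complex ring" V by (rule vectorspace_internal_top)
  have "dual_action m n g \<in> LinearCombinations.module_hom class_ring V V"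
    by (auto simp: LinearCombinations.module_hom_def carrier_internal_top add_internal_top smult_internal_top
        dual_action_icoset[OF g] act_sym[OF g] homogeneous_act[OF g] sym_map_ring_hom)
  then show ?thesis by unfold_locales
qed

lemma group_rep_internal_top: "group_rep W V (dual_action m n)"
proof (intro group_rep.intro group_rep_axioms.intro group_monomial_group vectorspace_internal_top)
    fix g assume g: "g \<in> carrier W"
    show "linear_map class_ring V V (dual_action m n g)" by (rule linear_map_dual_action[OF g])
  next
    fix v assume "v \<in> carrier V"
    then show "dual_action m n \<one>\<^bsub>W\<^esub> v = v"
      by (auto simp: carrier_internal_top dual_action_icoset one_monomial_group act_one)
  next
    fix g h v assume "g \<in> carrier W" "h \<in> carrier W" "v \<in> carrier V"
    then show "dual_action m n (g \<otimes>\<^bsub>W\<^esub> h) v = dual_action m n g (dual_action m n h v)"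
      by (auto simp: carrier_internal_top dual_action_icoset monomial_group_mult act_mult)
qed

end

section \<open>Detecting the base path\<close>

text \<open>In the application \<open>xs i\<close> is sigma^i applied to 0. The functional and the
  insertion sums work for any ordering of the axes that starts with 0.\<close>

locale enumerated_arrangement = monomial_arrangement +
  fixes xs :: "nat \<Rightarrow> nat"
  assumes bij_xs: "bij_betw xs {..<n} {..<n}" and xs_0: "xs 0 = 0"
begin

definition pos :: "nat \<Rightarrow> nat" where
  "pos = inv_into {..<n} xs"

lemma xs_less: "i < n \<Longrightarrow> xs i < n"
  using bij_xs by (auto simp: bij_betw_def)

lemma pos_xs [simp]: "i < n \<Longrightarrow> pos (xs i) = i"
  using bij_xs by (simp add: pos_def bij_betw_inv_into_left)

lemma xs_pos: "j < n \<Longrightarrow> xs (pos j) = j" "j < n \<Longrightarrow> pos j < n"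
  using bij_betw_inv_into_right[OF bij_xs, of j] bij_betw_apply[OF bij_betw_inv_into[OF bij_xs], of j]
  by (auto simp: pos_def)

lemma pos_eq_iff: "i < n \<Longrightarrow> j < n \<Longrightarrow> pos i = pos j \<longleftrightarrow> i = j"
  by (metis xs_pos(1))

lemma pos_0: "pos 0 = 0"
  using pos_xs[of 0] xs_0 n_ge_3 by simp

section \<open>A functional on the top degree\<close>

text \<open>
  An edge vector \<open>\<plusminus>(e\<^sub>i - e\<^sub>j)\<close>, with \<open>i\<close> before \<open>j\<close> in the enumeration, is sent to \<open>\<plusminus>y\<close> for a
  variable \<open>y\<close> attached to \<open>j\<close>; all other vectors are sent to zero.
\<close>

definition vsum :: "complex vec \<Rightarrow> complex" where
  "vsum v = (\<Sum>a<n. v $ a)"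

definition later :: "complex vec \<Rightarrow> nat" where
  "later v = Max (pos ` {a. a < n \<and> v $ a \<noteq> 0})"

definition \<psi> :: "complex vec \<Rightarrow> (nat \<Rightarrow>\<^sub>0 complex)" where
  "\<psi> v = (if v \<in> arr_vecs m n \<and> vsum v = 0 then sgl (later v) (- (v $ xs (later v))) else 0)"

definition \<Psi> :: "(complex vec \<Rightarrow>\<^sub>0 complex) \<Rightarrow> (nat \<Rightarrow>\<^sub>0 complex)" where
  "\<Psi> u = (\<Sum>v\<in>kys u. cscale (lkp u v) (\<psi> v))"

definition \<theta> :: "complex vec cpoly \<Rightarrow> nat cpoly" where
  "\<theta> = poly_subst (\<lambda>v. lin_form (\<psi> v))"

definition tmon :: "nat \<Rightarrow>\<^sub>0 nat" where
  "tmon = (\<Sum>k\<in>{1..<n}. sgl k 1)"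

definition F :: "complex vec cpoly \<Rightarrow> complex" where
  "F p = lkp (\<theta> p) tmon"

lemma \<theta>_lin_form: "\<theta> (lin_form u) = lin_form (\<Psi> u)"
  by (simp add: \<theta>_def poly_subst_lin_form \<Psi>_def lin_form_sum lin_form_cscale)

lemma \<theta>_hom: "\<theta> (p + q) = \<theta> p + \<theta> q" "\<theta> (p * q) = \<theta> p * \<theta> q" "\<theta> (p ^ k) = \<theta> p ^ k"
    "\<theta> 0 = 0" "\<theta> 1 = 1" "\<theta> (poly_const c) = poly_const c"
  by (simp_all add: \<theta>_def poly_subst_add poly_subst_mult poly_subst_power poly_subst_const)

lemma F_add: "F (p + q) = F p + F q"
  by (simp add: F_def \<theta>_hom lookup_add)

lemma F_scale: "F (poly_const c * p) = c * F p"
  by (simp add: F_def \<theta>_hom lookup_poly_const_mult)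

lemma F_sum: "F (\<Sum>a\<in>S. g a) = (\<Sum>a\<in>S. F (g a))"
  by (induction S rule: infinite_finite_induct) (auto simp: F_add, auto simp: F_def \<theta>_hom)

lemma lookup_tmon: "lkp tmon k = (if k \<in> {1..<n} then 1 else 0)"
  by (simp add: tmon_def lookup_sum lookup_single when_def sum.delta)

lemma sum_nonzero_eq_0_card:
  fixes g :: "'a \<Rightarrow> complex"
  assumes "finite S" "(\<Sum>a\<in>S. g a) = 0" "\<And>a. a \<in> S \<Longrightarrow> g a \<noteq> 0"
  shows "card S \<noteq> 1"
  using assms by (auto simp: card_1_singleton_iff)

text \<open>A unit vector has coordinate sum 1, and e_i - \<open>\<gamma>\<close> e_j has sum 1 -
  \<open>\<gamma>\<close>, so only edges with \<open>\<gamma>\<close> = 1 remain.\<close>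

lemma vsum_arr_vecs:
  assumes "v \<in> arr_vecs m n" "vsum v = 0"
  obtains i j where "i < j" "j < n" "v = edge_vec n i j 1"
proof -
  consider i where "i < n" "v = unit_vec n i"
    | i j \<gamma> where "i < j" "j < n" "v = edge_vec n i j \<gamma>"
    using assms(1) by (auto simp: arr_vecs_eq)
  then show ?thesis
  proof cases
    case (1 i)
    then have "vsum v = 1" by (simp add: vsum_def sum.delta)
    with assms(2) show ?thesis by simp
  next
    case (2 i j \<gamma>)
    then have "vsum v = (\<Sum>a<n. (if a = i then 1 else 0) - (if a = j then \<gamma> else 0))"
      unfolding vsum_def by (intro sum.cong) (auto simp: edge_vec_index)
    also have "\<dots> = 1 - \<gamma>" using 2 by (simp add: sum_subtractf sum.delta)
    finally show ?thesis using that[of i j] 2 assms(2) by simp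
  qed
qed

lemma later_props:
  assumes "v \<in> arr_vecs m n" "vsum v = 0"
  shows "later v < n" "v $ xs (later v) \<noteq> 0"
    and "\<And>a. a < n \<Longrightarrow> v $ a \<noteq> 0 \<Longrightarrow> pos a \<le> later v"
proof -
  obtain i j where ij: "i < j" "j < n" "v = edge_vec n i j 1" using assms by (rule vsum_arr_vecs)
  let ?S = "{a. a < n \<and> v $ a \<noteq> 0}"
  have "i \<in> ?S" using ij by (simp add: edge_vec_index)
  then have "later v \<in> pos ` ?S" unfolding later_def by (intro Max_in) auto
  then obtain a where a: "a < n" "v $ a \<noteq> 0" "later v = pos a" by auto
  then show "later v < n" "v $ xs (later v) \<noteq> 0" by (simp_all add: xs_pos)
  show "pos a \<le> later v" if "a < n" "v $ a \<noteq> 0" for a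
    unfolding later_def using that by (intro Max_ge) auto
qed

text \<open>
  If all edges in the support of \<open>u\<close> have the form \<open>\<plusminus>(e\<^sub>i - e\<^sub>j)\<close>, then the last vertex they
  meet lies on at least two of them but contributes nothing to \<open>\<Psi> u\<close>, because the corresponding
  coordinate of \<open>\<phi> u\<close> vanishes; otherwise at least two vectors in the support are lost.
\<close>

lemma card_keys_\<Psi>:
  assumes u: "u \<in> K" "u \<noteq> 0"
  shows "card (kys (\<Psi> u)) + 2 \<le> card (kys u)"
proof -
  have arr: "v \<in> arr_vecs m n" if "v \<in> kys u" for v using that u(1) by (auto simp: mem_arr_kernel)
  have coord: "(\<Sum>v\<in>kys u. lkp u v * v $ a) = 0" if "a < n" for a
    using that u(1) by (simp add: mem_arr_kernel vcoord_def)
  define E where "E = {v \<in> kys u. vsum v = 0}"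
  have E: "finite E" "E \<subseteq> kys u" by (auto simp: E_def)
  have \<Psi>: "\<Psi> u = (\<Sum>v\<in>E. sgl (later v) (lkp u v * - (v $ xs (later v))))"
    unfolding \<Psi>_def E_def by (rule sum.mono_neutral_cong_right) (auto simp: \<psi>_def arr)
  have keys: "kys (\<Psi> u) \<subseteq> later ` E"
    unfolding \<Psi> by (rule order.trans[OF keys_sum]) auto
  \<comment> \<open>Adding up all coordinates of the image of \<open>u\<close> in the coordinate
    space gives a vanishing sum weighted by \<open>vsum\<close>. It cannot consist of a single
    nonzero term, so the number of vectors with \<open>vsum\<close> nonzero is not 1.\<close>
  have "(\<Sum>v\<in>kys u. lkp u v * vsum v) = (\<Sum>a<n. \<Sum>v\<in>kys u. lkp u v * v $ a)"
    unfolding vsum_def by (simp add: sum_distrib_left sum.swap[of _ "kys u"])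
  also have "\<dots> = 0" by (simp add: coord)
  finally have "(\<Sum>v\<in>kys u. lkp u v * vsum v) = 0" .
  moreover have "(\<Sum>v\<in>kys u. lkp u v * vsum v) = (\<Sum>v\<in>kys u - E. lkp u v * vsum v)"
    by (rule sum.mono_neutral_right) (auto simp: E_def)
  ultimately have "card (kys u - E) \<noteq> 1"
    by (intro sum_nonzero_eq_0_card[where g = "\<lambda>v. lkp u v * vsum v"]) (auto simp: E_def in_keys_iff)
  then consider "card (kys u - E) \<ge> 2" | "kys u - E = {}"
  proof -
    have "card (kys u - E) \<ge> 2 \<or> card (kys u - E) = 0" using \<open>card (kys u - E) \<noteq> 1\<close> by linarith
    then show ?thesis using that by (auto simp: card_eq_0_iff)
  qed
  then show ?thesis
  proof cases
    case 1
    have "card (kys (\<Psi> u)) \<le> card (later ` E)" using keys E by (intro card_mono) auto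
    also have "\<dots> \<le> card E" using E by (intro card_image_le)
    finally show ?thesis using 1 card_Diff_subset[OF E] card_mono[OF _ E(2)] by simp
  next
    case 2
    then have Eu: "E = kys u" using E by auto
    have "E \<noteq> {}" using u(2) by (simp add: Eu)
    define k where "k = Max (later ` E)"
    define E1 where "E1 = {v \<in> E. later v = k}"
    have E1: "finite E1" "E1 \<subseteq> E" using E by (auto simp: E1_def)
    have k_ge: "later v \<le> k" if "v \<in> E" for v unfolding k_def using that E by (intro Max_ge) auto
    have "k \<in> later ` E" unfolding k_def using \<open>E \<noteq> {}\<close> E by (intro Max_in) auto
    then have "E1 \<noteq> {}" by (auto simp: E1_def)
    then have "k < n" using later_props(1)[OF arr] by (auto simp: E1_def E_def)
    have "(\<Sum>v\<in>E1. lkp u v * v $ xs k) = (\<Sum>v\<in>E. lkp u v * v $ xs k)"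
    proof (rule sum.mono_neutral_left[OF E(1) E1(2)], rule ballI)
      fix v assume v: "v \<in> E - E1"
      then have "later v < k" using k_ge[of v] by (auto simp: E1_def)
      then have "v $ xs k = 0"
        using later_props(3)[OF arr, of v "xs k"] v \<open>k < n\<close> xs_less by (auto simp: E_def)
      then show "lkp u v * v $ xs k = 0" by simp
    qed
    also have "\<dots> = 0" using coord[of "xs k"] xs_less[OF \<open>k < n\<close>] by (simp add: Eu)
    finally have sum0: "(\<Sum>v\<in>E1. lkp u v * v $ xs k) = 0" .
    have "card E1 \<noteq> 1"
      by (rule sum_nonzero_eq_0_card[OF E1(1) sum0])
        (use later_props(2)[OF arr] in \<open>auto simp: E1_def E_def in_keys_iff\<close>)
    moreover have "card E1 \<noteq> 0" using \<open>E1 \<noteq> {}\<close> E1 by simp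
    ultimately have card_E1: "card E1 \<ge> 2" by simp
    \<comment> \<open>Up to sign this coefficient is coordinate \<open>xs k\<close> of the image of
      \<open>u\<close>, which is zero. So the variable at \<open>k\<close> is absent from
      \<open>\<Psi> u\<close>, although at least two vectors of the support belong to it.\<close>
    have "lkp (\<Psi> u) k = (\<Sum>v\<in>E. if later v = k then lkp u v * - (v $ xs k) else 0)"
      unfolding \<Psi> by (auto simp: lookup_sum lookup_single when_def intro!: sum.cong)
    also have "\<dots> = (\<Sum>v\<in>E1. lkp u v * - (v $ xs k))"
      unfolding E1_def by (rule sum.inter_filter[OF E(1), symmetric])
    also have "\<dots> = 0" using sum0 by (simp add: sum_negf)
    finally have "k \<notin> kys (\<Psi> u)" by (simp add: in_keys_iff)
    then have "kys (\<Psi> u) \<subseteq> later ` (E - E1)" using keys by (auto simp: E1_def)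
    then have "card (kys (\<Psi> u)) \<le> card (later ` (E - E1))" using E by (intro card_mono) auto
    also have "\<dots> \<le> card (E - E1)" using E by (intro card_image_le) auto
    also have "\<dots> = card E - card E1" using E1 by (rule card_Diff_subset)
    finally show ?thesis using card_E1 card_mono[OF E(1) E1(2)] Eu by simp
  qed
qed

text \<open>By \<open>card_keys_\<Psi>\<close> the exponent of a generator exceeds the number of
  variables in the image of its linear form, so \<open>sum_var_power_nonsqfree\<close>
  applies.\<close>

lemma \<theta>_ideal:
  assumes "p \<in> I"
  shows "\<theta> p \<in> nonsqfree"
proof -
  let ?J = "{p \<in> SK. \<theta> p \<in> nonsqfree}"
  have "p \<in> ?J"
    using assms
  proof (rule iideal_least)
    fix u assume u: "u \<in> K" "u \<noteq> 0"
    let ?r = "arr_rho \<A> u"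
    have "lin_form (\<Psi> u) ^ (?r - 1) \<in> nonsqfree"
      unfolding lin_form_def using card_keys_\<Psi>[OF u] u
      by (intro sum_var_power_nonsqfree) (auto simp: arr_rho_eq)
    then show "lin_form u ^ (?r - 1) \<in> ?J"
      using u by (auto simp: \<theta>_hom \<theta>_lin_form intro: sym_carrier_power sym_carrier.lin)
  qed (auto simp: \<theta>_hom sym_carrier_0 intro: sym_carrier.intros nonsqfree_add nonsqfree_mult)
  then show ?thesis by simp
qed

lemma F_ideal: "p \<in> I \<Longrightarrow> F p = 0"
  unfolding F_def by (rule lookup_nonsqfree[OF \<theta>_ideal]) (auto simp: lookup_tmon)

abbreviation Y :: "nat \<Rightarrow> nat cpoly" where
  "Y k \<equiv> sgl (sgl k 1) 1"

lemma \<theta>_x: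
  assumes p: "p \<in> pts" and q: "q \<in> pts" and pq: "fst p \<noteq> fst q"
  shows "\<theta> (x p q) = (if snd p = snd q then
      if pos (fst p) < pos (fst q) then poly_const (snd p) * Y (pos (fst q))
      else poly_const (- snd p) * Y (pos (fst p)) else 0)"
proof -
  let ?v = "evec p q" and ?i = "fst p" and ?j = "fst q" and ?a = "ecoef p q"
  have ij: "?i < n" "?j < n" using p q by (auto simp: pts_iff)
  have nz: "snd p \<noteq> 0" "snd q \<noteq> 0" "?a \<noteq> 0"
    using p q pq by (auto simp: pts_nonzero ecoef_nonzero)
  have dim: "dim_vec ?v = n" by (simp add: evec_def)
  have at: "?a * ?v $ k = (if k = ?i then snd p else 0) - (if k = ?j then snd q else 0)" if "k < n" for k
    using arg_cong[OF ecoef_evec[OF assms], of "\<lambda>v. v $ k"] that ij dim by simp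
  have "?a * vsum ?v = (\<Sum>k<n. (if k = ?i then snd p else 0) - (if k = ?j then snd q else 0))"
    unfolding vsum_def sum_distrib_left by (intro sum.cong) (auto simp: at)
  also have "\<dots> = snd p - snd q" using ij by (simp add: sum_subtractf sum.delta)
  finally have vs: "vsum ?v = 0 \<longleftrightarrow> snd p = snd q" using nz by auto
  have \<psi>u: "\<psi> (unit_vec n k) = 0" if "k < n" for k
  proof -
    have "vsum (unit_vec n k) = 1" using that by (simp add: vsum_def sum.delta)
    then show ?thesis by (simp add: \<psi>_def)
  qed
  have Psi: "\<Psi> u = (\<Sum>v\<in>A. cscale (lkp u v) (\<psi> v))" if "finite A" "kys u \<subseteq> A" for u A
    unfolding \<Psi>_def using that by (intro sum.mono_neutral_left)
      (auto simp: in_keys_iff intro!: poly_mapping_eqI)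
  have "\<Psi> (X p q) = (\<Sum>v\<in>{?v, unit_vec n ?i, unit_vec n ?j}. cscale (lkp (X p q) v) (\<psi> v))"
    using keys_X[OF assms] by (intro Psi) auto
  also have "\<dots> = cscale ?a (\<psi> ?v)"
    using ij pq evec_neq_unit[OF assms] by (simp add: \<psi>u unit_vec_inject lookup_X[OF assms])
  finally have *: "\<theta> (x p q) = lin_form (cscale ?a (\<psi> ?v))" by (simp add: x_def \<theta>_lin_form)
  show ?thesis
  proof (cases "snd p = snd q")
    case False
    then have "\<psi> ?v = 0" using vs by (simp add: \<psi>_def)
    with False show ?thesis by (simp add: *)
  next
    case True
    have "{a. a < n \<and> ?v $ a \<noteq> 0} = {?i, ?j}"
    proof (intro subset_antisym subsetI)
      fix a assume "a \<in> {a. a < n \<and> ?v $ a \<noteq> 0}"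
      then show "a \<in> {?i, ?j}" using at[of a] nz by (auto split: if_splits)
    next
      fix a assume "a \<in> {?i, ?j}"
      then show "a \<in> {a. a < n \<and> ?v $ a \<noteq> 0}" using at[of a] nz ij pq by (auto split: if_splits)
    qed
    then have later: "later ?v = max (pos ?i) (pos ?j)" by (simp add: later_def)
    have "cscale ?a (\<psi> ?v) = sgl (later ?v) (- (?a * ?v $ xs (later ?v)))"
      using True vs evec_arr_vecs[OF assms] by (simp add: \<psi>_def)
    also have "\<dots> = (if pos ?i < pos ?j then sgl (pos ?j) (snd p) else sgl (pos ?i) (- snd p))"
      using True ij pq at[of ?i] at[of ?j] by (auto simp: later max_def xs_pos)
    finally show ?thesis
      using True by (auto simp: * lin_form_single poly_const_mult_single)
  qed
qed

text \<open>An edge whose endpoints carry different scalars is sent to zero. If the path ascends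
  into a vertex and then descends from it, both edges yield the variable of that vertex, hence a
  square. A surviving path that starts upwards therefore ascends throughout with one scalar.\<close>

lemma path_nonsqfree:
  assumes "distinct_ax (p # q # r)" "pos (fst p) < pos (fst q)" "\<theta> (path (p # q # r)) \<notin> nonsqfree"
  shows "sorted_wrt (<) (map (pos \<circ> fst) (p # q # r)) \<and> (\<forall>z\<in>set (q # r). snd z = snd p)"
  using assms
proof (induction r arbitrary: p q)
  case Nil
  then have "\<theta> (x p q) \<noteq> 0" by auto
  with Nil show ?case by (auto simp: \<theta>_x distinct_ax_Cons split: if_splits)
next
  case (Cons s r)
  have pqs: "p \<in> pts" "q \<in> pts" "s \<in> pts" "fst p \<noteq> fst q" "fst q \<noteq> fst s"
    using Cons.prems by (auto simp: distinct_ax_Cons)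
  have th: "\<theta> (path (p # q # s # r)) = \<theta> (x p q) * \<theta> (path (q # s # r))"
    "\<theta> (path (p # q # s # r)) = \<theta> (path (s # r)) * (\<theta> (x p q) * \<theta> (x q s))"
    by (simp_all add: \<theta>_hom)
  have ns: "\<theta> (path (q # s # r)) \<notin> nonsqfree" using Cons.prems(3) th(1) nonsqfree_mult by auto
  have ns2: "\<theta> (x p q) * \<theta> (x q s) \<notin> nonsqfree" using Cons.prems(3) th(2) nonsqfree_mult by auto
  then have "\<theta> (x p q) \<noteq> 0" "\<theta> (x q s) \<noteq> 0" by auto
  then have snds: "snd p = snd q" "snd q = snd s" using pqs by (auto simp: \<theta>_x split: if_splits)
  have "pos (fst q) < pos (fst s)"
  proof (rule ccontr)
    assume "\<not> ?thesis"
    then have "\<theta> (x p q) * \<theta> (x q s) = poly_const (snd p * - snd q) * (Y (pos (fst q)) * Y (pos (fst q)))"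
      using pqs snds Cons.prems(2) by (simp add: \<theta>_x poly_const_uminus poly_const_mult mult_ac)
    then show False using ns2 nonsqfree_mult[OF nonsqfree_var_square] by metis
  qed
  with Cons.IH[of q s] ns Cons.prems snds show ?case
    by (auto simp: distinct_ax_Cons)
qed

definition base :: "(nat \<times> complex) list" where
  "base = map (\<lambda>i. (xs i, 1)) [0..<n]"

lemma distinct_ax_base: "distinct_ax base" and fst_base: "fst ` set base = {..<n}"
proof -
  have "distinct (map xs [0..<n])"
    using bij_xs by (auto simp: distinct_map bij_betw_def lessThan_atLeast0)
  then show "distinct_ax base" using xs_less by (auto simp: distinct_ax_def base_def pts_iff comp_def)
  show "fst ` set base = {..<n}"
    using bij_xs by (auto simp: base_def bij_betw_def image_image lessThan_atLeast0)
qed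

lemma \<theta>_path_base:
  assumes "a < b" "b \<le> n"
  shows "\<theta> (path (map (\<lambda>i. (xs i, 1)) [a..<b])) = sgl (\<Sum>k\<in>{a<..<b}. sgl k 1) 1"
proof -
  have "a \<le> b - 1" using assms by simp
  then show ?thesis
  proof (induction a rule: inc_induct)
    case base
    have "[b - 1..<b] = [b - 1]" using assms by (cases b) auto
    moreover have "{b - 1<..<b} = {}" using assms by auto
    ultimately show ?case by (simp add: \<theta>_hom)
  next
    case (step a)
    have l: "[a..<b] = a # Suc a # [Suc (Suc a)..<b]" "[Suc a..<b] = Suc a # [Suc (Suc a)..<b]"
      using step.hyps by (simp_all add: upt_conv_Cons)
    have P: "(xs a, 1) \<in> pts" "(xs (Suc a), 1) \<in> pts" "xs a \<noteq> xs (Suc a)"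
    proof -
      have "a < n" "Suc a < n" using step.hyps assms(2) by auto
      then show "(xs a, 1) \<in> pts" "(xs (Suc a), 1) \<in> pts" "xs a \<noteq> xs (Suc a)"
        using xs_less pos_xs[of a] pos_xs[of "Suc a"] by (auto simp: pts_iff simp del: pos_xs)
    qed
    have "{a<..<b} = insert (Suc a) {Suc a<..<b}" using step.hyps by auto
    then have "(\<Sum>k\<in>{a<..<b}. sgl k (1::nat)) = sgl (Suc a) 1 + (\<Sum>k\<in>{Suc a<..<b}. sgl k 1)" by simp
    moreover have "\<theta> (x (xs a, 1) (xs (Suc a), 1)) = Y (Suc a)"
      using P step.hyps assms(2) by (simp add: \<theta>_x)
    ultimately show ?case
      using step.IH unfolding l by (simp add: \<theta>_hom mult_single)
  qed
qed

lemma F_path_base: "F (path base) = 1"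
proof -
  have "{0<..<n} = {1..<n}" by auto
  then show ?thesis
    using \<theta>_path_base[of 0 n] n_ge_3 by (simp add: F_def base_def tmon_def)
qed

text \<open>Position 0 is the lowest, so a path starting at (0, 1) begins with an ascent and
  \<open>path_nonsqfree\<close> applies. The only ascending list that meets all axes with scalar 1
  is \<open>base\<close>.\<close>

lemma F_path_rooted:
  assumes ps: "distinct_ax ps" "fst ` set ps = {..<n}" "hd ps = (0, 1)"
  shows "F (path ps) = (if ps = base then 1 else 0)"
proof (cases "ps = base")
  case False
  have "distinct (map fst ps)" using ps(1) by (simp add: distinct_ax_def)
  then have len: "length ps = n"
    using distinct_card[of "map fst ps"] ps(2) by simp
  then obtain p q r where pqr: "ps = p # q # r"
    using n_ge_3 by (cases ps rule: path.cases) auto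
  have p: "p = (0, 1)" using ps(3) pqr by simp
  have "fst q < n" "fst q \<noteq> 0" using ps pqr p by (auto simp: distinct_ax_Cons pts_iff)
  then have lt: "pos (fst p) < pos (fst q)" using p pos_0 pos_eq_iff[of "fst q" 0] n_ge_3 by simp
  have "\<theta> (path ps) \<in> nonsqfree"
  proof (rule ccontr)
    assume "\<theta> (path ps) \<notin> nonsqfree"
    with path_nonsqfree[of p q r] lt ps(1) pqr
    have so: "sorted_wrt (<) (map (pos \<circ> fst) ps)" and one: "\<forall>z\<in>set ps. snd z = 1" by (auto simp: p)
    have "set (map (pos \<circ> fst) ps) = pos ` (fst ` set ps)" by (simp add: image_comp)
    also have "\<dots> = {..<n}"
      using bij_betw_inv_into[OF bij_xs] by (simp add: ps(2) pos_def bij_betw_def)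
    finally have "map (pos \<circ> fst) ps = [0..<n]"
      using so by (intro sorted_distinct_set_unique) (simp_all only: strict_sorted_iff sorted_upt distinct_upt set_upt lessThan_atLeast0)
    then have "map (\<lambda>i. (xs i, 1)) (map (pos \<circ> fst) ps) = base" by (simp add: base_def)
    moreover have "map (\<lambda>i. (xs i, 1)) (map (pos \<circ> fst) ps) = ps"
      unfolding map_map using one ps(1) xs_pos(1)
      by (intro map_idI) (auto simp: distinct_ax_def pts_iff subset_iff prod_eq_iff)
    ultimately show False using False by simp
  qed
  then show ?thesis using False unfolding F_def by (auto simp: lookup_tmon intro!: lookup_nonsqfree)
qed (simp add: F_path_base)

end

section \<open>The inverse major index\<close>

definition perm_lists :: "nat \<Rightarrow> nat list set" where
  "perm_lists k = {l. distinct l \<and> set l = {..<k}}"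

text \<open>For distinct entries a and b of \<open>l\<close>: a stands to the left of b. The form
  with \<open>takeWhile\<close> behaves well under insertion of further entries.\<close>

definition before :: "'a list \<Rightarrow> 'a \<Rightarrow> 'a \<Rightarrow> bool" where
  "before l a b \<longleftrightarrow> b \<notin> set (takeWhile (\<lambda>z. z \<noteq> a) l)"

text \<open>With labels starting at 0, the label i stands left of i - 1 exactly when the inverse
  permutation, with positions counted from 1, has a descent at i. For permutations of the labels
  this is the major index of the inverse.\<close>

definition imaj :: "nat \<Rightarrow> nat list \<Rightarrow> nat" where
  "imaj k l = (\<Sum>i\<in>{1..<k}. if before l i (i - 1) then i else 0)"

lemma before_insert_other:
  assumes "a \<noteq> c" "b \<noteq> c"
  shows "before (take j l @ c # drop j l) a b \<longleftrightarrow> before l a b"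
proof (cases "a \<in> set (take j l)")
  case True
  then have "takeWhile (\<lambda>z. z \<noteq> a) (take j l @ r) = takeWhile (\<lambda>z. z \<noteq> a) (take j l)" for r
    by (simp add: takeWhile_append1)
  from this[of "c # drop j l"] this[of "drop j l"] show ?thesis by (simp add: before_def)
next
  case False
  then have "takeWhile (\<lambda>z. z \<noteq> a) (take j l @ r) = take j l @ takeWhile (\<lambda>z. z \<noteq> a) r" for r
    by (intro takeWhile_append2) auto
  from this[of "c # drop j l"] this[of "drop j l"] show ?thesis using assms by (auto simp: before_def)
qed

lemma before_insert_new:
  assumes "c \<notin> set l"
  shows "before (take j l @ c # drop j l) c b \<longleftrightarrow> b \<notin> set (take j l)"
proof -
  have "takeWhile (\<lambda>z. z \<noteq> c) (take j l @ c # drop j l) = take j l @ takeWhile (\<lambda>z. z \<noteq> c) (c # drop j l)"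
    using assms by (intro takeWhile_append2) (auto dest: in_set_takeD)
  then show ?thesis by (simp add: before_def)
qed

text \<open>Inserting the largest label does not disturb the order of the others. Only the new pair
  \<open>k - 1\<close>, \<open>k\<close> matters, and it contributes \<open>k\<close> when the new
  label is put to the left.\<close>

lemma imaj_insert:
  assumes "k \<ge> 1" "k \<notin> set l"
  shows "imaj (Suc k) (take j l @ k # drop j l) = imaj k l + (if k - 1 \<in> set (take j l) then 0 else k)"
proof -
  have "{1..<Suc k} = insert k {1..<k}" using assms(1) by auto
  then have "imaj (Suc k) (take j l @ k # drop j l)
      = (if k - 1 \<in> set (take j l) then 0 else k)
        + (\<Sum>i\<in>{1..<k}. if before (take j l @ k # drop j l) i (i - 1) then i else 0)"
    using before_insert_new[OF assms(2), of j "k - 1"] by (auto simp: imaj_def)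
  also have "(\<Sum>i\<in>{1..<k}. if before (take j l @ k # drop j l) i (i - 1) then i else 0) = imaj k l"
    unfolding imaj_def by (intro sum.cong refl) (subst before_insert_other, auto)
  finally show ?thesis by simp
qed

lemma perm_lists_1: "perm_lists 1 = {[0]}"
proof -
  have "l = [0]" if l: "distinct l" "set l = {0}" for l :: "nat list"
  proof -
    have "length l = 1" using distinct_card[OF l(1)] l(2) by simp
    then show ?thesis using l(2) by (cases l) auto
  qed
  moreover have "{..<1::nat} = {0}" by auto
  ultimately show ?thesis unfolding perm_lists_def by (intro subset_antisym subsetI) simp_all
qed

lemma bij_insert_label:
  "bij_betw (\<lambda>(l, j). take j l @ k # drop j l) (perm_lists k \<times> {..k}) (perm_lists (Suc k))"
  unfolding bij_betw_def
proof (intro conjI subset_antisym subsetI)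
  let ?ins = "\<lambda>(l, j). take j l @ k # drop j l"
  have len: "length l = k" if "l \<in> perm_lists k" for l
    using that distinct_card[of l] by (auto simp: perm_lists_def)
  show "inj_on ?ins (perm_lists k \<times> {..k})"
  proof (rule inj_onI, clarify)
    fix l j l' j' assume *: "l \<in> perm_lists k" "l' \<in> perm_lists k" "j \<le> k" "j' \<le> k"
      "take j l @ k # drop j l = take j' l' @ k # drop j' l'"
    have "k \<notin> set (take j l)" "k \<notin> set (take j' l')" "k \<notin> set (drop j l)" "k \<notin> set (drop j' l')"
      using * by (auto simp: perm_lists_def dest!: in_set_takeD in_set_dropD)
    then have eq: "take j l = take j' l' \<and> drop j l = drop j' l'"
      using *(5) by (auto simp: append_eq_append_conv2 append_eq_Cons_conv Cons_eq_append_conv)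
    then have "l = l'" by (metis append_take_drop_id)
    moreover have "j = j'" using arg_cong[OF conjunct1[OF eq], of length] * by (simp add: len)
    ultimately show "l = l' \<and> j = j'" by simp
  qed
  fix l assume "l \<in> ?ins ` (perm_lists k \<times> {..k})"
  then obtain r j where r: "r \<in> perm_lists k" and l: "l = take j r @ k # drop j r" by auto
  have "mset l = mset (k # r)" unfolding l by simp (metis append_take_drop_id mset_append)
  then have "set l = set (k # r)" "distinct l = distinct (k # r)"
    by (metis mset_eq_setD, metis mset_eq_imp_distinct_iff)
  then show "l \<in> perm_lists (Suc k)" using r by (simp add: perm_lists_def lessThan_Suc)
next
  let ?ins = "\<lambda>(l, j). take j l @ k # drop j l"
  fix l assume l: "l \<in> perm_lists (Suc k)"
  then have "k \<in> set l" by (auto simp: perm_lists_def)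
  then obtain us vs where uv: "l = us @ k # vs" by (meson split_list)
  have "insert k (set (us @ vs)) = insert k {..<k}" "k \<notin> set (us @ vs)" "distinct (us @ vs)"
    using l by (auto simp: perm_lists_def uv lessThan_Suc)
  then have "us @ vs \<in> perm_lists k" unfolding perm_lists_def by (auto simp: insert_eq_iff)
  moreover from this have "length us \<le> k"
    using distinct_card[of "us @ vs"] by (auto simp: perm_lists_def)
  ultimately show "l \<in> ?ins ` (perm_lists k \<times> {..k})"
    by (intro image_eqI[of _ _ "(us @ vs, length us)"]) (auto simp: uv)
qed

text \<open>Moving a from the front to the back affects only the comparisons of a with its
  neighbouring labels: the contribution a is lost and a + 1 is gained. For a = n - 1 nothing is
  gained, and the change -(n - 1) is still 1 modulo n. The function \<open>g\<close> in the proof is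
  the common part of both sums.\<close>

lemma imaj_rotate:
  assumes "a # l \<in> perm_lists n" and q: "q ^ n = (1 :: complex)"
  shows "q ^ imaj n (l @ [a]) = q * q ^ imaj n (a # l)"
proof -
  have a: "a < n" "a \<notin> set l" "set l = {..<n} - {a}" using assms(1) by (auto simp: perm_lists_def)
  define g where "g i = (if i = a \<or> i = Suc a then 0 else if before l i (i - 1) then i else 0)" for i
  have rot: "(if before (l @ [a]) i (i - 1) then i else 0) = g i + (if i = Suc a then i else 0)"
    if "i \<in> {1..<n}" for i
  proof -
    consider "i = a" | "i = Suc a" | "i \<noteq> a" "i \<noteq> Suc a" by blast
    then show ?thesis
    proof cases
      case 1
      have "takeWhile (\<lambda>z. z \<noteq> a) (l @ [a]) = l"
        using a by (subst takeWhile_append2) auto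
      moreover have "a - 1 \<in> set l" unfolding a(3) using 1 that by simp linarith
      ultimately show ?thesis using 1 by (simp add: before_def g_def)
    next
      case 2
      then have "takeWhile (\<lambda>z. z \<noteq> i) (l @ [a]) = takeWhile (\<lambda>z. z \<noteq> i) l"
        using a that by (intro takeWhile_append1) auto
      then show ?thesis using 2 a by (auto simp: before_def g_def dest: set_takeWhileD)
    next
      case 3
      then have "takeWhile (\<lambda>z. z \<noteq> i) (l @ [a]) = takeWhile (\<lambda>z. z \<noteq> i) l"
        using a that by (intro takeWhile_append1) auto
      then show ?thesis using 3 by (auto simp: before_def g_def)
    qed
  qed
  have unrot: "(if before (a # l) i (i - 1) then i else 0) = g i + (if i = a then i else 0)"
    if "i \<in> {1..<n}" for i
    using that by (auto simp: before_def g_def)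
  have 1: "imaj n (l @ [a]) = (\<Sum>i\<in>{1..<n}. g i) + (if Suc a < n then Suc a else 0)"
  proof -
    have "imaj n (l @ [a]) = (\<Sum>i\<in>{1..<n}. g i + (if i = Suc a then i else 0))"
      unfolding imaj_def by (rule sum.cong[OF refl rot])
    then show ?thesis by (simp add: sum.distrib sum.delta)
  qed
  have 2: "imaj n (a # l) = (\<Sum>i\<in>{1..<n}. g i) + a"
  proof -
    have "imaj n (a # l) = (\<Sum>i\<in>{1..<n}. g i + (if i = a then i else 0))"
      unfolding imaj_def by (rule sum.cong[OF refl unrot])
    then show ?thesis using a(1) by (simp add: sum.distrib sum.delta)
  qed
  show ?thesis
  proof (cases "Suc a < n")
    case False
    then have "n = Suc a" using a by simp
    then have "q * q ^ a = 1" using q by simp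
    then show ?thesis unfolding 1 2 using False by (simp add: power_add)
  qed (simp add: 1 2 power_add)
qed

section \<open>Weighted sums of labelled paths\<close>

context enumerated_arrangement
begin

lemma xs_eq_iff: "i < n \<Longrightarrow> j < n \<Longrightarrow> xs i = xs j \<longleftrightarrow> i = j"
  by (metis pos_xs)

definition lpath :: "nat list \<Rightarrow> complex vec cpoly" where
  "lpath l = path (map (\<lambda>i. (xs i, 1)) l)"

lemma distinct_ax_labels:
  assumes "distinct l" "set l \<subseteq> {..<n}" "\<alpha> ^ m = 1"
  shows "distinct_ax (map (\<lambda>i. (xs i, \<alpha>)) l)"
proof -
  have "inj_on xs (set l)" using bij_xs assms(2) by (auto simp: bij_betw_def intro: inj_on_subset)
  then show ?thesis using assms xs_less by (auto simp: distinct_ax_def pts_iff comp_def distinct_map)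
qed

text \<open>Insertions to the right of label \<open>k - 1\<close> keep the weight and add up to a
  pendant edge leaving that vertex. Insertions to its left gain the factor \<open>q ^ k\<close> and
  add up to the same edge reversed. The sign of the reversal turns the total into
  \<open>1 - q ^ k\<close> times one edge.\<close>

lemma insertion_sum:
  assumes k: "1 \<le> k" "k < n" and l: "l \<in> perm_lists k"
  shows "(\<Sum>j\<le>k. poly_const (q ^ imaj (Suc k) (take j l @ k # drop j l)) * lpath (take j l @ k # drop j l))
    - poly_const (q ^ imaj k l * (1 - q ^ k)) * (lpath l * x (xs (k - 1), 1) (xs k, 1)) \<in> I"
    (is "?S - _ \<in> I")
proof -
  let ?pt = "\<lambda>i. (xs i, 1 :: complex)"
  let ?a = "?pt (k - 1)" and ?b = "?pt k"
  let ?ins = "\<lambda>j. take j l @ k # drop j l"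
  have ll: "distinct l" "set l = {..<k}" using l by (auto simp: perm_lists_def)
  have len: "length l = k" using distinct_card[OF ll(1)] ll(2) by simp
  have "k - 1 \<in> set l" "k \<notin> set l" using ll k by auto
  then obtain us vs where uv: "l = us @ (k - 1) # vs" by (meson split_list)
  have lenuv: "k = Suc (length us + length vs)" using len uv by simp
  have b: "?b \<in> pts" using k xs_less by (simp add: pts_iff)
  have ad: "distinct_ax (map ?pt l)" using ll k by (intro distinct_ax_labels) auto
  have bn: "fst ?b \<notin> fst ` set (map ?pt l)"
  proof
    assume "fst ?b \<in> fst ` set (map ?pt l)"
    then have "xs k \<in> xs ` {..<k}" by (simp only: fst_conv set_map image_image ll(2))
    then obtain i where "i < k" "xs k = xs i" by blast
    then show False using pos_xs[of i] pos_xs[of k] k by simp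
  qed
  have ms: "map ?pt l = map ?pt us @ ?a # map ?pt vs" by (simp add: uv)
  define c where "c = q ^ imaj k l"
  define B where "B = (\<Sum>j\<le>length us. lpath (?ins j))"
  define A where "A = (\<Sum>i\<le>length vs. lpath (?ins (Suc (length us + i))))"
  have imaj_B: "imaj (Suc k) (?ins j) = imaj k l + k" if "j \<le> length us" for j
  proof -
    have "k - 1 \<notin> set (take j l)" using that ll(1) by (auto simp: uv dest: in_set_takeD)
    then show ?thesis using imaj_insert[OF k(1) \<open>k \<notin> set l\<close>, of j] by simp
  qed
  have imaj_A: "imaj (Suc k) (?ins (Suc (length us + i))) = imaj k l" for i
  proof -
    have "k - 1 \<in> set (take (Suc (length us + i)) l)" by (simp add: uv)
    then show ?thesis using imaj_insert[OF k(1) \<open>k \<notin> set l\<close>, of "Suc (length us + i)"] by simp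
  qed
  \<comment> \<open>The label \<open>k - 1\<close> sits at index \<open>length us\<close>, so
    insertion positions up to \<open>length us\<close> lie to its left and the later ones to its
    right.\<close>
  have "{..k} = {..length us} \<union> (\<lambda>i. Suc (length us + i)) ` {..length vs}"
  proof (intro subset_antisym subsetI)
    fix j assume "j \<in> {..k}"
    then show "j \<in> {..length us} \<union> (\<lambda>i. Suc (length us + i)) ` {..length vs}"
      using lenuv by (cases "j \<le> length us") (auto intro!: image_eqI[of _ _ "j - Suc (length us)"])
  qed (use lenuv in auto)
  moreover have "{..length us} \<inter> (\<lambda>i. Suc (length us + i)) ` {..length vs} = {}" by auto
  ultimately have S: "?S = (\<Sum>j\<le>length us. poly_const (q ^ imaj (Suc k) (?ins j)) * lpath (?ins j))
      + (\<Sum>i\<le>length vs. poly_const (q ^ imaj (Suc k) (?ins (Suc (length us + i)))) * lpath (?ins (Suc (length us + i))))"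
    by (simp only: sum.union_disjoint finite_atMost finite_imageI) (simp add: sum.reindex inj_on_def)
  have "?S = poly_const (c * q ^ k) * B + poly_const c * A"
    unfolding S A_def B_def c_def imaj_A by (simp add: imaj_B power_add sum_distrib_left)
  moreover have IB: "lpath l * x ?b ?a - B \<in> I"
  proof -
    have "lpath (?ins j) = path (take j (map ?pt us) @ ?b # drop j (map ?pt us) @ ?a # map ?pt vs)"
      if "j \<le> length us" for j
      using that by (simp add: lpath_def uv take_map drop_map)
    then show ?thesis
      using path_insert_before[of "map ?pt us" ?a "map ?pt vs" ?b] ad b bn
      unfolding B_def lpath_def ms by simp
  qed
  moreover have IA: "lpath l * x ?a ?b - A \<in> I"
  proof -
    have "lpath (?ins (Suc (length us + i)))
        = path (map ?pt us @ ?a # take i (map ?pt vs) @ ?b # drop i (map ?pt vs))" for i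
      by (simp add: lpath_def uv take_map drop_map)
    then show ?thesis
      using path_insert_after[of "map ?pt us" ?a "map ?pt vs" ?b] ad b bn
      unfolding A_def lpath_def ms by simp
  qed
  moreover have "x ?b ?a = - x ?a ?b"
    using k xs_less xs_eq_iff[of "k - 1" k] by (intro x_swap) (auto simp: pts_iff)
  moreover have pc: "poly_const (c * (1 - q ^ k)) = poly_const c - poly_const (c * q ^ k)"
    using poly_const_add[of c "- (c * q ^ k)"] by (simp add: right_diff_distrib poly_const_uminus)
  ultimately have "?S - poly_const (c * (1 - q ^ k)) * (lpath l * x ?a ?b)
      = - (poly_const (c * q ^ k) * (lpath l * x ?b ?a - B) + poly_const c * (lpath l * x ?a ?b - A))"
    by (simp only: pc) (simp add: algebra_simps del: poly_const_mult)
  also have "\<dots> \<in> I"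
    by (intro iideal_uminus iideal_add iideal_scale IB IA)
  finally show ?thesis by (simp only: c_def)
qed

text \<open>The edge produced by \<open>insertion_sum\<close> does not depend on the list, so it
  factors out of the whole sum. It is also the edge that extends the ascending path by one
  vertex.\<close>

lemma imaj_path_sum:
  assumes "1 \<le> k" "k \<le> n"
  shows "(\<Sum>l\<in>perm_lists k. poly_const (q ^ imaj k l) * lpath l)
    - poly_const (\<Prod>i\<in>{1..<k}. 1 - q ^ i) * lpath [0..<k] \<in> I"
  using assms
proof (induction k rule: dec_induct)
  case base
  have "imaj 1 [0] = 0" by (simp add: imaj_def)
  then show ?case unfolding perm_lists_1 by (simp add: lpath_def iideal_0)
next
  case (step k)
  define e where "e = x (xs (k - 1), 1) (xs k, 1)"
  define Pr where "Pr = (\<Prod>i\<in>{1..<k}. 1 - q ^ i)"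
  let ?ins = "\<lambda>(l, j). take j l @ k # drop j l"
  let ?t = "\<lambda>l. poly_const (q ^ imaj (Suc k) l) * lpath l"
  have k: "1 \<le> k" "k < n" using step by auto
  have e: "e \<in> SK"
    unfolding e_def using k xs_less xs_eq_iff[of "k - 1" k]
    by (intro x_sym) (auto simp: pts_iff)
  have "(\<Sum>l\<in>perm_lists (Suc k). ?t l) = (\<Sum>lj\<in>perm_lists k \<times> {..k}. ?t (?ins lj))"
    by (rule sum.reindex_bij_betw[OF bij_insert_label, symmetric])
  also have "\<dots> = (\<Sum>l\<in>perm_lists k. \<Sum>j\<le>k. ?t (take j l @ k # drop j l))"
    by (simp add: sum.cartesian_product case_prod_unfold)
  finally have S: "(\<Sum>l\<in>perm_lists (Suc k). ?t l) = (\<Sum>l\<in>perm_lists k. \<Sum>j\<le>k. ?t (take j l @ k # drop j l))" .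
  have "(\<Sum>l\<in>perm_lists k. (\<Sum>j\<le>k. ?t (take j l @ k # drop j l))
      - poly_const (q ^ imaj k l * (1 - q ^ k)) * (lpath l * e)) \<in> I"
    unfolding e_def by (intro iideal_sum insertion_sum k)
  moreover have "(\<Sum>l\<in>perm_lists k. poly_const (q ^ imaj k l * (1 - q ^ k)) * (lpath l * e))
      = poly_const (1 - q ^ k) * (e * (\<Sum>l\<in>perm_lists k. poly_const (q ^ imaj k l) * lpath l))"
    by (simp add: sum_distrib_left poly_const_mult mult_ac)
  ultimately have 1: "(\<Sum>l\<in>perm_lists (Suc k). ?t l)
      - poly_const (1 - q ^ k) * (e * (\<Sum>l\<in>perm_lists k. poly_const (q ^ imaj k l) * lpath l)) \<in> I"
    by (simp add: S sum_subtractf)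
  have "poly_const (1 - q ^ k) * (e * ((\<Sum>l\<in>perm_lists k. poly_const (q ^ imaj k l) * lpath l)
      - poly_const Pr * lpath [0..<k])) \<in> I"
    unfolding Pr_def using step by (intro iideal_scale iideal_mult e) auto
  from iideal_add[OF 1 this] have "(\<Sum>l\<in>perm_lists (Suc k). ?t l)
      - poly_const (1 - q ^ k) * (e * (poly_const Pr * lpath [0..<k])) \<in> I"
    by (simp add: algebra_simps)
  moreover have "lpath [0..<Suc k] = lpath [0..<k] * e"
  proof -
    obtain k' where k': "k = Suc k'" using k by (cases k) auto
    show ?thesis
      using path_append2[of "map (\<lambda>i. (xs i, 1)) [0..<k']" "(xs k', 1)" "(xs k, 1)"]
      by (simp add: lpath_def e_def k')
  qed
  moreover have "(\<Prod>i\<in>{1..<Suc k}. 1 - q ^ i) = Pr * (1 - q ^ k)"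
    unfolding Pr_def using k by (simp add: prod.atLeastLessThan_Suc)
  ultimately show ?case by (simp add: poly_const_mult mult_ac)
qed

section \<open>Group elements as lists of points\<close>

text \<open>Identifies the group with the lists of \<open>n\<close> points on distinct axes. In this
  form right multiplication by the generators of C becomes rotation and scaling of lists.\<close>

definition pl :: "complex mat \<Rightarrow> (nat \<times> complex) list" where
  "pl g = map (gact g) base"

definition point_lists :: "(nat \<times> complex) list set" where
  "point_lists = {ps. distinct_ax ps \<and> length ps = n}"

lemma length_base [simp]: "length base = n"
  by (simp add: base_def)

lemma pl_nth: "i < n \<Longrightarrow> pl g ! i = (gp g (xs i), gc g (xs i))"
  by (simp add: pl_def base_def gact_def)

lemma pl_point_lists: "g \<in> carrier W \<Longrightarrow> pl g \<in> point_lists"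
  by (simp add: pl_def point_lists_def distinct_ax_gact distinct_ax_base)

lemma fst_point_list:
  assumes "ps \<in> point_lists"
  shows "fst ` set ps = {..<n}"
proof (rule card_subset_eq)
  have "set ps \<subseteq> pts" using assms by (simp add: point_lists_def distinct_ax_def)
  then show "fst ` set ps \<subseteq> {..<n}" by (auto simp: pts_iff)
  show "card (fst ` set ps) = card {..<n}"
    using assms distinct_card[of "map fst ps"] by (simp add: point_lists_def distinct_ax_def)
qed simp

lemma pl_inject:
  assumes "g \<in> carrier W" "h \<in> carrier W" "pl g = pl h"
  shows "g = h"
proof -
  have "gp g j = gp h j \<and> gc g j = gc h j" if "j < n" for j
    using arg_cong[OF assms(3), of "\<lambda>l. l ! pos j"] xs_pos[OF that] by (simp add: pl_nth)
  then have "mmat (gp g) (gc g) = mmat (gp h) (gc h)" by (rule mmat_cong)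
  then show ?thesis using monomial_group_decompose(3)[OF assms(1)] monomial_group_decompose(3)[OF assms(2)] by simp
qed

lemma pl_surj:
  assumes "ps \<in> point_lists"
  shows "\<exists>g\<in>carrier W. pl g = ps"
proof -
  have len: "length ps = n" and di: "distinct (map fst ps)" and pp: "set ps \<subseteq> pts"
    using assms by (auto simp: point_lists_def distinct_ax_def)
  define \<pi> where "\<pi> j = (if j < n then fst (ps ! pos j) else j)" for j
  define c where "c j = snd (ps ! pos j)" for j
  have "bij_betw (\<lambda>i. map fst ps ! i) {..<n} {..<n}"
    by (rule bij_betw_nth[OF di]) (simp_all only: length_map len set_map fst_point_list[OF assms])
  then have "bij_betw ((\<lambda>i. map fst ps ! i) \<circ> pos) {..<n} {..<n}"
    unfolding pos_def by (rule bij_betw_trans[OF bij_betw_inv_into[OF bij_xs]])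
  then have "bij_betw \<pi> {..<n} {..<n}"
    by (rule bij_betw_cong[THEN iffD1, rotated]) (simp add: \<pi>_def len xs_pos)
  then have perm: "\<pi> permutes {..<n}" by (rule bij_imp_permutes) (simp add: \<pi>_def)
  have root: "c j ^ m = 1" if "j < n" for j
  proof -
    have "pos j < length ps" using xs_pos[OF that] len by simp
    then have "ps ! pos j \<in> pts" using pp nth_mem by blast
    then show ?thesis by (simp add: c_def pts_iff)
  qed
  have "pl (mmat \<pi> c) = ps"
  proof (rule nth_equalityI)
    fix i assume "i < length (pl (mmat \<pi> c))"
    then have i: "i < n" by (simp add: pl_def)
    then show "pl (mmat \<pi> c) ! i = ps ! i"
      using gp_gc_mmat[where c = c, OF perm root xs_less[OF i]] xs_less[OF i] by (simp add: pl_nth \<pi>_def c_def)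
  qed (simp add: pl_def len)
  then show ?thesis using mmat_carrier[where c = c, OF perm root] by blast
qed

lemma bij_pl: "bij_betw pl (carrier W) point_lists"
  using pl_inject pl_surj pl_point_lists unfolding bij_betw_def inj_on_def by blast

lemma finite_pts: "finite pts"
proof -
  have "pts = {..<n} \<times> {\<alpha>. \<alpha> ^ m = 1}" by (auto simp: pts_iff)
  then show ?thesis using finite_roots by simp
qed

lemma finite_point_lists: "finite point_lists"
  using finite_lists_length_eq[OF finite_pts, of n]
  by (rule finite_subset[rotated]) (auto simp: point_lists_def distinct_ax_def)

lemma finite_W: "finite (carrier W)"
  using bij_betw_finite[OF bij_pl] finite_point_lists by simp

lemma pl_mult: "g \<in> carrier W \<Longrightarrow> h \<in> carrier W \<Longrightarrow> pl (g * h) = map (gact g) (pl h)"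
  using distinct_ax_base by (auto simp: pl_def gact_mult distinct_ax_def)

lemma pl_one: "pl (1\<^sub>m n) = base"
  using distinct_ax_base unfolding pl_def by (intro map_idI gact_one) (auto simp: distinct_ax_def)

definition wpath :: "complex mat \<Rightarrow> complex vec cpoly" where
  "wpath g = path (pl g)"

lemma wpath_one: "wpath (1\<^sub>m n) = path base"
  by (simp add: wpath_def pl_one)

lemma wpath_sym: "g \<in> carrier W \<Longrightarrow> wpath g \<in> SK"
  using pl_point_lists[of g] by (simp add: wpath_def path_sym point_lists_def)

lemma homogeneous_wpath: "homogeneous (n - 1) (wpath g)"
proof -
  have "length (pl g) = n" by (simp add: pl_def)
  moreover from this have "pl g \<noteq> []" using n_ge_3 by auto
  ultimately show ?thesis using homogeneous_path[of "pl g"] by (simp add: wpath_def)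
qed

lemma act_wpath: "g \<in> carrier W \<Longrightarrow> h \<in> carrier W \<Longrightarrow> act g (wpath h) = wpath (g * h)"
  using pl_point_lists[of h] by (simp add: wpath_def pl_mult act_path point_lists_def)

section \<open>The Klyachko element\<close>

text \<open>Only lists with a common scalar get a nonzero weight. The power of the inverse scalar
  has two purposes: it cancels the factor in \<open>path_scale\<close>, and it gives the required
  behaviour under z.\<close>

definition lweight :: "complex \<Rightarrow> (nat \<times> complex) list \<Rightarrow> complex" where
  "lweight q ps = (if \<forall>p\<in>set ps. snd p = snd (hd ps)
     then inverse (snd (hd ps)) ^ (n - 1) * q ^ imaj n (map (pos \<circ> fst) ps) else 0)"

lemma label_list_of_point_list:
  assumes "ps \<in> point_lists"
  shows "map (pos \<circ> fst) ps \<in> perm_lists n"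
    and "\<forall>p\<in>set ps. snd p = \<alpha> \<Longrightarrow> map (\<lambda>i. (xs i, \<alpha>)) (map (pos \<circ> fst) ps) = ps"
proof -
  have "inj_on pos {..<n}" "pos ` {..<n} = {..<n}"
    using bij_betw_inv_into[OF bij_xs] by (auto simp: pos_def bij_betw_def)
  moreover have di: "distinct (map fst ps)" "set ps \<subseteq> pts"
    using assms by (simp_all add: point_lists_def distinct_ax_def)
  moreover have "map (pos \<circ> fst) ps = map pos (map fst ps)" by simp
  ultimately show "map (pos \<circ> fst) ps \<in> perm_lists n"
    unfolding perm_lists_def using fst_point_list[OF assms] by (simp only: distinct_map set_map mem_Collect_eq)
  have "(xs (pos (fst p)), \<alpha>) = p" if "p \<in> set ps" "snd p = \<alpha>" for p
    using that di(2) xs_pos(1) by (auto simp: pts_iff)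
  then show "\<forall>p\<in>set ps. snd p = \<alpha> \<Longrightarrow> map (\<lambda>i. (xs i, \<alpha>)) (map (pos \<circ> fst) ps) = ps"
    unfolding map_map by (intro map_idI) simp
qed

text \<open>The lists of nonzero weight are pairs of a common scalar and a permutation of the
  labels. After cancellation of the scalar each of the \<open>m\<close> roots of unity contributes
  the same sum, evaluated by \<open>imaj_path_sum\<close>.\<close>

lemma klyachko_sum:
  "(\<Sum>g\<in>carrier W. poly_const (lweight q (pl g)) * wpath g)
    - poly_const (of_nat m * (\<Prod>i\<in>{1..<n}. 1 - q ^ i)) * wpath (1\<^sub>m n) \<in> I"
proof -
  let ?R = "{\<alpha>::complex. \<alpha> ^ m = 1}"
  let ?h = "\<lambda>(\<alpha>, l). map (\<lambda>i. (xs i, \<alpha>)) l"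
  let ?C = "{ps \<in> point_lists. \<forall>p\<in>set ps. snd p = snd (hd ps)}"
  have posl: "map (pos \<circ> fst) (map (\<lambda>i. (xs i, \<alpha>)) l) = l" if "l \<in> perm_lists n" for l and \<alpha> :: complex
  proof -
    have "i < n" if "i \<in> set l" for i using that \<open>l \<in> perm_lists n\<close> by (simp add: perm_lists_def)
    then show ?thesis unfolding map_map by (intro map_idI) simp
  qed
  have ne: "l \<noteq> []" "length l = n" if "l \<in> perm_lists n" for l
  proof -
    have "distinct l" "set l = {..<n}" using that by (simp_all add: perm_lists_def)
    then show "length l = n" using distinct_card[of l] by simp
    then show "l \<noteq> []" using n_ge_3 by fastforce
  qed
  have hd: "snd (hd (map (\<lambda>i. (xs i, \<alpha>)) l)) = \<alpha>" if "l \<in> perm_lists n" for l and \<alpha> :: complex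
    using ne[OF that] by (cases l) auto
  have bij: "bij_betw ?h (?R \<times> perm_lists n) ?C"
    unfolding bij_betw_def
  proof (intro conjI subset_antisym subsetI)
    show "inj_on ?h (?R \<times> perm_lists n)"
      by (rule inj_onI, clarify) (metis posl hd)
    fix ps assume "ps \<in> ?h ` (?R \<times> perm_lists n)"
    then obtain \<alpha> l where *: "\<alpha> \<in> ?R" "l \<in> perm_lists n" "ps = map (\<lambda>i. (xs i, \<alpha>)) l" by auto
    then show "ps \<in> ?C"
      using ne[of l] hd[of l \<alpha>] distinct_ax_labels[of l \<alpha>]
      by (auto simp: point_lists_def perm_lists_def)
  next
    fix ps assume ps: "ps \<in> ?C"
    then have "hd ps \<in> pts" using n_ge_3 by (cases ps) (auto simp: point_lists_def distinct_ax_def)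
    then show "ps \<in> ?h ` (?R \<times> perm_lists n)"
      using ps label_list_of_point_list[of ps]
      by (intro image_eqI[of _ _ "(snd (hd ps), map (pos \<circ> fst) ps)"]) (auto simp: pts_iff)
  qed
  have "(\<Sum>g\<in>carrier W. poly_const (lweight q (pl g)) * wpath g)
      = (\<Sum>ps\<in>point_lists. poly_const (lweight q ps) * path ps)"
    unfolding wpath_def by (rule sum.reindex_bij_betw[OF bij_pl])
  also have "\<dots> = (\<Sum>ps\<in>?C. poly_const (lweight q ps) * path ps)"
    using finite_point_lists by (intro sum.mono_neutral_right) (auto simp: lweight_def)
  also have "\<dots> = (\<Sum>\<alpha>l\<in>?R \<times> perm_lists n. poly_const (lweight q (?h \<alpha>l)) * path (?h \<alpha>l))"
    by (rule sum.reindex_bij_betw[OF bij, symmetric])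
  also have "\<dots> = (\<Sum>(\<alpha>, l)\<in>?R \<times> perm_lists n. poly_const (q ^ imaj n l) * lpath l)"
  proof (rule sum.cong[OF refl], clarify)
    fix \<alpha> :: complex and l assume \<alpha>: "\<alpha> ^ m = 1" and l: "l \<in> perm_lists n"
    have nz: "\<alpha> \<noteq> 0" using \<alpha> root_nonzero by blast
    have sc: "map (\<lambda>i. (xs i, \<alpha>)) l = map (pscale \<alpha>) (map (\<lambda>i. (xs i, 1)) l)"
      by (simp add: pscale_def comp_def)
    have "path (map (\<lambda>i. (xs i, \<alpha>)) l) = poly_const (\<alpha> ^ (n - 1)) * lpath l"
      unfolding sc lpath_def using path_scale[of "map (\<lambda>i. (xs i, 1)) l" \<alpha>] nz l ne[OF l]
      by (simp add: distinct_ax_labels perm_lists_def)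
    moreover have "lweight q (map (\<lambda>i. (xs i, \<alpha>)) l) = inverse \<alpha> ^ (n - 1) * q ^ imaj n l"
      unfolding lweight_def posl[OF l] hd[OF l] by auto
    ultimately show "poly_const (lweight q (map (\<lambda>i. (xs i, \<alpha>)) l)) * path (map (\<lambda>i. (xs i, \<alpha>)) l)
        = poly_const (q ^ imaj n l) * lpath l"
    proof -
      have "inverse \<alpha> ^ (n - 1) * q ^ imaj n l * \<alpha> ^ (n - 1) = q ^ imaj n l"
        using nz by (simp add: power_inverse)
      then show ?thesis
        using \<open>lweight q _ = _\<close> \<open>path _ = _\<close> by (simp only: mult.assoc[symmetric] poly_const_mult[symmetric])
    qed
  qed
  also have "\<dots> = poly_const (of_nat m) * (\<Sum>l\<in>perm_lists n. poly_const (q ^ imaj n l) * lpath l)"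
  proof -
    have "poly_const (of_nat k) = (of_nat k :: complex vec cpoly)" for k
      by (induction k) (auto simp: poly_const_add)
    then show ?thesis
      using card_roots_unity_eq[OF m_pos] by (simp add: sum.cartesian_product[symmetric])
  qed
  finally have "(\<Sum>g\<in>carrier W. poly_const (lweight q (pl g)) * wpath g)
    = poly_const (of_nat m) * (\<Sum>l\<in>perm_lists n. poly_const (q ^ imaj n l) * lpath l)" .
  moreover have "lpath [0..<n] = wpath (1\<^sub>m n)" by (simp add: wpath_one lpath_def base_def)
  ultimately show ?thesis
    using iideal_scale[OF imaj_path_sum[of n q], of "of_nat m"] n_ge_3
    by (simp add: poly_const_mult algebra_simps)
qed

end

section \<open>Linear systems and isomorphisms of representations\<close>

text \<open>Takes the place of a comparison of dimensions. Unknowns and equations are both indexed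
  by \<open>D\<close>, so a trivial kernel means a nonzero determinant and hence a right
  inverse.\<close>

lemma square_system_injective_imp_surjective:
  fixes A :: "'d \<Rightarrow> 'd \<Rightarrow> complex"
  assumes "finite D"
    and inj: "\<And>v. (\<And>d. d \<in> D \<Longrightarrow> (\<Sum>e\<in>D. v e * A e d) = 0) \<Longrightarrow> (\<forall>d\<in>D. v d = 0)"
  shows "\<exists>v. \<forall>d\<in>D. (\<Sum>e\<in>D. v e * A e d) = y d"
proof -
  obtain h where h: "bij_betw h {0..<card D} D" using ex_bij_betw_nat_finite[OF assms(1)] by blast
  let ?N = "card D"
  define g where "g = inv_into {0..<?N} h"
  have gh: "g (h i) = i" if "i < ?N" for i
    using that h by (simp add: g_def bij_betw_inv_into_left)
  have hD: "h i \<in> D" if "i < ?N" for i using that h by (auto simp: bij_betw_def)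
  have hg: "h (g d) = d" "g d < ?N" if "d \<in> D" for d
    using that h bij_betw_apply[OF bij_betw_inv_into[OF h] that]
    by (simp_all add: g_def bij_betw_inv_into_right)
  define M where "M = mat ?N ?N (\<lambda>(i, j). A (h j) (h i))"
  have M: "M \<in> carrier_mat ?N ?N" by (simp add: M_def)
  have Mv: "(M *\<^sub>v v) $ i = (\<Sum>e\<in>D. v $ g e * A e (h i))" if "v \<in> carrier_vec ?N" "i < ?N" for v i
  proof -
    have "(M *\<^sub>v v) $ i = (\<Sum>j = 0..<?N. v $ g (h j) * A (h j) (h i))"
      using that by (auto simp: M_def scalar_prod_def gh mult.commute intro!: sum.cong)
    also have "\<dots> = (\<Sum>e\<in>D. v $ g e * A e (h i))"
      by (rule sum.reindex_bij_betw[OF h])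
    finally show ?thesis .
  qed
  have "det M \<noteq> 0"
  proof
    assume "det M = 0"
    then obtain v where v: "v \<in> carrier_vec ?N" "v \<noteq> 0\<^sub>v ?N" "M *\<^sub>v v = 0\<^sub>v ?N"
      using det_0_iff_vec_prod_zero[OF M] by blast
    have "(\<Sum>e\<in>D. v $ g e * A e d) = 0" if "d \<in> D" for d
      using Mv[OF v(1) hg(2)[OF that]] v(3) hg[OF that] by simp
    then have "\<forall>d\<in>D. v $ g d = 0" by (rule inj)
    then have "v $ g (h i) = 0" if "i < ?N" for i using hD[OF that] by blast
    then have "v $ i = 0" if "i < ?N" for i using that gh by simp
    then show False using v(1,2) by (auto intro!: eq_vecI)
  qed
  then obtain B where B: "B \<in> carrier_mat ?N ?N" "M * B = 1\<^sub>m ?N"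
    using det_non_zero_imp_unit[OF M, of "()"] by (auto simp: Units_def ring_mat_def)
  define w where "w = B *\<^sub>v vec ?N (\<lambda>i. y (h i))"
  have w: "w \<in> carrier_vec ?N" using B by (simp add: w_def)
  have "M *\<^sub>v w = (M * B) *\<^sub>v vec ?N (\<lambda>i. y (h i))"
    unfolding w_def by (rule assoc_mult_mat_vec[OF M B(1), symmetric]) simp
  then have Mw: "M *\<^sub>v w = vec ?N (\<lambda>i. y (h i))" using B(2) by simp
  have "(\<Sum>e\<in>D. w $ g e * A e d) = y d" if "d \<in> D" for d
    using Mv[OF w hg(2)[OF that]] hg[OF that] by (simp add: Mw)
  then show ?thesis by (intro exI[of _ "\<lambda>e. w $ g e"]) simp
qed

text \<open>The explicit formula is available for the map from the induced module to the top degree,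
  whereas the isomorphism is asked for in the other direction.\<close>

lemma rep_isomorphic_inverseI:
  assumes V: "group_rep G V \<rho>" and V': "group_rep G V' \<rho>'"
    and S: "bij_betw S (carrier V') (carrier V)"
    and add: "\<And>a b. a \<in> carrier V' \<Longrightarrow> b \<in> carrier V' \<Longrightarrow> S (a \<oplus>\<^bsub>V'\<^esub> b) = S a \<oplus>\<^bsub>V\<^esub> S b"
    and smult: "\<And>c a. a \<in> carrier V' \<Longrightarrow> S (c \<odot>\<^bsub>V'\<^esub> a) = c \<odot>\<^bsub>V\<^esub> S a"
    and equi: "\<And>g a. g \<in> carrier G \<Longrightarrow> a \<in> carrier V' \<Longrightarrow> S (\<rho>' g a) = \<rho> g (S a)"
  shows "rep_isomorphic G V \<rho> V' \<rho>'"
proof -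
  interpret V: group_rep G V \<rho> by (rule V)
  interpret V': group_rep G V' \<rho>' by (rule V')
  let ?T = "inv_into (carrier V') S"
  have T: "?T v \<in> carrier V'" "S (?T v) = v" if "v \<in> carrier V" for v
    using that S by (auto simp: bij_betw_def inv_into_into f_inv_into_f)
  have TS: "?T (S a) = a" if "a \<in> carrier V'" for a
    using that S by (rule bij_betw_inv_into_left[rotated])
  have rho': "\<rho>' g a \<in> carrier V'" if "g \<in> carrier G" "a \<in> carrier V'" for g a
    using V'.rho_linear[OF that(1)] that(2)
    by (auto simp: linear_map_def mod_hom_def mod_hom_axioms_def LinearCombinations.module_hom_def)
  have "?T (v \<oplus>\<^bsub>V\<^esub> w) = ?T v \<oplus>\<^bsub>V'\<^esub> ?T w" if "v \<in> carrier V" "w \<in> carrier V" for v w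
    using TS[of "?T v \<oplus>\<^bsub>V'\<^esub> ?T w"] T[OF that(1)] T[OF that(2)] by (simp add: add)
  moreover have "?T (c \<odot>\<^bsub>V\<^esub> v) = c \<odot>\<^bsub>V'\<^esub> ?T v" if "v \<in> carrier V" for c v
    using TS[of "c \<odot>\<^bsub>V'\<^esub> ?T v"] T[OF that] by (simp add: smult)
  ultimately have hom: "?T \<in> LinearCombinations.module_hom class_ring V V'"
    using T by (auto simp: LinearCombinations.module_hom_def)
  have "linear_map class_ring V V' ?T"
    by (intro linear_map.intro mod_hom.intro mod_hom_axioms.intro hom V.vectorspace_axioms
        V'.vectorspace_axioms V.module_axioms V'.module_axioms)
  moreover have "?T (\<rho> g v) = \<rho>' g (?T v)" if "g \<in> carrier G" "v \<in> carrier V" for g v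
    using TS[OF rho'[OF that(1) T(1)[OF that(2)]]] T[OF that(2)] that by (simp add: equi)
  ultimately show ?thesis
    unfolding rep_isomorphic_def using V V' bij_betw_inv_into[OF S] by blast
qed

section \<open>The function model of an induced representation\<close>

lemma mem_induced_module:
  "f \<in> carrier (induced_module G C \<chi>) \<longleftrightarrow>
    (\<forall>g\<in>carrier G. \<forall>c\<in>C. f (g \<otimes>\<^bsub>G\<^esub> c) = inverse (\<chi> c) * f g) \<and> (\<forall>g. g \<notin> carrier G \<longrightarrow> f g = 0)"
  by (simp add: induced_module_def)

lemma induced_module_simps [simp]:
  "\<zero>\<^bsub>induced_module G C \<chi>\<^esub> = (\<lambda>_. 0)"
  "f \<oplus>\<^bsub>induced_module G C \<chi>\<^esub> f' = (\<lambda>g. f g + f' g)"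
  "a \<odot>\<^bsub>induced_module G C \<chi>\<^esub> f = (\<lambda>g. a * f g)"
  by (simp_all add: induced_module_def)

lemma vectorspace_induced_module: "vectorspace class_ring (induced_module G C \<chi>)"
proof (rule vs_criteria)
  show "\<forall>v\<in>carrier (induced_module G C \<chi>). \<exists>w\<in>carrier (induced_module G C \<chi>).
      v \<oplus>\<^bsub>induced_module G C \<chi>\<^esub> w = \<zero>\<^bsub>induced_module G C \<chi>\<^esub>"
  proof
    fix v assume "v \<in> carrier (induced_module G C \<chi>)"
    then show "\<exists>w\<in>carrier (induced_module G C \<chi>).
      v \<oplus>\<^bsub>induced_module G C \<chi>\<^esub> w = \<zero>\<^bsub>induced_module G C \<chi>\<^esub>"
      by (intro bexI[of _ "\<lambda>g. - v g"]) (auto simp: mem_induced_module)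
  qed
qed (auto simp: mem_induced_module class_field algebra_simps)

lemma group_rep_induced_module:
  assumes "Group.group G" and "C \<subseteq> carrier G"
  shows "group_rep G (induced_module G C \<chi>) (induced_action G)"
proof -
  interpret G: Group.group G by (rule assms(1))
  let ?M = "induced_module G C \<chi>"
  have closed: "induced_action G h f \<in> carrier ?M" if "h \<in> carrier G" "f \<in> carrier ?M" for h f
    using that assms(2)
    by (auto simp: mem_induced_module induced_action_def G.m_assoc[symmetric] subset_iff)
  have "module class_ring ?M"
    using vectorspace_induced_module[of G C \<chi>] by (simp add: vectorspace_def)
  moreover have "induced_action G h \<in> LinearCombinations.module_hom class_ring ?M ?M" if "h \<in> carrier G" for h
    unfolding LinearCombinations.module_hom_def
    by (intro CollectI conjI Pi_I allI impI closed that) (simp_all add: induced_action_def fun_eq_iff)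
  ultimately have lin: "linear_map class_ring ?M ?M (induced_action G h)" if "h \<in> carrier G" for h
    using that by (intro linear_map.intro mod_hom.intro mod_hom_axioms.intro vectorspace_induced_module)
  show ?thesis
  proof (intro group_rep.intro group_rep_axioms.intro assms(1) vectorspace_induced_module lin)
    fix f assume "f \<in> carrier ?M"
    then show "induced_action G \<one>\<^bsub>G\<^esub> f = f" by (auto simp: mem_induced_module induced_action_def)
  next
    fix g h f assume "g \<in> carrier G" "h \<in> carrier G" "f \<in> carrier ?M"
    then show "induced_action G (g \<otimes>\<^bsub>G\<^esub> h) f = induced_action G g (induced_action G h f)"
      by (auto simp: induced_action_def G.inv_mult_group G.m_assoc)
  qed
qed

section \<open>The cyclic enumeration and the character of C\<close>

locale cyclic_arrangement = monomial_arrangement +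
  fixes \<sigma> :: "nat \<Rightarrow> nat" and C :: "complex mat set" and \<chi> :: "complex mat \<Rightarrow> complex"
  assumes \<sigma>: "\<sigma> permutes {..<n}" and cyclic: "cyclic_on \<sigma> {..<n}"
    and C: "C = generate (monomial_group m n) {perm_mat n \<sigma>, omega m \<cdot>\<^sub>m 1\<^sub>m n}"
    and \<chi>: "linear_character (monomial_group m n) C \<chi>"
    and \<chi>_\<sigma>: "\<chi> (perm_mat n \<sigma>) = omega n"
    and \<chi>_z: "\<chi> (omega m \<cdot>\<^sub>m 1\<^sub>m n) = omega m ^ (n - 1)"
begin

text \<open>Enumerating the axes along the orbit of 0 makes right multiplication by the permutation
  matrix of \<open>\<sigma>\<close> a rotation of \<open>pl g\<close>.\<close>

definition xs :: "nat \<Rightarrow> nat" where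
  "xs i = (\<sigma> ^^ i) 0"

lemma xs_Suc: "xs (Suc i) = \<sigma> (xs i)"
  by (simp add: xs_def)

lemma xs_bij_n: "bij_betw xs {..<n} {..<n}" "xs n = 0"
proof -
  have orb: "orbit \<sigma> 0 = {..<n}" using cyclic n_ge_3 by (intro orbit_cyclic_eq3) auto
  then have self: "0 \<in> orbit \<sigma> 0" using n_ge_3 by simp
  \<comment> \<open>The first return time of 0; it equals the size of the orbit, which is
    \<open>n\<close>.\<close>
  let ?D = "funpow_dist1 \<sigma> 0 0"
  have im: "{..<n} = xs ` {0..<?D}" and inj: "inj_on xs {0..<?D}"
    using orbit_conv_funpow_dist1[OF self] inj_on_funpow_dist1[OF self] orb by (simp_all add: xs_def[abs_def])
  have "n = card (xs ` {0..<?D})" using arg_cong[OF im, of card] by simp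
  also have "\<dots> = ?D" using card_image[OF inj] by simp
  finally have D: "?D = n" by simp
  show "bij_betw xs {..<n} {..<n}" using im inj unfolding D by (simp add: bij_betw_def lessThan_atLeast0)
  show "xs n = 0" using funpow_dist1_prop[OF self] unfolding D by (simp add: xs_def)
qed

sublocale enumerated_arrangement m n xs
  by unfold_locales (auto simp: xs_bij_n xs_def)

abbreviation "s \<equiv> perm_mat n \<sigma>"
abbreviation "z \<equiv> omega m \<cdot>\<^sub>m 1\<^sub>m n"

lemma s_z_W: "s \<in> carrier W" "z \<in> carrier W"
  and gact_s: "p \<in> pts \<Longrightarrow> gact s p = (\<sigma> (fst p), snd p)"
  and gact_z: "p \<in> pts \<Longrightarrow> gact z p = pscale (omega m) p"
proof -
  have s: "s = mmat \<sigma> (\<lambda>_. 1)" by (simp add: perm_mat_def mmat_def)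
  have z: "z = mmat id (\<lambda>_. omega m)" by (auto simp: mmat_def intro!: eq_matI)
  note om = omega_root[OF m_pos]
  show "s \<in> carrier W" "z \<in> carrier W"
    unfolding s z using om by (auto intro!: mmat_carrier \<sigma> permutes_id)
  show "gact s p = (\<sigma> (fst p), snd p)" if "p \<in> pts"
    unfolding s gact_def using gp_gc_mmat[OF \<sigma>, of "\<lambda>_. 1" "fst p"] that by (simp add: pts_iff)
  show "gact z p = pscale (omega m) p" if "p \<in> pts"
    unfolding z gact_def using gp_gc_mmat[OF permutes_id, of "\<lambda>_. omega m" "fst p"] that om
    by (simp add: pts_iff pscale_def)
qed

lemma C_subset: "C \<subseteq> carrier W"
  unfolding C using W.generate_in_carrier[of "{s, z}"] s_z_W by auto

lemma C_closed: "c \<in> C \<Longrightarrow> c' \<in> C \<Longrightarrow> c * c' \<in> C" "1\<^sub>m n \<in> C" "s \<in> C" "z \<in> C"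
  unfolding C using generate.eng[of _ W] generate.one[of W] generate.incl[of _ _ W] by auto

lemma \<chi>_mult: "c \<in> C \<Longrightarrow> c' \<in> C \<Longrightarrow> \<chi> (c * c') = \<chi> c * \<chi> c'"
  using \<chi> by (auto simp: linear_character_def hom_def units_of_def)

lemma \<chi>_nonzero: "c \<in> C \<Longrightarrow> \<chi> c \<noteq> 0"
proof
  assume "c \<in> C" "\<chi> c = 0"
  moreover from this(1) have "\<chi> c \<in> Units (class_ring :: complex ring)"
    using \<chi> by (auto simp: linear_character_def hom_def units_of_def)
  ultimately show False by (auto simp: Units_def)
qed

lemma \<chi>_one: "\<chi> (1\<^sub>m n) = 1"
  using \<chi>_mult[OF C_closed(2) C_closed(2)] \<chi>_nonzero[OF C_closed(2)] by simp

text \<open>Rotation multiplies \<open>lweight q\<close> by \<open>q\<close>, and membership in the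
  induced module demands the factor \<open>inverse (\<chi> s)\<close>.\<close>

definition q :: complex where
  "q = inverse (omega n)"

lemma q_power_n: "q ^ n = 1"
  using omega_root[of n] n_ge_3 by (simp add: q_def power_inverse)

lemma q_primitive: "i \<in> {1..<n} \<Longrightarrow> q ^ i \<noteq> 1"
proof -
  assume i: "i \<in> {1..<n}"
  have "inj_on (\<lambda>k. omega n ^ k) {..<n}"
    using bij_betw_roots_unity[of n] n_ge_3 by (auto simp: bij_betw_def omega_power)
  then have "omega n ^ i \<noteq> omega n ^ 0" using i by (subst inj_on_eq_iff) auto
  then show ?thesis by (simp add: q_def power_inverse)
qed

definition \<kappa> :: complex where
  "\<kappa> = of_nat m * (\<Prod>i\<in>{1..<n}. 1 - q ^ i)"

lemma \<kappa>_nonzero: "\<kappa> \<noteq> 0"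
  using m_pos q_primitive by (auto simp: \<kappa>_def)

definition F0 :: "complex mat \<Rightarrow> complex" where
  "F0 g = (if g \<in> carrier W then lweight q (pl g) else 0)"

lemma lweight_rotate:
  assumes "p # ps \<in> point_lists"
  shows "lweight q (ps @ [p]) = q * lweight q (p # ps)"
proof -
  have len: "length (p # ps) = n" using assms by (simp only: point_lists_def mem_Collect_eq)
  then have "ps \<noteq> []" using n_ge_3 by auto
  have "(\<forall>r\<in>set (ps @ [p]). snd r = snd (hd (ps @ [p]))) \<longleftrightarrow> (\<forall>r\<in>set (p # ps). snd r = snd p)"
    using \<open>ps \<noteq> []\<close> by (cases ps) auto
  moreover have "snd (hd (ps @ [p])) = snd p" if "\<forall>r\<in>set (p # ps). snd r = snd p"
    using that \<open>ps \<noteq> []\<close> by (cases ps) auto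
  moreover have "q ^ imaj n (map (pos \<circ> fst) (ps @ [p])) = q * q ^ imaj n (map (pos \<circ> fst) (p # ps))"
    using imaj_rotate[of "(pos \<circ> fst) p" "map (pos \<circ> fst) ps" n q]
      label_list_of_point_list(1)[OF assms] q_power_n by simp
  ultimately show ?thesis unfolding lweight_def by (simp del: set_append map_append)
qed

lemma lweight_scale:
  assumes "ps \<noteq> []" "\<gamma> \<noteq> 0"
  shows "lweight q (map (pscale \<gamma>) ps) = inverse \<gamma> ^ (n - 1) * lweight q ps"
proof -
  have "hd (map (pscale \<gamma>) ps) = pscale \<gamma> (hd ps)" using assms(1) by (rule hd_map)
  moreover have "(pos \<circ> fst) \<circ> pscale \<gamma> = pos \<circ> fst" by auto
  ultimately show ?thesis
    using assms(2) by (simp add: lweight_def power_mult_distrib)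
qed

lemma pl_mult_s:
  assumes "g \<in> carrier W"
  shows "pl (g * s) = tl (pl g) @ [hd (pl g)]"
proof -
  let ?f = "\<lambda>i. (xs i, 1 :: complex)"
  have b: "base = ?f 0 # map ?f [1..<n]" using n_ge_3 by (simp add: base_def upt_conv_Cons)
  have "map (gact s) base = map (\<lambda>i. ?f (Suc i)) [0..<n]"
    unfolding base_def map_map using xs_less by (intro map_cong refl) (simp add: gact_s pts_iff xs_Suc)
  also have "\<dots> = map ?f (map Suc [0..<n])" by simp
  also have "\<dots> = map ?f [1..<n] @ [?f n]" unfolding map_Suc_upt using n_ge_3 by simp
  finally have "pl s = map ?f [1..<n] @ [?f 0]" by (simp add: pl_def xs_bij_n(2) xs_0)
  then show ?thesis
    unfolding pl_mult[OF assms s_z_W(1)] by (simp add: pl_def b)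
qed

lemma pl_mult_z:
  assumes "g \<in> carrier W"
  shows "pl (g * z) = map (pscale (omega m)) (pl g)"
proof -
  have "gact g (gact z p) = pscale (omega m) (gact g p)" if "p \<in> set base" for p
    using that distinct_ax_base gact_z[of p] by (auto simp: distinct_ax_def gact_def pscale_def)
  then show ?thesis unfolding pl_mult[OF assms s_z_W(2)] by (simp add: pl_def)
qed

text \<open>Rotation and scaling of lists settle the two generators; the exponent n - 1 in
  \<open>lweight_scale\<close> matches the value of \<open>\<chi>\<close> at \<open>z\<close>.
  Inverses and products follow by induction over \<open>generate\<close>.\<close>

lemma F0_induced: "F0 \<in> carrier (induced_module W C \<chi>)"
proof -
  have F0_s: "F0 (g * s) = inverse (\<chi> s) * F0 g" if g: "g \<in> carrier W" for g
  proof -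
    have "length (pl g) = n" by (simp add: pl_def)
    then obtain p ps where "pl g = p # ps" using n_ge_3 by (cases "pl g") auto
    then show ?thesis
      using g lweight_rotate[of p ps] pl_point_lists[OF g]
      by (simp add: F0_def pl_mult_s monomial_group_mult(1) s_z_W \<chi>_\<sigma> q_def)
  qed
  have F0_z: "F0 (g * z) = inverse (\<chi> z) * F0 g" if g: "g \<in> carrier W" for g
  proof -
    have "length (pl g) = n" by (simp add: pl_def)
    then have "pl g \<noteq> []" using n_ge_3 by auto
    then show ?thesis
      using g lweight_scale[of "pl g" "omega m"] root_nonzero[OF omega_root[OF m_pos]]
      by (simp add: F0_def pl_mult_z monomial_group_mult(1) s_z_W \<chi>_z power_inverse)
  qed
  have "\<forall>g\<in>carrier W. F0 (g * c) = inverse (\<chi> c) * F0 g" if "c \<in> C" for c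
    using that[unfolded C]
  proof (induction rule: generate.induct)
    case one
    then show ?case using W.r_one \<chi>_one by simp
  next
    case (incl h)
    then show ?case using F0_s F0_z by auto
  next
    case (inv h)
    have h: "h \<in> carrier W" "h \<in> C" using inv s_z_W C_closed by auto
    have hi: "winv h \<in> carrier W" "winv h \<in> C" using h generate.inv[OF inv] by (auto simp: C)
    have "\<chi> (winv h) * \<chi> h = 1" using \<chi>_mult[OF hi(2) h(2)] W.l_inv[OF h(1)] \<chi>_one by simp
    then have inv_\<chi>: "inverse (\<chi> (winv h)) = \<chi> h"
      by (metis inverse_unique)
    have "F0 (g * winv h) = \<chi> h * F0 g" if g: "g \<in> carrier W" for g
    proof -
      have gi: "g * winv h \<in> carrier W" using g hi by (simp add: monomial_group_mult)
      have "g * winv h * h = g"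
        using W.m_assoc[OF g hi(1) h(1)] W.l_inv[OF h(1)] W.r_one[OF g] by simp
      moreover have "F0 (g * winv h * h) = inverse (\<chi> h) * F0 (g * winv h)"
        using inv F0_s[OF gi] F0_z[OF gi] by auto
      ultimately show ?thesis using \<chi>_nonzero[OF h(2)] by (simp add: field_simps)
    qed
    then show ?case by (simp add: inv_\<chi>)
  next
    case (eng c c')
    then have cc: "c \<in> C" "c' \<in> C" by (simp_all add: C)
    then have cW: "c \<in> carrier W" "c' \<in> carrier W" using C_subset by auto
    show ?case
    proof
      fix g assume g: "g \<in> carrier W"
      have "g * (c * c') = g * c * c'" using W.m_assoc[OF g cW] by simp
      moreover have "g * c \<in> carrier W" using g cW by (simp add: monomial_group_mult)
      ultimately show "F0 (g * (c \<otimes>\<^bsub>W\<^esub> c')) = inverse (\<chi> (c \<otimes>\<^bsub>W\<^esub> c')) * F0 g"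
        using eng.IH g \<chi>_mult[OF cc] by (simp add: mult_ac)
    qed
  qed
  then show ?thesis by (auto simp: mem_induced_module F0_def)
qed

section \<open>The isomorphism with the induced representation\<close>

abbreviation "Ind \<equiv> induced_module W C \<chi>"

definition D :: "complex mat set" where
  "D = {d \<in> carrier W. gact d (0, 1) = (0, 1)}"

lemma D_W: "d \<in> D \<Longrightarrow> d \<in> carrier W"
  by (simp add: D_def)

lemma pt_0: "(0, 1) \<in> pts"
  using n_ge_3 by (simp add: pts_iff)

lemma inv_D:
  assumes "d \<in> D"
  shows "winv d \<in> D"
proof -
  have d: "d \<in> carrier W" "gact d (0, 1) = (0, 1)" using assms by (auto simp: D_def)
  have "gact (winv d * d) (0, 1) = gact (winv d) (0, 1)"
    using gact_mult[OF W.inv_closed[OF d(1)] d(1) pt_0] d(2) by simp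
  then show ?thesis
    using W.l_inv[OF d(1)] gact_one[OF pt_0] W.inv_closed[OF d(1)] by (simp add: D_def)
qed

lemma mult_D: "d \<in> D \<Longrightarrow> d' \<in> D \<Longrightarrow> d * d' \<in> D"
  by (simp add: D_def monomial_group_mult gact_mult pt_0)

lemma finite_D: "finite D"
  using finite_W by (rule finite_subset[rotated]) (auto simp: D_def)

lemma hd_pl: "hd (pl g) = gact g (0, 1)"
  using n_ge_3 by (simp add: pl_def base_def hd_map xs_0 upt_conv_Cons)

lemma rooted_paths_subset: "rooted_paths n \<subseteq> wpath ` D"
proof
  fix p assume "p \<in> rooted_paths n"
  then obtain ps where ps: "p = path ps" "distinct_ax ps" "fst ` set ps = {..<n}" "hd ps = (0, 1)"
    by (auto simp: rooted_paths_def)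
  have "length ps = n"
    using distinct_card[of "map fst ps"] ps(2,3) by (simp add: distinct_ax_def)
  then obtain g where g: "g \<in> carrier W" "pl g = ps"
    using pl_surj[of ps] ps(2) by (auto simp: point_lists_def)
  then have "g \<in> D" using ps(4) hd_pl[of g] by (simp add: D_def)
  then show "p \<in> wpath ` D" using g ps(1) by (auto simp: wpath_def)
qed

lemma F_wpath_D:
  assumes "d \<in> D"
  shows "F (wpath d) = (if d = 1\<^sub>m n then 1 else 0)"
proof -
  have d: "d \<in> carrier W" using assms by (rule D_W)
  have "F (wpath d) = (if pl d = base then 1 else 0)"
    unfolding wpath_def
    using pl_point_lists[OF d] assms fst_point_list[OF pl_point_lists[OF d]]
    by (intro F_path_rooted) (auto simp: point_lists_def hd_pl D_def)
  moreover have "pl d = base \<longleftrightarrow> d = 1\<^sub>m n"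
    using pl_inject[OF d one_monomial_group(1)] pl_one by auto
  ultimately show ?thesis by simp
qed

text \<open>The functional dual to the path of \<open>d\<close>: translation by the inverse of
  \<open>d\<close> brings that path to the base path, which \<open>F\<close> detects.\<close>

definition coef :: "complex mat \<Rightarrow> complex vec cpoly \<Rightarrow> complex" where
  "coef d p = F (act (winv d) p)"

lemma coef_add: "coef d (p + p') = coef d p + coef d p'"
  by (simp add: coef_def sym_map_ring_hom F_add)

lemma coef_scale: "coef d (poly_const c * p) = c * coef d p"
  by (simp add: coef_def sym_map_ring_hom F_scale)

lemma coef_sum: "coef d (\<Sum>a\<in>S. f a) = (\<Sum>a\<in>S. coef d (f a))"
  by (simp add: coef_def sym_map_sum F_sum)

lemma coef_ideal: "d \<in> D \<Longrightarrow> p \<in> I \<Longrightarrow> coef d p = 0"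
  by (simp add: coef_def F_ideal act_ideal D_W)

lemma coef_cong: "d \<in> D \<Longrightarrow> p - p' \<in> I \<Longrightarrow> coef d p = coef d p'"
  using coef_ideal[of d "p - p'"] coef_add[of d "p - p'" p'] by simp

lemma coef_wpath:
  assumes "d \<in> D" "d' \<in> D"
  shows "coef d (wpath d') = (if d = d' then 1 else 0)"
proof -
  have dW: "d \<in> carrier W" "d' \<in> carrier W" using assms by (auto intro: D_W)
  have "winv d * d' = 1\<^sub>m n \<longleftrightarrow> d = d'"
    using W.l_inv[OF dW(1)] W.inv_equality[of "winv d" d'] W.inv_inv[OF dW(1)]
      W.inv_comm[of "winv d" d'] W.inv_closed[OF dW(1)] dW by auto
  then show ?thesis
    unfolding coef_def using act_wpath[OF W.inv_closed[OF dW(1)] dW(2)]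
    by (simp add: F_wpath_D mult_D inv_D assms)
qed

text \<open>Spanning yields some combination congruent to \<open>p\<close>. The dual functionals
  read off its coefficients, and they take the same values on \<open>p\<close> because they vanish
  on the ideal.\<close>

lemma top_expansion:
  assumes "p \<in> SK" "homogeneous (n - 1) p"
  shows "p - (\<Sum>d\<in>D. poly_const (coef d p) * wpath d) \<in> I"
proof -
  have "p \<in> ispan (wpath ` D)"
    by (rule ispan_trans[OF top_degree_ispan[OF assms]]) (use rooted_paths_subset ispan_base in blast)
  then obtain r where r: "r \<in> cspan (wpath ` D)" "p - r \<in> I" by (auto simp: ispan_def)
  have "r = (\<Sum>d\<in>D. poly_const (coef d r) * wpath d)"
    using r(1)
  proof induction
    case zero
    have "coef d 0 = 0" for d using coef_scale[of d 0 0] by simp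
    then show ?case by simp
  next
    case (step g r c)
    then obtain e where e: "e \<in> D" "g = wpath e" by blast
    have "coef d (poly_const c * g + r) = (if d = e then c else 0) + coef d r" if "d \<in> D" for d
      using that e by (simp add: coef_add coef_scale coef_wpath)
    then have "(\<Sum>d\<in>D. poly_const (coef d (poly_const c * g + r)) * wpath d)
        = (\<Sum>d\<in>D. (if d = e then poly_const c * wpath d else 0) + poly_const (coef d r) * wpath d)"
      by (intro sum.cong refl) (auto simp: poly_const_add ring_distribs)
    also have "\<dots> = poly_const c * g + (\<Sum>d\<in>D. poly_const (coef d r) * wpath d)"
      using e finite_D by (simp add: sum.distrib sum.delta)
    finally show ?case using step.IH by simp
  qed
  moreover have "coef d p = coef d r" if "d \<in> D" for d using coef_cong[OF that r(2)] .
  ultimately show ?thesis using r(2) by simp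
qed

text \<open>\<open>F\<close> shows that the base path is nonzero in degree n - 1, and straightening
  kills all larger degrees.\<close>

lemma internal_top_degree_eq: "internal_top_degree K \<A> = n - 1"
  unfolding internal_top_degree_def
proof (rule Greatest_equality)
  have "cls (wpath (1\<^sub>m n)) \<in> internal_comp K \<A> (n - 1)"
    unfolding internal_comp_eq
    by (intro imageI CollectI conjI homogeneous_wpath wpath_sym one_monomial_group)
  moreover have "wpath (1\<^sub>m n) \<notin> I"
    using F_ideal F_path_base by (auto simp: wpath_one)
  then have "cls (wpath (1\<^sub>m n)) \<noteq> \<zero>\<^bsub>internal_alg K \<A>\<^esub>"
    by (simp add: zero_internal_alg icoset_0 icoset_eq_ideal_iff)
  ultimately show "internal_comp K \<A> (n - 1) \<noteq> {\<zero>\<^bsub>internal_alg K \<A>\<^esub>}" by blast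
next
  fix k assume k: "internal_comp K \<A> k \<noteq> {\<zero>\<^bsub>internal_alg K \<A>\<^esub>}"
  show "k \<le> n - 1"
  proof (rule ccontr)
    assume "\<not> k \<le> n - 1"
    then have "p \<in> I" if "p \<in> SK" "homogeneous k p" for p
      using high_degree_ideal[OF that] by simp
    then have "cls p = cls 0" if "p \<in> SK" "homogeneous k p" for p
      using that by (simp add: icoset_eq_iff)
    then have "internal_comp K \<A> k \<subseteq> {cls 0}"
      unfolding internal_comp_eq by blast
    moreover have "cls 0 \<in> internal_comp K \<A> k"
      by (auto simp: internal_comp_eq sym_carrier_0)
    ultimately show False using k by (auto simp: zero_internal_alg)
  qed
qed

text \<open>The isomorphism before passage to classes, defined for all functions on the group. It is
  distinct from the linear map \<open>\<Psi>\<close> on kernel elements.\<close>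

definition Psi :: "(complex mat \<Rightarrow> complex) \<Rightarrow> complex vec cpoly" where
  "Psi f = (\<Sum>g\<in>carrier W. poly_const (f g) * wpath g)"

lemma Psi_sym: "Psi f \<in> SK"
  unfolding Psi_def by (intro sym_carrier_sum sym_carrier_scale wpath_sym)

lemma homogeneous_Psi: "homogeneous (n - 1) (Psi f)"
proof -
  have "Psi f \<in> cspan (wpath ` carrier W)"
    unfolding Psi_def by (intro cspan_sum cspan_scale cspan_base imageI)
  then show ?thesis by (rule homogeneous_cspan) (auto simp: homogeneous_wpath[simplified])
qed

lemma Psi_add: "Psi (\<lambda>g. f g + f' g) = Psi f + Psi f'"
  by (simp add: Psi_def poly_const_add ring_distribs sum.distrib)

lemma Psi_scale: "Psi (\<lambda>g. c * f g) = poly_const c * Psi f"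
  by (simp add: Psi_def poly_const_mult sum_distrib_left mult.assoc)

lemma Psi_sum: "Psi (\<lambda>g. \<Sum>a\<in>S. f a g) = (\<Sum>a\<in>S. Psi (f a))"
proof (induction S rule: infinite_finite_induct)
  case (insert a S)
  then show ?case by (simp add: Psi_add)
qed (simp_all add: Psi_def)

lemma act_Psi:
  assumes h: "h \<in> carrier W"
  shows "act h (Psi f) = Psi (induced_action W h f)"
proof -
  have "act h (Psi f) = (\<Sum>g\<in>carrier W. poly_const (f g) * wpath (h * g))"
    unfolding Psi_def sym_map_sum by (intro sum.cong refl) (simp add: sym_map_ring_hom act_wpath h)
  also have "\<dots> = (\<Sum>g\<in>carrier W. poly_const (f (winv h * g)) * wpath g)"
  proof (rule sum.reindex_bij_witness[of _ "\<lambda>g. winv h * g" "\<lambda>g. h * g"])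
    fix g assume g: "g \<in> carrier W"
    have hi: "winv h \<in> carrier W" using h by simp
    show 1: "winv h * (h * g) = g"
      using W.m_assoc[OF hi h g] W.l_inv[OF h] W.l_one[OF g] by simp
    show "h * (winv h * g) = g"
      using W.m_assoc[OF h hi g] W.r_inv[OF h] W.l_one[OF g] by simp
    show "h * g \<in> carrier W" "winv h * g \<in> carrier W"
      using g h hi by (auto intro: monomial_group_mult(1))
    show "poly_const (f (winv h * (h * g))) * wpath (h * g) = poly_const (f g) * wpath (h * g)"
      by (simp only: 1)
  qed
  also have "\<dots> = Psi (induced_action W h f)"
    unfolding Psi_def by (intro sum.cong refl) (simp add: induced_action_def)
  finally show ?thesis .
qed

sublocale Ind: group_rep W Ind "induced_action W"
  by (rule group_rep_induced_module[OF group_monomial_group C_subset])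

lemma induced_action_closed: "h \<in> carrier W \<Longrightarrow> f \<in> carrier Ind \<Longrightarrow> induced_action W h f \<in> carrier Ind"
  using Ind.rho_linear[of h]
  by (auto simp: linear_map_def mod_hom_def mod_hom_axioms_def LinearCombinations.module_hom_def)

lemma Ind_scale: "f \<in> carrier Ind \<Longrightarrow> (\<lambda>g. c * f g) \<in> carrier Ind"
  using Ind.smult_closed[of c f] by simp

lemma Ind_add: "f \<in> carrier Ind \<Longrightarrow> f' \<in> carrier Ind \<Longrightarrow> (\<lambda>g. f g + f' g) \<in> carrier Ind"
  using Ind.a_closed[of f f'] by simp

lemma Ind_sum: "(\<And>a. a \<in> S \<Longrightarrow> f a \<in> carrier Ind) \<Longrightarrow> (\<lambda>g. \<Sum>a\<in>S. f a g) \<in> carrier Ind"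
  by (auto simp: mem_induced_module sum_distrib_left intro!: sum.cong sum.neutral)

text \<open>Translates of the Klyachko function, normalised by \<open>\<kappa>\<close> so that
  \<open>Psi (B d)\<close> is congruent to the path of \<open>d\<close>.\<close>

definition B :: "complex mat \<Rightarrow> complex mat \<Rightarrow> complex" where
  "B d = (\<lambda>g. inverse \<kappa> * induced_action W d F0 g)"

lemma B_Ind: "d \<in> D \<Longrightarrow> B d \<in> carrier Ind"
  unfolding B_def by (intro Ind_scale induced_action_closed D_W F0_induced)

lemma Psi_B:
  assumes "d \<in> D"
  shows "Psi (B d) - wpath d \<in> I"
proof -
  have dW: "d \<in> carrier W" using assms by (rule D_W)
  have "Psi F0 - poly_const \<kappa> * wpath (1\<^sub>m n) \<in> I"
    using klyachko_sum[of q] by (simp add: Psi_def F0_def \<kappa>_def)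
  then have "poly_const (inverse \<kappa>) * act d (Psi F0 - poly_const \<kappa> * wpath (1\<^sub>m n)) \<in> I"
    by (intro iideal_scale act_ideal dW)
  moreover have "d * 1\<^sub>m n = d" using W.r_one[OF dW] by simp
  then have "poly_const (inverse \<kappa>) * act d (Psi F0 - poly_const \<kappa> * wpath (1\<^sub>m n)) = Psi (B d) - wpath d"
    using \<kappa>_nonzero act_wpath[OF dW one_monomial_group(1)]
    by (simp add: sym_map_ring_hom act_Psi[OF dW] B_def Psi_scale right_diff_distrib
        mult.assoc[symmetric] poly_const_mult[symmetric])
  ultimately show ?thesis by simp
qed

lemma Psi_combination:
  "Psi (\<lambda>g. \<Sum>d\<in>D. v d * B d g) - (\<Sum>d\<in>D. poly_const (v d) * wpath d) \<in> I"
proof -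
  have "(\<Sum>d\<in>D. poly_const (v d) * (Psi (B d) - wpath d)) \<in> I"
    by (intro iideal_sum iideal_scale Psi_B)
  then show ?thesis by (simp add: Psi_sum Psi_scale right_diff_distrib sum_subtractf)
qed

lemma coef_Psi_combination:
  assumes "d \<in> D"
  shows "coef d (Psi (\<lambda>g. \<Sum>e\<in>D. v e * B e g)) = v d"
proof -
  have "coef d (Psi (\<lambda>g. \<Sum>e\<in>D. v e * B e g)) = coef d (\<Sum>e\<in>D. poly_const (v e) * wpath e)"
    by (rule coef_cong[OF assms Psi_combination])
  also have "\<dots> = (\<Sum>e\<in>D. if e = d then v e else 0)"
    unfolding coef_sum by (intro sum.cong refl) (auto simp: coef_scale coef_wpath assms)
  also have "\<dots> = v d" using assms finite_D by (simp add: sum.delta)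
  finally show ?thesis .
qed

text \<open>\<open>C\<close> acts transitively on the points, hence \<open>W = D C\<close>.\<close>

lemma C_transitive:
  assumes "p \<in> pts"
  shows "\<exists>c\<in>C. gact c (0, 1) = p"
proof -
  have "\<exists>c\<in>C. gact c (0, 1) = (xs k, 1)" for k
  proof (induction k)
    case 0
    show ?case using C_closed(2) gact_one[OF pt_0] by (auto simp: xs_0)
  next
    case (Suc k)
    then obtain c where c: "c \<in> C" "gact c (0, 1) = (xs k, 1)" by blast
    then have cW: "c \<in> carrier W" using C_subset by blast
    have "gact (s * c) (0, 1) = (xs (Suc k), 1)"
      using gact_mult[OF s_z_W(1) cW pt_0] gact_s[OF gact_pts[OF cW pt_0]] c by (simp add: xs_Suc)
    then show ?case using C_closed(1)[OF C_closed(3) c(1)] by blast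
  qed
  then have "\<exists>c\<in>C. gact c (0, 1) = (xs k, omega m ^ l)" for k l
  proof (induction l)
    case (Suc l)
    then obtain c where c: "c \<in> C" "gact c (0, 1) = (xs k, omega m ^ l)" by blast
    then have cW: "c \<in> carrier W" using C_subset by blast
    have "gact (z * c) (0, 1) = (xs k, omega m ^ Suc l)"
      using gact_mult[OF s_z_W(2) cW pt_0] gact_z[OF gact_pts[OF cW pt_0]] c by (simp add: pscale_def)
    then show ?case using C_closed(1)[OF C_closed(4) c(1)] by blast
  qed simp
  moreover have "snd p \<in> (\<lambda>k. omega m ^ k) ` {..<m}"
    unfolding roots_unity_eq_omega[OF m_pos, symmetric] using assms by (simp add: pts_iff)
  then obtain l where "snd p = omega m ^ l" by blast
  moreover have "xs (pos (fst p)) = fst p" using assms by (intro xs_pos) (simp add: pts_iff)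
  ultimately show ?thesis by (metis prod.collapse)
qed

text \<open>Choose c in \<open>C\<close> that agrees with the inverse of \<open>g\<close> at (0, 1).
  Then g c fixes (0, 1) and lies in \<open>D\<close>, and \<open>f g\<close> is a nonzero multiple
  of \<open>f (g * c)\<close>.\<close>

lemma Ind_vanish:
  assumes f: "f \<in> carrier Ind" and "\<And>d. d \<in> D \<Longrightarrow> f d = 0"
  shows "f g = 0"
proof (cases "g \<in> carrier W")
  case True
  obtain c where c: "c \<in> C" "gact c (0, 1) = gact (winv g) (0, 1)"
    using C_transitive[OF gact_pts[OF W.inv_closed[OF True] pt_0]] by blast
  then have cW: "c \<in> carrier W" using C_subset by blast
  have "gact (g * c) (0, 1) = gact (g * winv g) (0, 1)"
    using True cW c(2) by (simp add: gact_mult pt_0)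
  also have "\<dots> = (0, 1)" using W.r_inv[OF True] gact_one[OF pt_0] by simp
  finally have "g * c \<in> D" using True cW by (simp add: D_def monomial_group_mult)
  moreover have "f (g * c) = inverse (\<chi> c) * f g" using f True c(1) by (simp add: mem_induced_module)
  ultimately show ?thesis using assms(2) \<chi>_nonzero[OF c(1)] by simp
qed (use f in \<open>simp add: mem_induced_module\<close>)

text \<open>Prescribing the values of a combination of the \<open>B e\<close> on \<open>D\<close> is
  a square system. A solution of the homogeneous system gives a function vanishing on
  \<open>D\<close>, hence zero, and \<open>coef_Psi_combination\<close> then shows that its
  coefficients vanish. So the system for the values of \<open>f\<close> is solvable, and the
  difference from \<open>f\<close> vanishes by \<open>Ind_vanish\<close>.\<close>

lemma Ind_combination:
  assumes f: "f \<in> carrier Ind"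
  shows "\<exists>v. f = (\<lambda>g. \<Sum>d\<in>D. v d * B d g)"
proof -
  have comb: "(\<lambda>g. \<Sum>d\<in>D. v d * B d g) \<in> carrier Ind" for v
    by (intro Ind_sum Ind_scale B_Ind)
  have "\<forall>d\<in>D. v d = 0" if "\<And>d. d \<in> D \<Longrightarrow> (\<Sum>e\<in>D. v e * B e d) = 0" for v
  proof
    fix d assume d: "d \<in> D"
    have "(\<lambda>g. \<Sum>e\<in>D. v e * B e g) = (\<lambda>_. 0)"
      using Ind_vanish[OF comb that] by blast
    then have "v d = coef d (Psi (\<lambda>_. 0))" using coef_Psi_combination[OF d, of v] by simp
    also have "\<dots> = 0" using coef_ideal[OF d iideal_0] by (simp add: Psi_def)
    finally show "v d = 0" .
  qed
  then obtain v where v: "\<And>d. d \<in> D \<Longrightarrow> (\<Sum>e\<in>D. v e * B e d) = f d"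
    using square_system_injective_imp_surjective[OF finite_D, of B f] by blast
  have "(\<lambda>g. f g + (-1) * (\<Sum>d\<in>D. v d * B d g)) \<in> carrier Ind"
    by (intro Ind_add f Ind_scale comb)
  then have "f g + (-1) * (\<Sum>d\<in>D. v d * B d g) = 0" for g
    by (rule Ind_vanish) (simp add: v)
  then have "f = (\<lambda>g. \<Sum>d\<in>D. v d * B d g)" by (intro ext) simp
  then show ?thesis by blast
qed

lemma carrier_V: "carrier V = cls ` {p \<in> SK. homogeneous (n - 1) p}"
  by (simp add: carrier_internal_top internal_top_degree_eq)

lemma bij_cls_Psi: "bij_betw (\<lambda>f. cls (Psi f)) (carrier Ind) (carrier V)"
  unfolding bij_betw_def
proof (intro conjI subset_antisym subsetI)
  show "inj_on (\<lambda>f. cls (Psi f)) (carrier Ind)"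
  proof (rule inj_onI)
    fix f f' assume f: "f \<in> carrier Ind" "f' \<in> carrier Ind" "cls (Psi f) = cls (Psi f')"
    obtain v v' where v: "f = (\<lambda>g. \<Sum>d\<in>D. v d * B d g)" "f' = (\<lambda>g. \<Sum>d\<in>D. v' d * B d g)"
      using Ind_combination f(1,2) by metis
    have "Psi f - Psi f' \<in> I" using f(3) by (simp add: icoset_eq_iff)
    then have "v d = v' d" if "d \<in> D" for d
      using coef_cong[OF that, of "Psi f" "Psi f'"] coef_Psi_combination[OF that] by (simp add: v)
    then show "f = f'" by (simp add: v)
  qed
next
  fix X assume "X \<in> (\<lambda>f. cls (Psi f)) ` carrier Ind"
  then show "X \<in> carrier V" using Psi_sym homogeneous_Psi by (auto simp: carrier_V)
next
  fix X assume "X \<in> carrier V"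
  then obtain p where p: "p \<in> SK" "homogeneous (n - 1) p" "X = cls p" by (auto simp: carrier_V)
  let ?f = "\<lambda>g. \<Sum>d\<in>D. coef d p * B d g"
  have "p - (\<Sum>d\<in>D. poly_const (coef d p) * wpath d) -
      (Psi ?f - (\<Sum>d\<in>D. poly_const (coef d p) * wpath d)) \<in> I"
    by (rule iideal_diff[OF top_expansion[OF p(1,2)] Psi_combination])
  then have "X = cls (Psi ?f)" by (simp add: p(3) icoset_eq_iff)
  moreover have "?f \<in> carrier Ind" by (intro Ind_sum Ind_scale B_Ind)
  ultimately show "X \<in> (\<lambda>f. cls (Psi f)) ` carrier Ind" by blast
qed

lemma rep_isomorphic_top_induced:
  "rep_isomorphic W V (dual_action m n) Ind (induced_action W)"
proof (rule rep_isomorphic_inverseI[OF group_rep_internal_top Ind.group_rep_axioms bij_cls_Psi])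
  fix f f' assume "f \<in> carrier Ind" "f' \<in> carrier Ind"
  then show "cls (Psi (f \<oplus>\<^bsub>Ind\<^esub> f')) = cls (Psi f) \<oplus>\<^bsub>V\<^esub> cls (Psi f')"
    by (simp add: Psi_add add_internal_top Psi_sym)
next
  fix c f assume "f \<in> carrier Ind"
  then show "cls (Psi (c \<odot>\<^bsub>Ind\<^esub> f)) = c \<odot>\<^bsub>V\<^esub> cls (Psi f)"
    by (simp add: Psi_scale smult_internal_top Psi_sym)
next
  fix g f assume "g \<in> carrier W" "f \<in> carrier Ind"
  then show "cls (Psi (induced_action W g f)) = dual_action m n g (cls (Psi f))"
    by (simp add: dual_action_icoset act_Psi)
qed

end

theorem theorem9p1:
  fixes m n :: nat and \<sigma> :: "nat \<Rightarrow> nat" and \<chi> :: "complex mat \<Rightarrow> complex"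
    and C :: "complex mat set"
  assumes "m \<ge> 2" and "n \<ge> 3"
    and "\<sigma> permutes {..<n}" and "cyclic_on \<sigma> {..<n}"
    and "C = generate (monomial_group m n) {perm_mat n \<sigma>, omega m \<cdot>\<^sub>m 1\<^sub>m n}"
    and "linear_character (monomial_group m n) C \<chi>"
    and "\<chi> (perm_mat n \<sigma>) = exp (2 * of_real pi * \<i> / of_nat n)"
    and "\<chi> (omega m \<cdot>\<^sub>m 1\<^sub>m n) = omega m ^ (n - 1)"
  shows "rep_isomorphic (monomial_group m n)
    (internal_top (arr_kernel m n) (dual_arr m n)) (dual_action m n)
    (induced_module (monomial_group m n) C \<chi>) (induced_action (monomial_group m n))"
proof -
  interpret cyclic_arrangement m n \<sigma> C \<chi>
    by unfold_locales (use assms in \<open>simp_all add: omega_def\<close>)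
  show ?thesis by (rule rep_isomorphic_top_induced)
qed

end
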